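(* Let $\mu$ be a Radon measure on $\mathbb{R}^n$ and let $1\leq p<\infty$. Then the measure $$\mu\llcorner\Big\{x\in\mathrm{spt}\,\mu:\limsup_{r\downarrow0}\frac{\mu(B(x,2r))}{\mu(B(x,r))}<\infty\text{ and }\widetilde J_p(\mu,x)<\infty\Big\}$$ is 1-rectifiable.
   Context: A Radon measure is 1-rectifiable if there are countably many Lipschitz $f_i:[0,1]\to\mathbb{R}^n$ with $\mu(\mathbb{R}^n\setminus\bigcup_if_i([0,1]))=0$; $\mathrm{spt}\,\mu$ is the support of $\mu$. Dyadic cubes are half open cubes $Q=\prod_{i=1}^n[j_i2^{-k},(j_i+1)2^{-k})$, $k,j_i\in\mathbb{Z}$, with side length $2^{-k}$ and $\mathrm{diam}\,Q=2^{-k}\sqrt n$; $\Delta_1(\mathbb{R}^n)$ denotes dyadic cubes of side length at most 1; $3Q$ is the concentric dilate by 3. For a bounded Borel set $E$ of positive diameter, $\beta_p(\mu,E)=\inf_\ell\big(\int_E(\mathrm{dist}(x,\ell)/\mathrm{diam}\,E)^p\,d\mu(x)/\mu(E)\big)^{1/p}$ over lines $\ell$ ($=0$ if $\mu(E)=0$). $\widetilde J_p(\mu,x)=\sum_{Q\in\Delta_1(\mathbb{R}^n)}\beta_p(\mu,3Q)^2\frac{\mathrm{diam}\,Q}{\mu(Q)}\chi_Q(x)$, with $0/0=0$, $1/0=\infty$. *)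

theory Defs
  imports "HOL-Analysis.Analysis"
begin

definition radon_measure :: "'a::euclidean_space measure \<Rightarrow> bool" where
  "radon_measure M \<longleftrightarrow> sets M = sets borel \<and> (\<forall>K. compact K \<longrightarrow> emeasure M K < \<infinity>)"

definition spt :: "'a::euclidean_space measure \<Rightarrow> 'a set" where
  "spt M = {x. \<forall>r>0. emeasure M (ball x r) > 0}"

definition outer_null :: "'a measure \<Rightarrow> 'a set \<Rightarrow> bool" where
  "outer_null M S \<longleftrightarrow> (\<exists>N\<in>null_sets M. S \<subseteq> N)"

text \<open>The restriction (mu restricted to A) is 1-rectifiable: there are countably many Lipschitz
  curves f_i on [0,1] with (mu restricted to A)(R^n minus the union of their images) = 0,
  where (mu restricted to A)(E) = mu*(A \<inter> E).\<close>
definition one_rectifiable_restr :: "'a::euclidean_space measure \<Rightarrow> 'a set \<Rightarrow> bool" where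
  "one_rectifiable_restr M A \<longleftrightarrow>
     (\<exists>f :: nat \<Rightarrow> real \<Rightarrow> 'a. (\<forall>i. \<exists>C. C-lipschitz_on {0..1} (f i)) \<and>
        outer_null M (A \<inter> (UNIV - (\<Union>i. f i ` {0..1}))))"

definition dcube :: "int \<Rightarrow> ('a::euclidean_space \<Rightarrow> int) \<Rightarrow> 'a set" where
  "dcube k j = {x. \<forall>b\<in>Basis. of_int (j b) * 2 powr (- of_int k) \<le> x \<bullet> b \<and>
                               x \<bullet> b < (of_int (j b) + 1) * 2 powr (- of_int k)}"

definition dyadic1 :: "'a::euclidean_space set set" where
  "dyadic1 = {Q. \<exists>k j. k \<ge> 0 \<and> Q = dcube k j}"

definition dcenter :: "'a::euclidean_space set \<Rightarrow> 'a" where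
  "dcenter Q = (SOME c. \<exists>k j. Q = dcube k j \<and>
       c = (\<Sum>b\<in>Basis. ((of_int (j b) + 1/2) * 2 powr (- of_int k)) *\<^sub>R b))"

definition dilate3 :: "'a::euclidean_space set \<Rightarrow> 'a set" where
  "dilate3 Q = (\<lambda>y. dcenter Q + 3 *\<^sub>R (y - dcenter Q)) ` Q"

definition lines :: "'a::euclidean_space set set" where
  "lines = {L. \<exists>a v. v \<noteq> 0 \<and> L = range (\<lambda>t::real. a + t *\<^sub>R v)}"

definition beta_p :: "'a::euclidean_space measure \<Rightarrow> real \<Rightarrow> 'a set \<Rightarrow> real" where
  "beta_p M p E = (if emeasure M E = 0 then 0 else
     (INF L\<in>lines. (enn2real (\<integral>\<^sup>+ x. ennreal ((infdist x L / diameter E) powr p) * indicator E x \<partial>M)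
                     / measure M E) powr (1 / p)))"

text \<open>The density tilde J_p(mu,x); ennreal division gives 0/0 = 0 and a/0 = \<infinity> for a > 0.\<close>
definition Jtilde :: "'a::euclidean_space measure \<Rightarrow> real \<Rightarrow> 'a \<Rightarrow> ennreal" where
  "Jtilde M p x = (\<Sum>\<^sub>\<infinity> Q\<in>dyadic1.
      ennreal ((beta_p M p (dilate3 Q))\<^sup>2 * diameter Q) / emeasure M Q * indicator Q x)"

end

theory Submission
  imports Defs "HOL-Complex_Analysis.Great_Picard"
begin

text \<open>
  The set is split into countably many bounded pieces on which the doubling constant and the Jones
  function are uniformly bounded and whose points lie only in dyadic cubes filled by the sublevel
  set of the Jones function up to a fixed proportion; what remains is a null set. Integrating the
  Jones function over the sublevel set shows that the numbers \<open>\<beta>(3Q)\<^sup>2 diam Q\<close> are summable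
  over the cubes that meet such a piece.

  Each piece lies on one Lipschitz curve. At scale \<open>2\<^bsup>-k\<^esup>\<close> a net of the piece is
  represented by the barycenters of small balls, because by convexity and doubling these lie within
  \<open>C \<beta>(3Q) diam Q\<close> of a line for \<open>3Q\<close>, for \<open>\<beta>\<close> with any exponent \<open>p \<ge> 1\<close>. The net points are
  joined by a network of short edges, which count with twice their length, and long edges, which
  count with their length plus a penalty proportional to \<open>2\<^bsup>-k\<^esup>\<close>, chosen so that the total is
  minimal. When passing to the next scale, a vertex with two short edges that leave in opposite
  directions along a line costs only \<open>O(\<beta>\<^sup>2 2\<^bsup>-k\<^esup>)\<close>, by Pythagoras. Every other vertex costs
  \<open>O(2\<^bsup>-k\<^esup>)\<close>, but by the handshake identity their number is bounded by 2 plus multiples of the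
  number of long edges, paid for by the decrease of the penalty, and of the number of vertices with
  large \<open>\<beta>\<close>. So the minimal costs stay bounded, and tours through the networks converge to a
  Lipschitz curve.
\<close>

section \<open>Tours of finite networks\<close>

text \<open>Short and long are labels, not conditions on length. Relabelling a short edge of length
  d as long changes the cost by at most g - d, where g is the penalty, so minimality alone keeps
  short edges within g; this is why they count twice. All geometry at a vertex then takes place in a
  window proportional to the scale, where one line is available. The penalty is (32N+2)r, where N
  bounds the number of net points of the next scale within r of a vertex. From one scale to the next
  each long edge releases (16N+1)r, while it can excuse up to four vertices with first order costs,
  each needing up to 4Nr for new leaves.

  A point of the set need not lie near the lines, since beta only controls averages; hence
  barycenters, which move with the scale. Keeping the net points as labels separates the
  combinatorics from these moves.

  Neither the set of doubling points nor the pieces are shown to be measurable. Densities in dyadic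
  cubes are therefore taken with respect to Borel sublevel sets of finite partial sums, and the
  final null set is built from these alone.\<close>

definition elen :: "('v \<Rightarrow> 'a::metric_space) \<Rightarrow> 'v \<times> 'v \<Rightarrow> real" where
  "elen f e = dist (f (fst e)) (f (snd e))"

text \<open>Edges are ordered pairs and are symmetrised only here. Paths may leave \<open>X\<close>,
  so part of a network counts as connected once it is connected inside the whole network.\<close>

definition links :: "('v \<times> 'v) set \<Rightarrow> 'v set \<Rightarrow> bool" where
  "links E X \<longleftrightarrow> (\<forall>u\<in>X. \<forall>v\<in>X. (u, v) \<in> (E \<union> E\<inverse>)\<^sup>*)"

lemma elen_nonneg [simp]: "0 \<le> elen f e"
  by (simp add: elen_def)

lemma links_crossing:
  assumes "links E X" "E \<subseteq> X \<times> X" "S \<subseteq> X" "S \<noteq> {}" "S \<noteq> X"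
  obtains a b e where "e \<in> E" "e = (a, b) \<or> e = (b, a)" "a \<in> S" "b \<in> X - S"
proof -
  obtain u v where uv: "u \<in> S" "v \<in> X - S" using assms(3-5) by blast
  have "(u, v) \<in> (E \<union> E\<inverse>)\<^sup>*" using assms(1,3) uv unfolding links_def by blast
  moreover have "v \<in> S \<or> (\<exists>a b. (a, b) \<in> E \<union> E\<inverse> \<and> a \<in> S \<and> b \<notin> S)" if "(u, v) \<in> (E \<union> E\<inverse>)\<^sup>*" for v
    using that by (induction) (use uv in auto)
  ultimately obtain a b where ab: "(a, b) \<in> E \<union> E\<inverse>" "a \<in> S" "b \<notin> S" using uv by blast
  show ?thesis
  proof (cases "(a, b) \<in> E")
    case True then show ?thesis using ab assms(2) by (intro that[of "(a,b)" a b]) auto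
  next
    case False then show ?thesis using ab assms(2) by (intro that[of "(b,a)" a b]) auto
  qed
qed

text \<open>Spanning tree induction: the reached set \<open>S\<close> and its tree \<open>F\<close>
  grow by one vertex and one edge crossing the boundary of \<open>S\<close>. It serves both the edge
  count and the tour.\<close>

lemma links_grow:
  assumes "links E X" "E \<subseteq> X \<times> X" "finite X" "x \<in> X"
    and base: "P {x} {}"
    and step: "\<And>S F e a b. \<lbrakk>S \<subseteq> X; F \<subseteq> E; F \<subseteq> S \<times> S; e \<in> E - F; e = (a, b) \<or> e = (b, a);
       a \<in> S; b \<in> X - S; P S F\<rbrakk> \<Longrightarrow> P (insert b S) (insert e F)"
  obtains F where "F \<subseteq> E" "P X F"
proof -
  have "\<exists>S F. S \<subseteq> X \<and> card S = Suc n \<and> F \<subseteq> E \<and> F \<subseteq> S \<times> S \<and> P S F" if "n < card X" for n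
    using that
  proof (induction n)
    case 0
    show ?case using base assms(4) by (intro exI[of _ "{x}"] exI[of _ "{}"]) auto
  next
    case (Suc n)
    then obtain S F where SF: "S \<subseteq> X" "card S = Suc n" "F \<subseteq> E" "F \<subseteq> S \<times> S" "P S F" by auto
    have "S \<noteq> {}" "S \<noteq> X" using SF(2) Suc.prems by auto
    then obtain a b e where e: "e \<in> E" "e = (a, b) \<or> e = (b, a)" "a \<in> S" "b \<in> X - S"
      using links_crossing[OF assms(1,2) SF(1)] by blast
    have "e \<in> E - F" using e SF(4) by auto
    then have "P (insert b S) (insert e F)" using step SF e by blast
    moreover have "finite S" using SF(1) assms(3) finite_subset by blast
    ultimately show ?case using SF e
      by (intro exI[of _ "insert b S"] exI[of _ "insert e F"]) auto
  qed
  moreover have "0 < card X" using assms(3,4) card_gt_0_iff by blast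
  ultimately obtain S F where "S \<subseteq> X" "card S = card X" "F \<subseteq> E" "P S F"
    by (metis Suc_diff_1 diff_less zero_less_one)
  then show ?thesis using that card_subset_eq[OF assms(3)] by metis
qed

lemma links_card:
  assumes "links E X" "E \<subseteq> X \<times> X" "finite X"
  shows "card X \<le> card E + 1"
proof (cases "X = {}")
  case False
  then obtain x where x: "x \<in> X" by blast
  have fE: "finite E" using assms finite_subset by blast
  obtain F where "F \<subseteq> E" "finite X \<and> card X \<le> card F + 1"
  proof (rule links_grow[OF assms x, where P = "\<lambda>S F. finite S \<and> card S \<le> card F + 1"])
    fix S F e a b
    assume "F \<subseteq> E" "e \<in> E - F" "b \<in> X - S" "finite S \<and> card S \<le> card F + 1"
    then show "finite (insert b S) \<and> card (insert b S) \<le> card (insert e F) + 1"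
      using finite_subset[OF \<open>F \<subseteq> E\<close> fE] by auto
  qed auto
  with card_mono[OF fE this(1)] show ?thesis by linarith
qed auto

lemma links_mono: "links E X \<Longrightarrow> E \<subseteq> E' \<Longrightarrow> links E' X"
  unfolding links_def by (meson Un_mono converse_mono in_mono rtrancl_mono)

lemma links_sym: "(a, b) \<in> (E \<union> E\<inverse>)\<^sup>* \<Longrightarrow> (b, a) \<in> (E \<union> E\<inverse>)\<^sup>*"
  by (metis converse_Un converse_converse rtrancl_converseD rtrancl_converseI sup_commute)

text \<open>The modifications of a network below (deleting, exchanging or subdividing edges) are
  checked edge by edge through this criterion.\<close>

lemma links_replace:
  assumes "links E X" "\<And>a b. (a, b) \<in> E \<Longrightarrow> (a, b) \<in> (E' \<union> E'\<inverse>)\<^sup>*"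
  shows "links E' X"
proof -
  have "E \<union> E\<inverse> \<subseteq> (E' \<union> E'\<inverse>)\<^sup>*" using assms(2) links_sym by fastforce
  then have "(E \<union> E\<inverse>)\<^sup>* \<subseteq> (E' \<union> E'\<inverse>)\<^sup>*" by (rule rtrancl_subset_rtrancl)
  then show ?thesis using assms(1) unfolding links_def by blast
qed

section \<open>Lipschitz curves running along a tree\<close>

lemma lipschitz_segment:
  fixes a b :: "'a::real_normed_vector"
  assumes "d = dist a b" "d > 0"
  shows "1-lipschitz_on X (\<lambda>t::real. a + ((t - s) / d) *\<^sub>R (b - a))"
proof (rule lipschitz_onI)
  fix t u assume "t \<in> X" "u \<in> X"
  have "(a + ((t - s) / d) *\<^sub>R (b - a)) - (a + ((u - s) / d) *\<^sub>R (b - a)) = ((t - u) / d) *\<^sub>R (b - a)"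
    by (simp add: algebra_simps diff_divide_distrib)
  then show "dist (a + ((t - s) / d) *\<^sub>R (b - a)) (a + ((u - s) / d) *\<^sub>R (b - a)) \<le> 1 * dist t u"
    using assms by (simp add: dist_norm norm_minus_commute)
qed auto

text \<open>The curve is cut at \<open>s\<close>, runs straight to \<open>b\<close> and back, and
  continues with a shifted parameter. The parameter interval grows by exactly the added length, so
  the Lipschitz constant stays 1.\<close>

lemma lipschitz_detour:
  fixes f :: "real \<Rightarrow> 'a::real_normed_vector"
  assumes f: "1-lipschitz_on {0..c} f" and s: "s \<in> {0..c}"
  obtains g where "1-lipschitz_on {0..c + 2 * dist (f s) b} g"
    "insert b (f ` {0..c}) \<subseteq> g ` {0..c + 2 * dist (f s) b}"
proof (cases "f s = b")
  case True
  then show ?thesis using that[of f] f s by auto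
next
  case False
  define d where "d = dist (f s) b"
  have d: "d > 0" using False by (simp add: d_def)
  define g3 where "g3 t = (if t \<le> s + 2 * d then b + ((t - (s + d)) / d) *\<^sub>R (f s - b) else f (t - 2 * d))" for t
  define g2 where "g2 t = (if t \<le> s + d then f s + ((t - s) / d) *\<^sub>R (b - f s) else g3 t)" for t
  define g where "g t = (if t \<le> s then f t else g2 t)" for t
  have "1-lipschitz_on {s + 2 * d..c + 2 * d} (\<lambda>t. f (t - 2 * d))"
  proof (rule lipschitz_onI)
    fix x y assume "x \<in> {s + 2 * d..c + 2 * d}" "y \<in> {s + 2 * d..c + 2 * d}"
    then have "x - 2 * d \<in> {0..c}" "y - 2 * d \<in> {0..c}" using s by auto
    from lipschitz_onD[OF f this] show "dist (f (x - 2 * d)) (f (y - 2 * d)) \<le> 1 * dist x y"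
      by (simp add: dist_real_def)
  qed auto
  then have "1-lipschitz_on {s + d..c + 2 * d} g3"
    unfolding g3_def using d
    by (intro lipschitz_on_concat lipschitz_segment) (auto simp: d_def dist_commute field_simps)
  then have "1-lipschitz_on {s..c + 2 * d} g2"
    unfolding g2_def using d
    by (intro lipschitz_on_concat lipschitz_segment) (auto simp: d_def g3_def)
  then have "1-lipschitz_on {0..c + 2 * d} g"
    unfolding g_def using d s
    by (intro lipschitz_on_concat lipschitz_on_subset[OF f]) (auto simp: d_def g2_def)
  moreover have "b \<in> g ` {0..c + 2 * d}"
    by (rule image_eqI[of _ _ "s + d"]) (use d s in \<open>auto simp: g_def g2_def\<close>)
  moreover have "f t \<in> g ` {0..c + 2 * d}" if "t \<in> {0..c}" for t
  proof (cases "t \<le> s")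
    case True
    then show ?thesis using that d by (intro image_eqI[of _ _ t]) (auto simp: g_def)
  next
    case False
    then show ?thesis using that d by (intro image_eqI[of _ _ "t + 2 * d"]) (auto simp: g_def g2_def g3_def)
  qed
  ultimately show ?thesis using that[of g] unfolding d_def by blast
qed

text \<open>Each tree edge is walked out and back, hence the factor 2. Any larger \<open>L\<close>
  is allowed because the tours of all scales must share one parameter interval; the curve waits at
  its end point.\<close>

lemma links_tour:
  fixes p :: "'v \<Rightarrow> 'a::real_normed_vector"
  assumes "links E X" "E \<subseteq> X \<times> X" "finite X" "X \<noteq> {}"
    and L: "2 * (\<Sum>e\<in>E. elen p e) \<le> L"
  obtains f where "1-lipschitz_on {0..L} f" "p ` X \<subseteq> f ` {0..L}"
proof -
  obtain x where x: "x \<in> X" using assms by blast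
  have fE: "finite E" using assms finite_subset by blast
  let ?P = "\<lambda>S F. finite F \<and> (\<exists>f. 1-lipschitz_on {0..2 * (\<Sum>e\<in>F. elen p e)} f \<and>
    p ` S \<subseteq> f ` {0..2 * (\<Sum>e\<in>F. elen p e)})"
  obtain F where F: "F \<subseteq> E" "?P X F"
  proof (rule links_grow[OF assms(1-3) x, where P = ?P])
    show "?P {x} {}" by (auto intro!: exI[of _ "\<lambda>_. p x"] lipschitz_onI)
  next
    fix S F e a b
    assume h: "F \<subseteq> E" "e \<in> E - F" "e = (a, b) \<or> e = (b, a)" "a \<in> S" "b \<in> X - S" "?P S F"
    let ?c = "2 * (\<Sum>e\<in>F. elen p e)"
    from h obtain f where f: "1-lipschitz_on {0..?c} f" "p ` S \<subseteq> f ` {0..?c}" by blast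
    then obtain s where s: "s \<in> {0..?c}" "p a = f s" using h(4) by blast
    obtain g where g: "1-lipschitz_on {0..?c + 2 * dist (f s) (p b)} g"
      "insert (p b) (f ` {0..?c}) \<subseteq> g ` {0..?c + 2 * dist (f s) (p b)}"
      using lipschitz_detour[OF f(1) s(1)] by blast
    have "elen p e = dist (f s) (p b)" using h(3) s(2) by (auto simp: elen_def dist_commute)
    then have "2 * (\<Sum>e\<in>insert e F. elen p e) = ?c + 2 * dist (f s) (p b)"
      using h by simp
    then show "?P (insert b S) (insert e F)" using g f(2) h(6) by (auto intro!: exI[of _ g])
  qed auto
  then obtain f where f: "1-lipschitz_on {0..2 * (\<Sum>e\<in>F. elen p e)} f"
    "p ` X \<subseteq> f ` {0..2 * (\<Sum>e\<in>F. elen p e)}" by blast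
  define c where "c = 2 * (\<Sum>e\<in>F. elen p e)"
  have "c \<le> 2 * (\<Sum>e\<in>E. elen p e)"
    unfolding c_def using F fE by (auto intro!: sum_mono2)
  then have c: "c \<le> L" using L by simp
  have "1-lipschitz_on {0..L} (\<lambda>t. if t \<le> c then f t else f c)"
    using f c by (intro lipschitz_on_concat) (auto simp: c_def intro!: lipschitz_onI)
  moreover have "p ` X \<subseteq> (\<lambda>t. if t \<le> c then f t else f c) ` {0..L}"
  proof -
    have "f ` {0..c} \<subseteq> (\<lambda>t. if t \<le> c then f t else f c) ` {0..L}"
      using c by auto
    then show ?thesis using f(2) by (auto simp: c_def)
  qed
  ultimately show ?thesis using that by blast
qed

text \<open>Arzela-Ascoli gives a uniform limit of a subsequence of the rescaled curves. The
  approximating points lie on these curves, so \<open>x\<close> is in the closure of the limit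
  image, which is compact.\<close>

lemma lipschitz_curve_through_limits:
  fixes A :: "'a::euclidean_space set"
  assumes tour: "\<And>k::nat. \<exists>f. 1-lipschitz_on {0..L} f \<and> V k \<subseteq> f ` {0..L}"
    and "L > 0" and bdd: "bounded (\<Union>k. V k)" and ne: "\<And>k. V k \<noteq> {}"
    and lim: "\<And>x. x \<in> A \<Longrightarrow> \<exists>v. (\<forall>k. v k \<in> V k) \<and> v \<longlonglongrightarrow> x"
  obtains f where "L-lipschitz_on {0..1::real} f" "A \<subseteq> f ` {0..1}"
proof -
  obtain f where f: "\<And>k. 1-lipschitz_on {0..L} (f k)" "\<And>k. V k \<subseteq> f k ` {0..L}"
    using tour by metis
  define h where "h k t = f k (L * t)" for k t
  have h: "L-lipschitz_on {0..1} (h k)" for k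
  proof (rule lipschitz_onI)
    fix s t :: real assume st: "s \<in> {0..1}" "t \<in> {0..1}"
    have "L * s \<in> {0..L}" "L * t \<in> {0..L}" using st \<open>L > 0\<close> by (auto simp: mult_left_le)
    from lipschitz_onD[OF f(1) this] have "dist (h k s) (h k t) \<le> dist (L * s) (L * t)"
      by (simp add: h_def)
    also have "\<dots> = L * dist s t"
      using \<open>L > 0\<close> by (simp add: dist_real_def abs_mult flip: right_diff_distrib)
    finally show "dist (h k s) (h k t) \<le> L * dist s t" .
  qed (use \<open>L > 0\<close> in auto)
  have hV: "V k \<subseteq> h k ` {0..1}" for k
  proof
    fix x assume "x \<in> V k"
    then obtain t where "t \<in> {0..L}" "x = f k t" using f(2) by blast
    then show "x \<in> h k ` {0..1}" using \<open>L > 0\<close>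
      by (intro image_eqI[of _ _ "t / L"]) (auto simp: h_def)
  qed
  obtain B where B: "\<And>k x. x \<in> V k \<Longrightarrow> norm x \<le> B" using bdd by (auto simp: bounded_iff)
  have hB: "norm (h k t) \<le> B + L" if t: "t \<in> {0..1}" for k t
  proof -
    obtain x s where x: "x \<in> V k" "x = h k s" "s \<in> {0..1}" using ne hV by blast
    have "dist (h k t) (h k s) \<le> L * dist t s" using lipschitz_onD[OF h] t x by blast
    also have "\<dots> \<le> L" using t x \<open>L > 0\<close> by (auto simp: dist_real_def intro!: mult_left_le)
    finally have "norm (h k t - h k s) \<le> L" by (simp add: dist_norm)
    then show ?thesis using B[OF x(1)] norm_triangle_sub[of "h k t" "h k s"] unfolding x(2) by linarith
  qed
  obtain g \<phi> where g: "continuous_on {0..1} g" "strict_mono (\<phi> :: nat \<Rightarrow> nat)"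
    "\<And>e. 0 < e \<Longrightarrow> \<exists>N. \<forall>n x. n \<ge> N \<and> x \<in> {0..1} \<longrightarrow> norm (h (\<phi> n) x - g x) < e"
  proof (rule Arzela_Ascoli[of "{0..1::real}" h "B + L"])
    fix x e :: real assume x: "x \<in> {0..1}" and e: "0 < e"
    show "\<exists>d. 0 < d \<and> (\<forall>n y. y \<in> {0..1} \<and> norm (x - y) < d \<longrightarrow> norm (h n x - h n y) < e)"
    proof (intro exI[of _ "e / L"] conjI allI impI)
      fix n y assume y: "y \<in> {0..1} \<and> norm (x - y) < e / L"
      then have "norm (h n x - h n y) \<le> L * norm (x - y)"
        using lipschitz_onD[OF h[of n], of x y] x by (simp add: dist_norm)
      also have "\<dots> < e" using y \<open>L > 0\<close> by (simp add: field_simps)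
      finally show "norm (h n x - h n y) < e" .
    qed (use e \<open>L > 0\<close> in auto)
  qed (use hB in auto)
  have gl: "(\<lambda>n. h (\<phi> n) x) \<longlonglongrightarrow> g x" if "x \<in> {0..1}" for x
    using g(3) that by (intro LIMSEQ_I) blast
  have "L-lipschitz_on {0..1} g"
  proof (rule lipschitz_onI)
    fix s t :: real assume st: "s \<in> {0..1}" "t \<in> {0..1}"
    show "dist (g s) (g t) \<le> L * dist s t"
      by (rule LIMSEQ_le_const2[OF tendsto_dist[OF gl gl]]) (use st lipschitz_onD[OF h] in auto)
  qed (use \<open>L > 0\<close> in auto)
  moreover have "A \<subseteq> g ` {0..1}"
  proof
    fix x assume "x \<in> A"
    then obtain v where v: "\<And>k. v k \<in> V k" "v \<longlonglongrightarrow> x" using lim by blast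
    then have vl: "(\<lambda>n. v (\<phi> n)) \<longlonglongrightarrow> x" using LIMSEQ_subseq_LIMSEQ[OF v(2) g(2)] by (simp add: o_def)
    have "x \<in> closure (g ` {0..1})"
    proof (unfold closure_approachable, intro allI impI)
      fix e :: real assume e: "e > 0"
      obtain N where N: "\<And>n y. n \<ge> N \<Longrightarrow> y \<in> {0..1} \<Longrightarrow> norm (h (\<phi> n) y - g y) < e / 2"
        using g(3)[of "e/2"] e by auto
      obtain M where M: "\<And>n. n \<ge> M \<Longrightarrow> dist (v (\<phi> n)) x < e / 2"
        using metric_LIMSEQ_D[OF vl half_gt_zero[OF e]] by blast
      obtain t where t: "t \<in> {0..1}" "v (\<phi> (max N M)) = h (\<phi> (max N M)) t"
        using v(1) hV by blast
      have "dist (g t) x \<le> dist (h (\<phi> (max N M)) t) (g t) + dist (h (\<phi> (max N M)) t) x"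
        by (rule dist_triangle3)
      also have "\<dots> < e" using N[of "max N M" t] M[of "max N M"] t by (simp add: dist_norm)
      finally show "\<exists>y\<in>g ` {0..1}. dist y x < e" using t by blast
    qed
    moreover have "closed (g ` {0..1})"
      using g(1) by (intro compact_imp_closed compact_continuous_image) auto
    ultimately show "x \<in> g ` {0..1}" by simp
  qed
  ultimately show ?thesis using that by blast
qed

section \<open>Optimal networks\<close>

definition cost :: "real \<Rightarrow> ('v \<Rightarrow> 'a::metric_space) \<Rightarrow> ('v \<times> 'v) set \<Rightarrow> ('v \<times> 'v) set \<Rightarrow> real" where
  "cost g p S T = 2 * (\<Sum>e\<in>S. elen p e) + (\<Sum>e\<in>T. elen p e + g)"

definition network :: "'v set \<Rightarrow> ('v \<times> 'v) set \<Rightarrow> ('v \<times> 'v) set \<Rightarrow> bool" where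
  "network X S T \<longleftrightarrow> S \<union> T \<subseteq> X \<times> X - Id \<and> links (S \<union> T) X"

definition optimal :: "real \<Rightarrow> ('v \<Rightarrow> 'a::metric_space) \<Rightarrow> 'v set \<Rightarrow> ('v \<times> 'v) set \<Rightarrow> ('v \<times> 'v) set \<Rightarrow> bool" where
  "optimal g p X S T \<longleftrightarrow> network X S T \<and> (\<forall>S' T'. network X S' T' \<longrightarrow> cost g p S T \<le> cost g p S' T')"

definition incident :: "('v \<times> 'v) set \<Rightarrow> 'v \<Rightarrow> ('v \<times> 'v) set" where
  "incident E v = {e \<in> E. fst e = v \<or> snd e = v}"

definition other :: "'v \<Rightarrow> 'v \<times> 'v \<Rightarrow> 'v" where
  "other v e = (if fst e = v then snd e else fst e)"

lemma elen_other: "e \<in> incident E v \<Longrightarrow> elen p e = dist (p v) (p (other v e))"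
  by (auto simp: incident_def other_def elen_def dist_commute)

lemma sum_insert_le:
  fixes f :: "'b \<Rightarrow> real"
  assumes "finite A" "f x \<ge> 0"
  shows "sum f (insert x A) \<le> f x + sum f A"
  using assms by (cases "x \<in> A") (auto simp: insert_absorb)

lemma network_finite:
  assumes "network X S T" "finite X"
  shows "finite S" "finite T"
proof -
  have "S \<union> T \<subseteq> X \<times> X" using assms(1) by (auto simp: network_def)
  then have "finite (S \<union> T)" using assms(2) finite_subset by blast
  then show "finite S" "finite T" by auto
qed

lemma optimal_exists:
  assumes "finite X"
  obtains S T where "optimal g p X S T"
proof -
  let ?N = "{(S, T). network X S T}"
  have "?N \<subseteq> Pow (X \<times> X) \<times> Pow (X \<times> X)" by (auto simp: network_def)
  then have fin: "finite ?N" using assms by (meson finite_Pow_iff finite_SigmaI finite_subset)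
  have "(u, v) \<in> ((X \<times> X - Id) \<union> (X \<times> X - Id)\<inverse>)\<^sup>*" if "u \<in> X" "v \<in> X" for u v
    using that by (cases "u = v") auto
  then have "network X (X \<times> X - Id) {}" by (auto simp: network_def links_def)
  then have ne: "?N \<noteq> {}" by blast
  obtain z where "z \<in> ?N" "\<And>z'. z' \<in> ?N \<Longrightarrow> (\<lambda>(S, T). cost g p S T) z \<le> (\<lambda>(S, T). cost g p S T) z'"
    using ex_is_arg_min_if_finite[OF fin ne, of "\<lambda>(S, T). cost g p S T"]
    by (auto simp: is_arg_min_linorder)
  then show ?thesis using that[of "fst z" "snd z"] by (auto simp: optimal_def case_prod_beta)
qed

text \<open>Otherwise relabelling the edge as long would be cheaper: it saves one copy of the length
  and adds \<open>g\<close>.\<close>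

lemma optimal_short_le:
  assumes opt: "optimal g p X S T" and "finite X" "e \<in> S" "0 \<le> g"
  shows "elen p e \<le> g"
proof -
  note nw = opt[unfolded optimal_def, THEN conjunct1]
  have fin: "finite S" "finite T" using network_finite[OF nw \<open>finite X\<close>] by auto
  have "(S - {e}) \<union> insert e T = S \<union> T" using \<open>e \<in> S\<close> by auto
  then have "network X (S - {e}) (insert e T)" using nw by (simp add: network_def)
  then have "cost g p S T \<le> cost g p (S - {e}) (insert e T)" using opt by (auto simp: optimal_def)
  also have "\<dots> \<le> 2 * ((\<Sum>e\<in>S. elen p e) - elen p e) + ((elen p e + g) + (\<Sum>e\<in>T. elen p e + g))"
    unfolding cost_def using fin \<open>e \<in> S\<close> \<open>0 \<le> g\<close>
    by (intro add_mono sum_insert_le) (auto simp: sum_diff1)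
  finally show ?thesis by (simp add: cost_def)
qed

lemma incident_adj: "e \<in> incident E v \<Longrightarrow> (v, other v e) \<in> (E \<union> E\<inverse>)"
  by (cases e) (auto simp: incident_def other_def)

text \<open>Two exchange arguments. If both edges led to the same point, as a pair and its reverse
  do, one could be deleted. Otherwise \<open>e2\<close> can be exchanged for the segment between the
  two neighbours, because \<open>e1\<close> still joins \<open>v\<close> to them.\<close>

lemma optimal_swap:
  assumes opt: "optimal g p X S T" and "finite X" and inj: "inj_on p X"
    and e: "e1 \<in> incident S v" "e2 \<in> incident S v" "e1 \<noteq> e2"
  shows "other v e1 \<noteq> other v e2"
    and "dist (p v) (p (other v e2)) \<le> dist (p (other v e1)) (p (other v e2))"
proof -
  note nw = opt[unfolded optimal_def, THEN conjunct1]
  have fin: "finite S" "finite T" using network_finite[OF nw \<open>finite X\<close>] by auto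
  define a b where "a = other v e1" and "b = other v e2"
  have eS: "e1 \<in> S" "e2 \<in> S" using e by (auto simp: incident_def)
  have sub: "S \<subseteq> X \<times> X - Id" "T \<subseteq> X \<times> X - Id" using nw by (auto simp: network_def)
  have "e1 \<in> X \<times> X - Id" "e2 \<in> X \<times> X - Id" using sub(1) eS by auto
  then have mem: "a \<in> X" "b \<in> X" "v \<in> X" "a \<noteq> v" "b \<noteq> v"
    using e(1,2) by (cases e1; cases e2; auto simp: a_def b_def other_def incident_def)+
  have e2: "e2 = (v, b) \<or> e2 = (b, v)"
    using e(2) by (cases e2) (auto simp: b_def other_def incident_def)
  have va: "(v, a) \<in> (S - {e2}) \<union> (S - {e2})\<inverse>"
    using incident_adj[of e1 "S - {e2}" v] e(1,3) by (auto simp: a_def incident_def)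
  \<comment> \<open>One connectivity argument covers both exchanges: only \<open>e2\<close> is lost,
    so only a path from \<open>v\<close> to \<open>b\<close> has to be supplied.\<close>
  have links: "links E' X" if E': "S - {e2} \<union> T \<subseteq> E'" and vb: "(v, b) \<in> (E' \<union> E'\<inverse>)\<^sup>*" for E'
  proof (rule links_replace)
    show "links (S \<union> T) X" using nw by (simp add: network_def)
    fix x y assume "(x, y) \<in> S \<union> T"
    then show "(x, y) \<in> (E' \<union> E'\<inverse>)\<^sup>*"
      using E' vb links_sym[OF vb] e2 by (cases "(x, y) = e2") auto
  qed
  \<comment> \<open>Injectivity of \<open>p\<close> makes the deletion a strict gain, which
    contradicts minimality.\<close>
  have pos: "0 < elen p e2" using elen_other[OF e(2), of p] inj mem by (auto simp: b_def inj_on_def)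
  show ab: "other v e1 \<noteq> other v e2"
  proof
    assume "other v e1 = other v e2"
    then have "a = b" by (simp add: a_def b_def)
    then have "(v, b) \<in> ((S - {e2} \<union> T) \<union> (S - {e2} \<union> T)\<inverse>)\<^sup>*" using va by auto
    then have "network X (S - {e2}) T" using links[of "S - {e2} \<union> T"] sub by (auto simp: network_def)
    then have "cost g p S T \<le> cost g p (S - {e2}) T" using opt by (auto simp: optimal_def)
    then show False using pos fin eS by (simp add: cost_def sum_diff1)
  qed
  let ?S = "insert (a, b) (S - {e2})"
  have "(v, a) \<in> ((?S \<union> T) \<union> (?S \<union> T)\<inverse>)" "(a, b) \<in> ((?S \<union> T) \<union> (?S \<union> T)\<inverse>)" using va by auto
  then have "(v, b) \<in> ((?S \<union> T) \<union> (?S \<union> T)\<inverse>)\<^sup>*" by (meson r_into_rtrancl rtrancl_trans)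
  then have "network X ?S T" using links[of "?S \<union> T"] sub mem ab by (auto simp: network_def a_def b_def)
  then have "cost g p S T \<le> cost g p ?S T" using opt by (auto simp: optimal_def)
  also have "\<dots> \<le> 2 * (elen p (a, b) + ((\<Sum>e\<in>S. elen p e) - elen p e2)) + (\<Sum>e\<in>T. elen p e + g)"
    unfolding cost_def using fin eS sum_insert_le[of "S - {e2}" "elen p" "(a, b)"]
    by (auto simp: sum_diff1)
  finally have "elen p e2 \<le> elen p (a, b)" by (simp add: cost_def)
  then show "dist (p v) (p (other v e2)) \<le> dist (p (other v e1)) (p (other v e2))"
    using elen_other[OF e(2), of p] by (simp add: elen_def a_def b_def)
qed

text \<open>Double counting; since loops are excluded, every edge has two different ends.\<close>

lemma sum_degrees:
  assumes "finite X" "E \<subseteq> X \<times> X - Id"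
  shows "(\<Sum>v\<in>X. card (incident E v)) = 2 * card E"
proof -
  have "finite E" using assms by (meson finite_Diff finite_SigmaI finite_subset)
  have "(\<Sum>v\<in>X. card (incident E v)) = (\<Sum>v\<in>X. \<Sum>e\<in>{e \<in> E. fst e = v \<or> snd e = v}. 1)"
    by (simp add: incident_def)
  also have "\<dots> = (\<Sum>e\<in>E. \<Sum>v\<in>{v \<in> X. fst e = v \<or> snd e = v}. 1)"
    using \<open>finite E\<close> assms(1) by (rule sum.swap_restrict[rotated])
  also have "\<dots> = (\<Sum>e\<in>E. 2)"
  proof (rule sum.cong)
    fix e assume "e \<in> E"
    then have "e \<in> X \<times> X - Id" using assms(2) by blast
    then have "{v \<in> X. fst e = v \<or> snd e = v} = {fst e, snd e}" "fst e \<noteq> snd e" by auto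
    then show "(\<Sum>v\<in>{v \<in> X. fst e = v \<or> snd e = v}. 1) = (2::nat)" by simp
  qed simp
  finally show ?thesis by simp
qed

text \<open>The function t plays the role of the orthogonal projection to a line such that
  all points of F have distance at most h from it.\<close>

definition flat_on :: "real \<Rightarrow> ('a::metric_space \<Rightarrow> real) \<Rightarrow> 'a set \<Rightarrow> bool" where
  "flat_on h t F \<longleftrightarrow> (\<forall>x\<in>F. \<forall>y\<in>F. \<bar>t x - t y\<bar> \<le> dist x y \<and> (dist x y)\<^sup>2 \<le> (t x - t y)\<^sup>2 + 4 * h\<^sup>2)"

lemma flat_on_le:
  assumes "flat_on h t F" "x \<in> F" "y \<in> F"
  shows "\<bar>t x - t y\<bar> \<le> dist x y"
  using assms by (auto simp: flat_on_def)

lemma flat_on_ge: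
  assumes "flat_on h t F" "x \<in> F" "y \<in> F" "0 \<le> h"
  shows "dist x y \<le> \<bar>t x - t y\<bar> + 2 * h"
proof (rule power2_le_imp_le)
  have "(dist x y)\<^sup>2 \<le> (t x - t y)\<^sup>2 + 4 * h\<^sup>2" using assms by (auto simp: flat_on_def)
  also have "\<dots> \<le> (\<bar>t x - t y\<bar> + 2 * h)\<^sup>2" using assms(4) by (simp add: power2_sum power_mult_distrib)
  finally show "(dist x y)\<^sup>2 \<le> (\<bar>t x - t y\<bar> + 2 * h)\<^sup>2" .
qed (use assms(4) in auto)

text \<open>Pythagoras, with the square root of D^2 + 4h^2 at most D + 2h^2/D: once the gap along
  the line is at least \<open>c\<close>, the error is quadratic in \<open>h\<close>. This is the
  source of all second order estimates, and so of the squares of the beta numbers.\<close>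

lemma flat_on_ge_quadratic:
  assumes "flat_on h t F" "x \<in> F" "y \<in> F" "c \<le> t y - t x" "0 < c"
  shows "dist x y \<le> t y - t x + 2 * h\<^sup>2 / c"
proof -
  define D where "D = t y - t x"
  have D: "D > 0" "c \<le> D" using assms by (auto simp: D_def)
  have "(dist x y)\<^sup>2 \<le> D\<^sup>2 + 4 * h\<^sup>2" using assms by (auto simp: flat_on_def D_def power2_commute)
  also have "\<dots> \<le> (D + 2 * h\<^sup>2 / D)\<^sup>2" using D by (simp add: power2_sum)
  finally have "dist x y \<le> D + 2 * h\<^sup>2 / D" by (rule power2_le_imp_le) (use D in auto)
  also have "\<dots> \<le> D + 2 * h\<^sup>2 / c" using D assms(5) by (intro add_left_mono divide_left_mono) auto
  finally show ?thesis by (simp add: D_def)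
qed

lemma flat_on_between:
  assumes "flat_on h t F" "a \<in> F" "x \<in> F" "b \<in> F" "t a + c \<le> t x" "t x + c \<le> t b" "0 < c"
  shows "dist a x + dist x b \<le> dist a b + 4 * h\<^sup>2 / c"
proof -
  have "dist a x \<le> t x - t a + 2 * h\<^sup>2 / c" "dist x b \<le> t b - t x + 2 * h\<^sup>2 / c"
    using assms by (auto intro!: flat_on_ge_quadratic)
  moreover have "t b - t a \<le> dist a b" using flat_on_le[OF assms(1,2,4)] by linarith
  moreover have "4 * h\<^sup>2 / c = 2 * h\<^sup>2 / c + 2 * h\<^sup>2 / c" by (simp add: field_simps)
  ultimately show ?thesis by linarith
qed

text \<open>Induction on \<open>card W\<close>: an arbitrary point \<open>x\<close> divides the
  edge, the other points fall into two halves by their projections, and the division costs the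
  excess in \<open>flat_on_between\<close>. The points need not be sorted.\<close>

lemma insert_into_edge:
  assumes flat: "flat_on h t F" and "0 < c" and "finite W"
    and "q ` insert a (insert b W) \<subseteq> F"
    and sep: "\<And>x y. x \<in> insert a (insert b W) \<Longrightarrow> y \<in> insert a (insert b W) \<Longrightarrow> x \<noteq> y \<Longrightarrow> c \<le> \<bar>t (q x) - t (q y)\<bar>"
    and between: "\<And>x. x \<in> W \<Longrightarrow> t (q a) < t (q x) \<and> t (q x) < t (q b)"
    and "a \<noteq> b"
  shows "\<exists>E. E \<subseteq> insert a (insert b W) \<times> insert a (insert b W) - Id \<and> links E (insert a (insert b W)) \<and>
    (\<Sum>e\<in>E. elen q e) \<le> dist (q a) (q b) + card W * (4 * h\<^sup>2 / c)"
  using assms(3-)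
proof (induction "card W" arbitrary: W a b rule: less_induct)
  case less
  show ?case
  proof (cases "W = {}")
    case True
    have "links {(a, b)} {a, b}" by (auto simp: links_def)
    then show ?thesis using True less.prems by (intro exI[of _ "{(a, b)}"]) (auto simp: elen_def)
  next
    case False
    then obtain x where x: "x \<in> W" by blast
    define W1 W2 where "W1 = {y \<in> W. t (q y) < t (q x)}" and "W2 = {y \<in> W. t (q x) < t (q y)}"
    \<comment> \<open>Separation of the projections excludes ties, so \<open>W1\<close> and
      \<open>W2\<close> exhaust the rest of \<open>W\<close>.\<close>
    have ne: "t (q y) \<noteq> t (q x)" if "y \<in> insert a (insert b W)" "y \<noteq> x" for y
      using less.prems(3)[of y x] that x \<open>0 < c\<close> by auto
    have W: "W = insert x (W1 \<union> W2)" using ne x by (auto simp: W1_def W2_def neq_iff)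
    have fin: "finite W1" "finite W2" using less.prems(1) by (auto simp: W1_def W2_def)
    have x12: "x \<notin> W1 \<union> W2" "W1 \<inter> W2 = {}" by (auto simp: W1_def W2_def)
    have card: "card W = Suc (card W1 + card W2)"
      unfolding W using fin x12 by (simp add: card_Un_disjoint)
    have axb: "t (q a) < t (q x)" "t (q x) < t (q b)" using less.prems(4) x by auto
    then have "a \<noteq> x" "x \<noteq> b" by auto
    have "\<exists>E. E \<subseteq> insert a (insert x W1) \<times> insert a (insert x W1) - Id \<and> links E (insert a (insert x W1)) \<and>
      (\<Sum>e\<in>E. elen q e) \<le> dist (q a) (q x) + card W1 * (4 * h\<^sup>2 / c)"
      using less.prems x axb \<open>a \<noteq> x\<close> card fin by (intro less.hyps) (auto simp: W1_def)
    then obtain E1 where E1: "E1 \<subseteq> insert a (insert x W1) \<times> insert a (insert x W1) - Id"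
      "links E1 (insert a (insert x W1))"
      "(\<Sum>e\<in>E1. elen q e) \<le> dist (q a) (q x) + card W1 * (4 * h\<^sup>2 / c)" by blast
    have "\<exists>E. E \<subseteq> insert x (insert b W2) \<times> insert x (insert b W2) - Id \<and> links E (insert x (insert b W2)) \<and>
      (\<Sum>e\<in>E. elen q e) \<le> dist (q x) (q b) + card W2 * (4 * h\<^sup>2 / c)"
      using less.prems x axb \<open>x \<noteq> b\<close> card fin by (intro less.hyps) (auto simp: W2_def)
    then obtain E2 where E2: "E2 \<subseteq> insert x (insert b W2) \<times> insert x (insert b W2) - Id"
      "links E2 (insert x (insert b W2))"
      "(\<Sum>e\<in>E2. elen q e) \<le> dist (q x) (q b) + card W2 * (4 * h\<^sup>2 / c)" by blast
    have V: "insert a (insert b W) = insert a (insert x W1) \<union> insert x (insert b W2)" using W by blast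
    have l1: "(u, x) \<in> ((E1 \<union> E2) \<union> (E1 \<union> E2)\<inverse>)\<^sup>*" if "u \<in> insert a (insert b W)" for u
    proof -
      have "links (E1 \<union> E2) (insert a (insert x W1))" "links (E1 \<union> E2) (insert x (insert b W2))"
        using links_mono E1(2) E2(2) by blast+
      then show ?thesis using that unfolding V links_def by blast
    qed
    have "links (E1 \<union> E2) (insert a (insert b W))"
      unfolding links_def using l1 links_sym[OF l1] by (meson rtrancl_trans)
    moreover have "(\<Sum>e\<in>E1 \<union> E2. elen q e) \<le> dist (q a) (q b) + card W * (4 * h\<^sup>2 / c)"
    proof -
      have "finite E1" "finite E2"
        using E1(1) E2(1) fin by (meson finite_Diff finite_SigmaI finite_insert finite_subset)+
      then have "(\<Sum>e\<in>E1 \<union> E2. elen q e) \<le> (\<Sum>e\<in>E1. elen q e) + (\<Sum>e\<in>E2. elen q e)"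
        by (simp add: sum_Un sum_nonneg)
      moreover have "dist (q a) (q x) + dist (q x) (q b) \<le> dist (q a) (q b) + 4 * h\<^sup>2 / c"
        using less.prems(2) x axb \<open>a \<noteq> x\<close> \<open>x \<noteq> b\<close> less.prems(3)[of a x] less.prems(3)[of x b] \<open>0 < c\<close>
        by (intro flat_on_between[OF flat]) auto
      moreover have "card W * (4 * h\<^sup>2 / c) = card W1 * (4 * h\<^sup>2 / c) + card W2 * (4 * h\<^sup>2 / c) + 4 * h\<^sup>2 / c"
        by (simp add: card distrib_right add_divide_distrib)
      ultimately show ?thesis using E1(3) E2(3) by linarith
    qed
    moreover have "E1 \<union> E2 \<subseteq> insert a (insert b W) \<times> insert a (insert b W) - Id"
      unfolding V using E1(1) E2(1) by blast
    ultimately show ?thesis by blast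
  qed
qed

section \<open>Refining an optimal network\<close>

lemma sum_UN_le:
  fixes f :: "'b \<Rightarrow> real"
  assumes "finite A" "\<And>x. x \<in> A \<Longrightarrow> finite (F x)" "\<And>y. 0 \<le> f y"
  shows "(\<Sum>y\<in>(\<Union>x\<in>A. F x). f y) \<le> (\<Sum>x\<in>A. \<Sum>y\<in>F x. f y)"
  using assms(1,2)
proof (induction A rule: finite_induct)
  case (insert a A)
  have "(\<Sum>y\<in>(\<Union>x\<in>insert a A. F x). f y) \<le> sum f (F a) + sum f (\<Union>x\<in>A. F x)"
    using insert assms(3) by (simp add: sum_Un sum_nonneg)
  then show ?case using insert by simp
qed simp

text \<open>The points of X and Y serve as labels; p and q give their positions at the old and the new
  scale, S and T are the short and the long edges.\<close>

locale refinement =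
  fixes X Y :: "'a::metric_space set" and p q :: "'a \<Rightarrow> 'a" and r g :: real
    and \<alpha> :: "'a \<Rightarrow> real" and t :: "'a \<Rightarrow> 'a \<Rightarrow> real" and N D :: nat
    and S T :: "('a \<times> 'a) set"
  assumes r: "0 < r" and fin: "finite Y" and XY: "X \<subseteq> Y"
    and sepX: "\<And>x y. x \<in> X \<Longrightarrow> y \<in> X \<Longrightarrow> x \<noteq> y \<Longrightarrow> r \<le> dist x y"
    and sepY: "\<And>x y. x \<in> Y \<Longrightarrow> y \<in> Y \<Longrightarrow> x \<noteq> y \<Longrightarrow> r / 2 \<le> dist x y"
    and cover: "\<And>y. y \<in> Y \<Longrightarrow> \<exists>x\<in>X. dist x y \<le> r"
    and p: "\<And>y. y \<in> Y \<Longrightarrow> dist (p y) y \<le> r / 100"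
    and q: "\<And>y. y \<in> Y \<Longrightarrow> dist (q y) y \<le> r / 100"
    and \<alpha>: "\<And>v. 0 \<le> \<alpha> v"
    and flat: "\<And>v. v \<in> X \<Longrightarrow> flat_on (\<alpha> v * r) (t v) (\<Union>x\<in>{x\<in>Y. dist v x \<le> g + 2 * r}. {p x, q x})"
    and N: "\<And>v. v \<in> X \<Longrightarrow> card {y\<in>Y. dist v y \<le> r} \<le> N"
    and D: "\<And>v. v \<in> X \<Longrightarrow> card {y\<in>Y. dist v y \<le> g + 2 * r} \<le> D"
    and g: "g = (32 * real N + 2) * r"
    and opt: "optimal g p X S T"
begin

text \<open>The vertices that cost only second order terms: two short edges at a flat vertex leave
  on different sides (\<open>good_edges\<close>), so that new points nearby fit into existing
  edges.\<close>

definition good :: "'a \<Rightarrow> bool" where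
  "good v \<longleftrightarrow> \<alpha> v \<le> 1/100 \<and> incident T v = {} \<and> card (incident S v) = 2"

definition B :: "'a set" where "B = {v\<in>X. \<not> good v}"

definition bent :: "'a set" where "bent = {v\<in>X. 1/100 < \<alpha> v}"

definition energy :: real where "energy = (\<Sum>v\<in>X. (\<alpha> v)\<^sup>2)"

section \<open>Short edges at flat vertices and the number of exceptional vertices\<close>

lemma finX: "finite X" using fin XY finite_subset by blast

lemma nw: "network X S T" using opt by (simp add: optimal_def)

lemma sub: "S \<subseteq> X \<times> X - Id" "T \<subseteq> X \<times> X - Id" using nw by (auto simp: network_def)

lemma finST: "finite S" "finite T" using network_finite[OF nw finX] by auto

lemma g_nonneg: "0 \<le> g" using g r by simp

lemma fin_incident: "finite (incident S v)" "finite (incident T v)"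
  using finST by (auto simp: incident_def)

lemma dist_pp: assumes "x \<in> X" "y \<in> X" "x \<noteq> y" shows "98/100 * r \<le> dist (p x) (p y)"
proof -
  have "x \<in> Y" "y \<in> Y" using assms XY by auto
  from p[OF this(1)] p[OF this(2)] sepX[OF assms] dist_triangle[of x y "p x"] dist_triangle[of "p x" y "p y"]
  show ?thesis by (simp add: dist_commute)
qed

lemma dist_pq: assumes "x \<in> Y" shows "dist (p x) (q x) \<le> r / 50"
  using p[OF assms] q[OF assms] dist_triangle2[of "p x" "q x" x] by auto

lemma dist_qq: assumes "x \<in> Y" "y \<in> Y" "x \<noteq> y" shows "48/100 * r \<le> dist (q x) (q y)"
  using sepY[OF assms] q[of x] q[of y] assms dist_triangle[of x y "q x"] dist_triangle[of "q x" y "q y"]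
  by (auto simp: dist_commute)

lemma injp: "inj_on p X"
  using dist_pp r by (force simp: inj_on_def)

lemma other_mem:
  assumes "e \<in> incident S v"
  shows "v \<in> X" "other v e \<in> X" "other v e \<noteq> v" "dist v (other v e) \<le> g + r / 50" "dist (p v) (p (other v e)) \<le> g"
proof -
  have e: "e \<in> S" using assms by (auto simp: incident_def)
  then have "e \<in> X \<times> X - Id" using sub by auto
  then show *: "v \<in> X" "other v e \<in> X" "other v e \<noteq> v"
    using assms by (cases e; auto simp: incident_def other_def)+
  show le: "dist (p v) (p (other v e)) \<le> g"
    using optimal_short_le[OF opt finX e g_nonneg] elen_other[OF assms, of p] by simp
  have "v \<in> Y" "other v e \<in> Y" using * XY by auto
  from p[OF this(1)] p[OF this(2)] le dist_triangle[of v "other v e" "p v"]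
    dist_triangle[of "p v" "other v e" "p (other v e)"]
  show "dist v (other v e) \<le> g + r / 50" by (simp add: dist_commute)
qed

text \<open>The label of a neighbour along a short edge is within \<open>g + r / 50\<close>, and
  that of a new point belonging to the neighbour within a further \<open>r\<close>. Old and new
  positions are both included because the vertices are moved one at a time.\<close>

abbreviation window :: "'a \<Rightarrow> 'a set" where
  "window v \<equiv> \<Union>x\<in>{x\<in>Y. dist v x \<le> g + 2 * r}. {p x, q x}"

lemma window_other:
  assumes "e \<in> incident S v"
  shows "p (other v e) \<in> window v" "q (other v e) \<in> window v"
  using other_mem[OF assms] XY r by auto

lemma window_self: assumes "v \<in> X" shows "p v \<in> window v" "q v \<in> window v"
  using assms XY r g_nonneg by auto

text \<open>At a flat vertex the flatness error \<open>2 * \<alpha> v * r\<close> is at most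
  \<open>r / 50\<close>. This turns the geometric case distinctions below into linear
  inequalities.\<close>

lemma spread:
  assumes v: "v \<in> X" "\<alpha> v \<le> 1/100" and xy: "x \<in> window v" "y \<in> window v"
  shows "dist x y \<le> \<bar>t v x - t v y\<bar> + r / 50" "\<bar>t v x - t v y\<bar> \<le> dist x y"
proof -
  have "\<alpha> v * r \<le> r / 100" using v(2) r by (simp add: field_simps)
  then show "dist x y \<le> \<bar>t v x - t v y\<bar> + r / 50"
    using flat_on_ge[OF flat[OF v(1)] xy] \<alpha>[of v] r mult_nonneg_nonneg[of "\<alpha> v" r] by linarith
  show "\<bar>t v x - t v y\<bar> \<le> dist x y" by (rule flat_on_le[OF flat[OF v(1)] xy])
qed

text \<open>In an optimal network the short edges at a flat vertex leave it in opposite directions: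
  otherwise the longer one could be replaced by the segment between the two neighbours.\<close>

lemma opposite_sides:
  assumes v: "\<alpha> v \<le> 1/100" and e: "e1 \<in> incident S v" "e2 \<in> incident S v" "e1 \<noteq> e2"
  shows "t v (p v) < t v (p (other v e1)) \<longleftrightarrow> \<not> t v (p v) < t v (p (other v e2))"
proof -
  define a b where "a = other v e1" and "b = other v e2"
  note sw = optimal_swap[OF opt finX injp]
  have ne: "a \<noteq> b" using sw(1)[OF e] by (simp add: a_def b_def)
  have vX: "v \<in> X" using other_mem(1)[OF e(1)] .
  note w = window_self[OF vX] window_other[OF e(1), folded a_def] window_other[OF e(2), folded b_def]
  have 1: "dist (p v) (p b) \<le> dist (p a) (p b)" "dist (p v) (p a) \<le> dist (p b) (p a)"
    using sw(2)[OF e] sw(2)[OF e(2,1)] e(3) by (auto simp: a_def b_def)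
  have 2: "98/100 * r \<le> dist (p v) (p a)" "98/100 * r \<le> dist (p v) (p b)" "98/100 * r \<le> dist (p a) (p b)"
    using dist_pp other_mem[OF e(1)] other_mem[OF e(2)] ne by (auto simp: a_def b_def)
  note sp = spread[OF vX v]
  show ?thesis
    using sp[OF w(1) w(3)] sp[OF w(1) w(5)] sp[OF w(3) w(5)] 1 2 r
    unfolding a_def[symmetric] b_def[symmetric] dist_commute[of "p b" "p a"] by linarith
qed

lemma other_inj: "inj_on (other v) (incident S v)"
  by (rule inj_onI) (use optimal_swap(1)[OF opt finX injp] in blast)

text \<open>Different short edges at \<open>v\<close> lead to different net points, all of them
  counted by the packing number \<open>D\<close>.\<close>

lemma card_incident_le: "card (incident S v) \<le> D"
proof (cases "incident S v = {}")
  case False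
  then have v: "v \<in> X" using other_mem by blast
  have "other v ` incident S v \<subseteq> {y\<in>Y. dist v y \<le> g + 2 * r}"
  proof clarify
    fix e assume "e \<in> incident S v"
    from other_mem[OF this] show "other v e \<in> Y \<and> dist v (other v e) \<le> g + 2 * r" using XY r by auto
  qed
  then have "card (incident S v) \<le> card {y\<in>Y. dist v y \<le> g + 2 * r}"
    using other_inj fin by (intro card_inj_on_le[of "other v"]) auto
  then show ?thesis using D[OF v] by simp
qed auto

text \<open>A third short edge would leave on the same side as one of the others.\<close>

lemma card_incident_flat: assumes "\<alpha> v \<le> 1/100" shows "card (incident S v) \<le> 2"
proof -
  have "inj_on (\<lambda>e. t v (p v) < t v (p (other v e))) (incident S v)"
    using opposite_sides[OF assms] by (auto simp: inj_on_def)
  then have "card (incident S v) \<le> card (UNIV :: bool set)"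
    by (intro card_inj_on_le) auto
  then show ?thesis by simp
qed

text \<open>The handshake identity bounds the number of leaves, and hence of all vertices at which
  the refinement costs an amount of first order.\<close>

lemma card_B: "real (card B) \<le> 2 + 4 * real (card T) + real D * real (card bent)"
proof (cases "X = {}")
  case True
  have "B \<subseteq> X" unfolding B_def by blast
  then show ?thesis unfolding True by simp
next
  case False
  let ?s = "\<lambda>v. real (card (incident S v))" and ?l = "\<lambda>v. real (card (incident T v))"
  \<comment> \<open>Summed over \<open>X\<close>, the term \<open>2 - ?s v - ?l v\<close> gives at
    most 2, since a connected network has at least \<open>card X - 1\<close> edges. At a flat vertex
    without long edges that is not good it is at least 1. The other terms make up for vertices with
    long edges and for bent ones, where it may be negative.\<close>
  have vert: "(if good v then 0 else (1::real)) \<le> (2 - ?s v - ?l v) + 2 * ?l v + real D * (if 1/100 < \<alpha> v then 1 else (0::real))" for v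
  proof (cases "1/100 < \<alpha> v")
    case True
    then show ?thesis using card_incident_le[of v] by (auto simp: good_def)
  next
    case False
    then have s2: "card (incident S v) \<le> 2" using card_incident_flat by auto
    show ?thesis
    proof (cases "incident T v = {}")
      case True
      then show ?thesis using False s2 by (auto simp: good_def)
    next
      case F: False
      then have "card (incident T v) \<ge> 1" using fin_incident by (simp add: Suc_le_eq card_gt_0_iff)
      then show ?thesis using False s2 by (auto simp: good_def)
    qed
  qed
  have "real (card B) = (\<Sum>v\<in>X. if good v then 0 else 1)"
    using finX by (simp add: B_def sum.If_cases Int_def)
  also have "\<dots> \<le> (\<Sum>v\<in>X. (2 - ?s v - ?l v) + 2 * ?l v + real D * (if 1/100 < \<alpha> v then 1 else (0::real)))"
    by (rule sum_mono) (use vert in auto)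
  also have "\<dots> = 2 * card X - (\<Sum>v\<in>X. ?s v) - (\<Sum>v\<in>X. ?l v) + 2 * (\<Sum>v\<in>X. ?l v) + D * real (card bent)"
    using finX by (simp add: sum.distrib sum_subtractf sum_distrib_left[symmetric] sum.If_cases bent_def Int_def)
  also have "(\<Sum>v\<in>X. ?s v) = 2 * real (card S)"
    using sum_degrees[OF finX sub(1)] by (metis of_nat_mult of_nat_numeral of_nat_sum)
  also have "(\<Sum>v\<in>X. ?l v) = 2 * real (card T)"
    using sum_degrees[OF finX sub(2)] by (metis of_nat_mult of_nat_numeral of_nat_sum)
  finally have "real (card B) \<le> 2 * card X - 2 * card S + 2 * card T + D * real (card bent)" by simp
  moreover have "card X \<le> card S + card T + 1"
    using links_card[of "S \<union> T" X] nw finX card_Un_le[of S T] by (force simp: network_def)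
  ultimately show ?thesis by linarith
qed

text \<open>Chebyshev's inequality with threshold \<open>1/100\<close>.\<close>

lemma card_bent: "real (card bent) \<le> 10000 * energy"
proof -
  have "real (card bent) = (\<Sum>v\<in>bent. 1)" by simp
  also have "\<dots> \<le> (\<Sum>v\<in>bent. 10000 * (\<alpha> v)\<^sup>2)"
  proof (rule sum_mono)
    fix v assume "v \<in> bent"
    then have "(1/100)\<^sup>2 \<le> (\<alpha> v)\<^sup>2" by (intro power_mono) (auto simp: bent_def)
    then show "1 \<le> 10000 * (\<alpha> v)\<^sup>2" by (simp add: power2_eq_square)
  qed
  also have "\<dots> \<le> (\<Sum>v\<in>X. 10000 * (\<alpha> v)\<^sup>2)" using finX by (intro sum_mono2) (auto simp: bent_def)
  finally show ?thesis by (simp add: energy_def sum_distrib_left)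
qed

text \<open>The gap \<open>96/100 * r\<close> is the separation \<open>98/100 * r\<close> of old
  positions less the flatness error \<open>r / 50\<close>.\<close>

lemma good_edges:
  assumes "v \<in> X" "good v"
  obtains e1 e2 where "incident S v = {e1, e2}" "e1 \<noteq> e2"
    "t v (p (other v e1)) + 96/100 * r \<le> t v (p v)" "t v (p v) + 96/100 * r \<le> t v (p (other v e2))"
proof -
  have v: "\<alpha> v \<le> 1/100" using assms by (auto simp: good_def)
  have gap: "96/100 * r \<le> \<bar>t v (p v) - t v (p (other v e))\<bar>" if "e \<in> incident S v" for e
    using spread(1)[OF assms(1) v window_self(1)[OF assms(1)] window_other(1)[OF that]]
      dist_pp[of v "other v e"] other_mem[OF that] by auto
  obtain e1 e2 where e: "incident S v = {e1, e2}" "e1 \<noteq> e2"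
    using assms(2) by (auto simp: good_def card_2_iff)
  show ?thesis
  proof (cases "t v (p v) < t v (p (other v e1))")
    case True
    then have "\<not> t v (p v) < t v (p (other v e2))" using opposite_sides[OF v, of e1 e2] e by auto
    then show ?thesis using True gap[of e1] gap[of e2] e by (intro that[of e2 e1]) auto
  next
    case False
    then have "t v (p v) < t v (p (other v e2))" using opposite_sides[OF v, of e1 e2] e by auto
    then show ?thesis using False gap[of e1] gap[of e2] e by (intro that[of e1 e2]) auto
  qed
qed

section \<open>Moving the vertices to their new positions\<close>

definition mix :: "'a set \<Rightarrow> 'a \<Rightarrow> 'a" where "mix Z z = (if z \<in> Z then q z else p z)"

text \<open>The cost without the penalties, which stay fixed while the vertices move.\<close>

definition len0 :: "('a \<Rightarrow> 'a) \<Rightarrow> real" where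
  "len0 f = 2 * (\<Sum>e\<in>S. elen f e) + (\<Sum>e\<in>T. elen f e)"

lemma sum_incident:
  assumes "finite E"
  shows "(\<Sum>e\<in>E. elen (mix (insert v Z)) e) - (\<Sum>e\<in>E. elen (mix Z) e) =
    (\<Sum>e\<in>incident E v. elen (mix (insert v Z)) e - elen (mix Z) e)"
proof -
  have "(\<Sum>e\<in>E. elen (mix (insert v Z)) e) - (\<Sum>e\<in>E. elen (mix Z) e) =
    (\<Sum>e\<in>E. elen (mix (insert v Z)) e - elen (mix Z) e)" by (simp add: sum_subtractf)
  also have "\<dots> = (\<Sum>e\<in>incident E v. elen (mix (insert v Z)) e - elen (mix Z) e)"
    using assms by (intro sum.mono_neutral_right) (auto simp: incident_def elen_def mix_def)
  finally show ?thesis .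
qed

lemma elen_mix_le:
  assumes "E \<subseteq> X \<times> X - Id" "e \<in> incident E v"
  shows "elen (mix (insert v Z)) e - elen (mix Z) e \<le> r / 50"
proof -
  have "e \<in> X \<times> X - Id" "e \<in> E" using assms by (auto simp: incident_def)
  then have "other v e \<noteq> v" "v \<in> Y" using assms XY by (cases e; auto simp: incident_def other_def)+
  then have "mix (insert v Z) (other v e) = mix Z (other v e)" by (simp add: mix_def)
  moreover have "dist (mix (insert v Z) v) (mix Z v) \<le> r / 50"
    using dist_pq[OF \<open>v \<in> Y\<close>] r by (auto simp: mix_def dist_commute)
  ultimately show ?thesis
    using dist_triangle[of "mix (insert v Z) v" "mix Z (other v e)" "mix Z v"]
    unfolding elen_other[OF assms(2)] by simp
qed

definition move_cost :: "'a \<Rightarrow> real" where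
  "move_cost v = (if good v then 16 * (\<alpha> v)\<^sup>2 * r
     else r / 25 * card (incident S v) + r / 50 * card (incident T v))"

text \<open>Only \<open>v\<close> moves, so both neighbours of a good vertex stay put. Their
  distance bounds the old path through \<open>p v\<close> from below by the triangle inequality, and
  flatness bounds the new path through \<open>q v\<close> from above; the first order terms cancel.
  Short edges count twice, which turns 8 into 16.\<close>

lemma move_vertex:
  assumes "v \<in> X" "v \<notin> Z"
  shows "len0 (mix (insert v Z)) \<le> len0 (mix Z) + move_cost v"
proof -
  let ?d = "\<lambda>e. elen (mix (insert v Z)) e - elen (mix Z) e"
  have len: "len0 (mix (insert v Z)) = len0 (mix Z) + 2 * (\<Sum>e\<in>incident S v. ?d e) + (\<Sum>e\<in>incident T v. ?d e)"
    using sum_incident[OF finST(1), of v Z] sum_incident[OF finST(2), of v Z] by (simp add: len0_def)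
  show ?thesis
  proof (cases "good v")
    case False
    have "(\<Sum>e\<in>incident S v. ?d e) \<le> card (incident S v) * (r / 50)"
      by (rule sum_bounded_above) (use elen_mix_le[OF sub(1)] in auto)
    moreover have "(\<Sum>e\<in>incident T v. ?d e) \<le> card (incident T v) * (r / 50)"
      by (rule sum_bounded_above) (use elen_mix_le[OF sub(2)] in auto)
    ultimately show ?thesis using False len by (simp add: move_cost_def field_simps)
  next
    case True
    have v: "\<alpha> v \<le> 1/100" using True by (auto simp: good_def)
    obtain e1 e2 where e: "incident S v = {e1, e2}" "e1 \<noteq> e2"
      "t v (p (other v e1)) + 96/100 * r \<le> t v (p v)" "t v (p v) + 96/100 * r \<le> t v (p (other v e2))"
      using good_edges[OF assms(1) True] .
    define a b where "a = other v e1" and "b = other v e2"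
    have e12: "e1 \<in> incident S v" "e2 \<in> incident S v" using e by auto
    note oth = other_mem[OF e12(1), folded a_def] other_mem[OF e12(2), folded b_def]
    note w = window_self[OF assms(1)] window_other[OF e12(1), folded a_def] window_other[OF e12(2), folded b_def]
    \<comment> \<open>A neighbour may or may not have been moved already; the window contains both
      of its positions.\<close>
    have wa: "mix Z a \<in> window v" and wb: "mix Z b \<in> window v"
      by (cases "a \<in> Z"; cases "b \<in> Z"; use w(3-6) in \<open>simp only: mix_def if_True if_False\<close>)+
    have Y: "v \<in> Y" "a \<in> Y" "b \<in> Y" using oth XY by auto
    have pq: "\<bar>t v (p x) - t v (mix Z x)\<bar> \<le> r / 50" if "x \<in> Y" "p x \<in> window v" "q x \<in> window v" for x
      using spread(2)[OF assms(1) v that(2,3)] dist_pq[OF that(1)] r by (auto simp: mix_def)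
    have pqa: "\<bar>t v (p a) - t v (mix Z a)\<bar> \<le> r / 50" and pqb: "\<bar>t v (p b) - t v (mix Z b)\<bar> \<le> r / 50"
      using pq[OF Y(2) w(3,4)] pq[OF Y(3) w(5,6)] .
    have tv: "\<bar>t v (p v) - t v (q v)\<bar> \<le> r / 50"
      using spread(2)[OF assms(1) v w(1,2)] dist_pq[OF Y(1)] by linarith
    \<comment> \<open>The gap \<open>96/100 * r\<close> remains above \<open>r / 2\<close> after
      \<open>v\<close> and the neighbour have each shifted by at most \<open>r / 50\<close>.\<close>
    have "dist (mix Z a) (q v) + dist (q v) (mix Z b) \<le> dist (mix Z a) (mix Z b) + 4 * (\<alpha> v * r)\<^sup>2 / (r / 2)"
    proof (rule flat_on_between[OF flat[OF assms(1)] wa w(2) wb])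
      show "t v (mix Z a) + r / 2 \<le> t v (q v)"
        using e(3)[folded a_def] pqa tv r by linarith
      show "t v (q v) + r / 2 \<le> t v (mix Z b)"
        using e(4)[folded b_def] pqb tv r by linarith
    qed (use r in simp)
    also have "\<dots> \<le> dist (mix Z a) (p v) + dist (p v) (mix Z b) + 8 * (\<alpha> v)\<^sup>2 * r"
      using dist_triangle[of "mix Z a" "mix Z b" "p v"] r
      by (simp add: power_mult_distrib power2_eq_square)
    finally have "?d e1 + ?d e2 \<le> 8 * (\<alpha> v)\<^sup>2 * r"
      using oth assms(2) unfolding elen_other[OF e12(1)] elen_other[OF e12(2)] a_def[symmetric] b_def[symmetric]
      by (simp add: mix_def dist_commute)
    moreover have "(\<Sum>e\<in>incident S v. ?d e) = ?d e1 + ?d e2" using e by simp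
    moreover have "incident T v = {}" using True by (simp add: good_def)
    ultimately show ?thesis using len True by (simp add: move_cost_def)
  qed
qed

lemma move_all:
  "len0 q \<le> len0 p + 16 * r * energy + r / 25 * (2 * card B + D * card bent) + r / 25 * card T"
proof -
  have "finite Z \<Longrightarrow> Z \<subseteq> X \<Longrightarrow> len0 (mix Z) \<le> len0 p + (\<Sum>v\<in>Z. move_cost v)" for Z
  proof (induction Z rule: finite_induct)
    case empty
    have "mix {} = p" by (auto simp: mix_def)
    then show ?case by simp
  next
    case (insert v Z)
    then show ?case using move_vertex[of v Z] by auto
  qed
  from this[OF finX] have 1: "len0 (mix X) \<le> len0 p + (\<Sum>v\<in>X. move_cost v)" by simp
  have 2: "len0 (mix X) = len0 q"
  proof -
    have "elen (mix X) e = elen q e" if "e \<in> S \<union> T" for e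
    proof -
      have "e \<in> X \<times> X" using that sub by blast
      then show ?thesis by (auto simp: elen_def mix_def)
    qed
    then show ?thesis by (simp add: len0_def)
  qed
  \<comment> \<open>A vertex that is not good has at most two short edges if it is flat and at most
    \<open>D\<close> if it is bent.\<close>
  have mc: "move_cost v \<le> 16 * r * (\<alpha> v)\<^sup>2 + r / 25 * (2 * (if good v then 0 else (1::real)) + real D * (if 1/100 < \<alpha> v then 1 else (0::real)))
    + r / 50 * card (incident T v)" for v
  proof -
    define I :: real where "I = (if 1/100 < \<alpha> v then 1 else 0)"
    have "real (card (incident S v)) \<le> 2 + real D * I"
      using card_incident_le[of v] card_incident_flat[of v] by (force simp: I_def)
    then have "r / 25 * real (card (incident S v)) \<le> r / 25 * (2 + real D * I)"
      using r by (intro mult_left_mono) auto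
    moreover have "0 \<le> 16 * r * (\<alpha> v)\<^sup>2" "0 \<le> r / 25 * (real D * I)"
      "0 \<le> r / 50 * card (incident T v)" using r by (auto simp: I_def)
    ultimately show ?thesis unfolding move_cost_def I_def[symmetric] distrib_left
      by (cases "good v") auto
  qed
  have "(\<Sum>v\<in>X. move_cost v) \<le> (\<Sum>v\<in>X. 16 * r * (\<alpha> v)\<^sup>2 + r / 25 * (2 * (if good v then 0 else (1::real)) + real D * (if 1/100 < \<alpha> v then 1 else (0::real)))
    + r / 50 * card (incident T v))"
    by (rule sum_mono) (rule mc)
  also have "\<dots> = 16 * r * energy + r / 25 * (2 * (\<Sum>v\<in>X. if good v then 0 else (1::real)) + real D * (\<Sum>v\<in>X. if 1/100 < \<alpha> v then 1 else (0::real)))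
    + r / 50 * (\<Sum>v\<in>X. real (card (incident T v)))"
    by (simp only: sum.distrib sum_distrib_left[symmetric] energy_def)
  also have "(\<Sum>v\<in>X. if good v then 0 else (1::real)) = card B"
    using finX by (simp add: B_def sum.If_cases Int_def)
  also have "(\<Sum>v\<in>X. if 1/100 < \<alpha> v then 1 else (0::real)) = card bent"
    using finX by (simp add: bent_def sum.If_cases Int_def)
  also have "(\<Sum>v\<in>X. real (card (incident T v))) = 2 * real (card T)"
    using sum_degrees[OF finX sub(2)] by (metis of_nat_mult of_nat_numeral of_nat_sum)
  finally show ?thesis using 1 2 by simp
qed

section \<open>Inserting the new net points\<close>

definition parent :: "'a \<Rightarrow> 'a" where "parent y = arg_min_on (\<lambda>x. dist x y) X"

lemma parent:
  assumes "y \<in> Y"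
  shows "parent y \<in> X" "dist (parent y) y \<le> r" "\<And>x. x \<in> X \<Longrightarrow> dist (parent y) y \<le> dist x y"
proof -
  obtain x where x: "x \<in> X" "dist x y \<le> r" using cover[OF assms] by blast
  then have "X \<noteq> {}" by blast
  then show "parent y \<in> X"
    unfolding parent_def using arg_min_if_finite(1)[OF finX] by blast
  show *: "dist (parent y) y \<le> dist x y" if "x \<in> X" for x
    unfolding parent_def using arg_min_least[OF finX \<open>X \<noteq> {}\<close> that, of "\<lambda>x. dist x y"] .
  show "dist (parent y) y \<le> r" using *[OF x(1)] x(2) by simp
qed

definition btw :: "'a \<Rightarrow> 'a \<times> 'a \<Rightarrow> bool" where
  "btw y e \<longleftrightarrow> dist (q y) (q (fst e)) < elen q e \<and> dist (q y) (q (snd e)) < elen q e"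

lemma btw_other:
  "e \<in> incident S v \<Longrightarrow> btw y e \<longleftrightarrow>
    dist (q v) (q y) < dist (q v) (q (other v e)) \<and> dist (q (other v e)) (q y) < dist (q v) (q (other v e))"
  by (auto simp: btw_def elen_def incident_def other_def dist_commute)

lemma incident_subset: "e \<in> incident S v \<Longrightarrow> e \<in> S"
  by (auto simp: incident_def)

text \<open>Metric betweenness does not depend on the line, so points whose parents are either end
  of an edge can be inserted using the line of one end.\<close>

lemma child_between:
  assumes y: "y \<in> Y" "y \<notin> X" and gd: "good (parent y)"
  obtains e where "e \<in> incident S (parent y)" "btw y e"
proof -
  define v where "v = parent y"
  note par = parent[OF y(1), folded v_def]
  have v: "\<alpha> v \<le> 1/100" using gd by (auto simp: good_def v_def)
  obtain e1 e2 where e: "incident S v = {e1, e2}" "e1 \<noteq> e2"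
    "t v (p (other v e1)) + 96/100 * r \<le> t v (p v)" "t v (p v) + 96/100 * r \<le> t v (p (other v e2))"
    using good_edges[OF par(1) gd[folded v_def]] .
  have vY: "v \<in> Y" using par(1) XY by blast
  note wv = window_self[OF par(1)]
  have wy: "q y \<in> window v" using y(1) par(2) g_nonneg r by auto
  note sp = spread[OF par(1) v]
  have vy: "48/100 * r \<le> dist (q v) (q y)" using dist_qq[OF vY y(1)] y(2) par(1) by auto
  have tv: "\<bar>t v (p v) - t v (q v)\<bar> \<le> r / 50" using sp(2)[OF wv] dist_pq[OF vY] by linarith
  \<comment> \<open>The sign \<open>s\<close> treats both sides at once: it orients the line so that
    the edge and \<open>y\<close> lie in the positive direction from \<open>v\<close>.\<close>
  have *: "btw y e" if ei: "e \<in> incident S v"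
    and side: "s * s = 1" "s * (t v (p v)) + 96/100 * r \<le> s * (t v (p (other v e)))" "0 < s * (t v (q y) - t v (q v))"
    for e and s :: real
  proof -
    define b where "b = other v e"
    note ob = other_mem[OF ei, folded b_def]
    note wb = window_other[OF ei, folded b_def]
    have bY: "b \<in> Y" using ob XY by blast
    have tb: "\<bar>t v (p b) - t v (q b)\<bar> \<le> r / 50" using sp(2)[OF wb] dist_pq[OF bY] by linarith
    have dby: "48/100 * r \<le> dist (q b) (q y)" using dist_qq[OF bY y(1)] y(2) ob by auto
    \<comment> \<open>Here it matters that the parent is a nearest point of \<open>X\<close>: since
      \<open>y\<close> is not much closer to \<open>b\<close> than to \<open>v\<close>, it cannot
      lie beyond \<open>b\<close>.\<close>
    have near: "dist (q v) (q y) \<le> dist (q b) (q y) + r / 25"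
      using par(3)[OF ob(2)] q[OF vY] q[OF bY] q[OF y(1)] dist_triangle[of "q v" "q y" v] dist_triangle[of v "q y" y]
        dist_triangle[of b y "q b"] dist_triangle[of "q b" y "q y"] by (simp add: dist_commute)
    have s: "s = 1 \<or> s = -1" using side(1) by (simp add: square_eq_1_iff)
    show ?thesis
      unfolding btw_other[OF ei] b_def[symmetric]
      using s
    proof
      assume "s = 1"
      then have "t v (p v) + 96/100 * r \<le> t v (p b)" "t v (q v) < t v (q y)"
        using side(2,3)[folded b_def] by auto
      then show "dist (q v) (q y) < dist (q v) (q b) \<and> dist (q b) (q y) < dist (q v) (q b)"
        using tb tv dby near vy r sp[OF wv(2) wy] sp[OF wb(2) wy] sp[OF wv(2) wb(2)]
        by (intro conjI; linarith)
    next
      assume "s = -1"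
      then have "t v (p b) + 96/100 * r \<le> t v (p v)" "t v (q y) < t v (q v)"
        using side(2,3)[folded b_def] by auto
      then show "dist (q v) (q y) < dist (q v) (q b) \<and> dist (q b) (q y) < dist (q v) (q b)"
        using tb tv dby near vy r sp[OF wv(2) wy] sp[OF wb(2) wy] sp[OF wv(2) wb(2)]
        by (intro conjI; linarith)
    qed
  qed
  have "t v (q y) \<noteq> t v (q v)" using sp(1)[OF wv(2) wy] vy r by auto
  then consider "t v (q y) < t v (q v)" | "t v (q v) < t v (q y)" by linarith
  then show ?thesis
  proof cases
    case 1
    have "btw y e1" by (rule *[of e1 "-1"]) (use e 1 in auto)
    then show ?thesis using e that[of e1] by (auto simp: v_def)
  next
    case 2
    have "btw y e2" by (rule *[of e2 1]) (use e 2 in auto)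
    then show ?thesis using e that[of e2] by (auto simp: v_def)
  qed
qed

definition home :: "'a \<Rightarrow> 'a \<times> 'a" where "home y = (SOME e. e \<in> incident S (parent y) \<and> btw y e)"

lemma home:
  assumes "y \<in> Y" "y \<notin> X" "good (parent y)"
  shows "home y \<in> incident S (parent y)" "btw y (home y)"
proof -
  have "\<exists>e. e \<in> incident S (parent y) \<and> btw y e" using child_between[OF assms] by blast
  then have "home y \<in> incident S (parent y) \<and> btw y (home y)" unfolding home_def by (rule someI_ex)
  then show "home y \<in> incident S (parent y)" "btw y (home y)" by auto
qed

definition guests :: "'a \<times> 'a \<Rightarrow> 'a set" where
  "guests e = {y\<in>Y - X. good (parent y) \<and> home y = e}"

text \<open>Both ends are included because the guests of an edge are inserted along the line of one
  end, and an arbitrary guest decides which.\<close>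

definition edge_energy :: "'a \<times> 'a \<Rightarrow> real" where
  "edge_energy e = (\<Sum>v\<in>{v\<in>X. fst e = v \<or> snd e = v}. (\<alpha> v)\<^sup>2)"

lemma edge_energy_nonneg: "0 \<le> edge_energy e"
  by (auto simp: edge_energy_def sum_nonneg)

text \<open>One guest supplies a good end \<open>v\<close>, and the line of \<open>v\<close> serves
  for all guests, also for those whose parent is the other end. The symmetric condition
  \<open>btw\<close> is translated into an order of projections on this line.\<close>

lemma refine_edge:
  assumes eS: "e \<in> S"
  shows "\<exists>E. E \<subseteq> ({fst e, snd e} \<union> guests e) \<times> ({fst e, snd e} \<union> guests e) - Id \<and>
    links E ({fst e, snd e} \<union> guests e) \<and> (\<Sum>e'\<in>E. elen q e') \<le> elen q e + 16 * D * r * edge_energy e"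
proof (cases "guests e = {}")
  case True
  have "fst e \<noteq> snd e" using eS sub by auto
  moreover have "links {e} {fst e, snd e}" by (cases e) (auto simp: links_def)
  ultimately show ?thesis using True edge_energy_nonneg[of e] r by (intro exI[of _ "{e}"]) (cases e; auto)
next
  case False
  then obtain y0 where y0: "y0 \<in> Y" "y0 \<notin> X" "good (parent y0)" "home y0 = e" by (auto simp: guests_def)
  define v where "v = parent y0"
  have ev: "e \<in> incident S v" using home(1)[OF y0(1-3)] y0(4) by (simp add: v_def)
  have v: "\<alpha> v \<le> 1/100" using y0(3) by (auto simp: good_def v_def)
  define b where "b = other v e"
  note ob = other_mem[OF ev, folded b_def]
  have ends: "{fst e, snd e} = {v, b}" using ev by (auto simp: b_def other_def incident_def)
  have near: "y \<in> Y \<and> dist v y \<le> g + 2 * r" if "y \<in> {v, b} \<union> guests e" for y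
  proof -
    from that consider "y = v" | "y = b" | "y \<in> guests e" by blast
    then show ?thesis
    proof cases
      case 3
      then have y: "y \<in> Y" "y \<notin> X" "good (parent y)" "home y = e" by (auto simp: guests_def)
      have "parent y \<in> {fst e, snd e}" using home(1)[OF y(1-3)] y(4) by (auto simp: incident_def)
      then have "parent y \<in> {v, b}" unfolding ends .
      then have "dist v (parent y) \<le> g + r / 50" using ob g_nonneg r by auto
      then have "dist v y \<le> g + 2 * r" using parent(2)[OF y(1)] r dist_triangle[of v y "parent y"] by linarith
      then show ?thesis using y(1) by blast
    qed (use ob XY g_nonneg r in auto)
  qed
  have win: "q ` ({v, b} \<union> guests e) \<subseteq> window v" using near by blast
  \<comment> \<open>\<open>48/100 * r\<close> less the flatness error \<open>r / 50\<close> leaves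
    more than \<open>r / 4\<close>.\<close>
  have sep: "r / 4 \<le> \<bar>t v (q x) - t v (q y)\<bar>" if xy: "x \<in> {v, b} \<union> guests e" "y \<in> {v, b} \<union> guests e" "x \<noteq> y" for x y
  proof -
    have "q x \<in> window v" "q y \<in> window v" using win xy by blast+
    then have "dist (q x) (q y) \<le> \<bar>t v (q x) - t v (q y)\<bar> + r / 50" by (rule spread(1)[OF ob(1) v])
    moreover have "48/100 * r \<le> dist (q x) (q y)" using near xy by (intro dist_qq) auto
    ultimately show ?thesis using r by linarith
  qed
  \<comment> \<open>A projection beyond one end would exceed it by at least \<open>r / 4\<close>,
    more than the flatness error, and so put \<open>y\<close> farther from the opposite end than the
    two ends are from each other.\<close>
  have bt: "(t v (q v) < t v (q y) \<and> t v (q y) < t v (q b)) \<or> (t v (q b) < t v (q y) \<and> t v (q y) < t v (q v))"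
    if y: "y \<in> guests e" for y
  proof -
    have yY: "y \<in> Y" "y \<notin> X" "good (parent y)" "home y = e" using y by (auto simp: guests_def)
    then have "btw y e" using home(2) by blast
    then have m: "dist (q v) (q y) < dist (q v) (q b)" "dist (q b) (q y) < dist (q v) (q b)"
      by (auto simp: btw_other[OF ev] b_def)
    have w: "q v \<in> window v" "q b \<in> window v" "q y \<in> window v" using win y by blast+
    note sp = spread[OF ob(1) v]
    have ne: "v \<noteq> y" "b \<noteq> y" "v \<noteq> b" using yY ob by auto
    have s: "r / 4 \<le> \<bar>t v (q v) - t v (q y)\<bar>" "r / 4 \<le> \<bar>t v (q b) - t v (q y)\<bar>" "r / 4 \<le> \<bar>t v (q v) - t v (q b)\<bar>"
      using sep[of v y] sep[of b y] sep[of v b] y ne by blast+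
    show ?thesis
      using sp[OF w(1,2)] sp[OF w(1,3)] sp[OF w(2,3)] m r s
      by linarith
  qed
  have finG: "finite (guests e)" using fin by (auto simp: guests_def)
  have cardG: "card (guests e) \<le> D"
  proof -
    have "card (guests e) \<le> card {y\<in>Y. dist v y \<le> g + 2 * r}" using near fin by (intro card_mono) auto
    then show ?thesis using D[OF ob(1)] by simp
  qed
  have *: "\<exists>E. E \<subseteq> insert a (insert b' (guests e)) \<times> insert a (insert b' (guests e)) - Id \<and>
    links E (insert a (insert b' (guests e))) \<and>
    (\<Sum>e'\<in>E. elen q e') \<le> dist (q a) (q b') + card (guests e) * (4 * (\<alpha> v * r)\<^sup>2 / (r / 4))"
    if ab: "{a, b'} = {v, b}" "t v (q a) < t v (q b')" for a b'
  proof (rule insert_into_edge[OF flat[OF ob(1)] _ finG])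
    have V: "insert a (insert b' (guests e)) = {v, b} \<union> guests e" using ab(1) by blast
    show "q ` insert a (insert b' (guests e)) \<subseteq> window v" unfolding V by (rule win)
    show "r / 4 \<le> \<bar>t v (q x) - t v (q y)\<bar>"
      if "x \<in> insert a (insert b' (guests e))" "y \<in> insert a (insert b' (guests e))" "x \<noteq> y" for x y
      using that unfolding V by (rule sep)
    show "t v (q a) < t v (q x) \<and> t v (q x) < t v (q b')" if "x \<in> guests e" for x
      using bt[OF that] ab by (auto simp: doubleton_eq_iff)
  qed (use r ab in auto)
  have K: "card (guests e) * (4 * (\<alpha> v * r)\<^sup>2 / (r / 4)) \<le> 16 * D * r * edge_energy e"
  proof -
    have "4 * (\<alpha> v * r)\<^sup>2 / (r / 4) = 16 * r * (\<alpha> v)\<^sup>2" using r by (simp add: power2_eq_square)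
    moreover have "(\<alpha> v)\<^sup>2 \<le> edge_energy e"
      unfolding edge_energy_def using ev ob(1) finX by (intro member_le_sum) (auto simp: incident_def)
    ultimately have "card (guests e) * (4 * (\<alpha> v * r)\<^sup>2 / (r / 4)) \<le> real D * (16 * r * edge_energy e)"
      using cardG r by (intro mult_mono) auto
    then show ?thesis by (simp add: mult_ac)
  qed
  have "v \<noteq> b" using ob by auto
  then have "t v (q v) \<noteq> t v (q b)" using sep[of v b] r by auto
  \<comment> \<open>The orientation of the line is arbitrary, so the ends are named in the order of
    their projections.\<close>
  then obtain a b' where ab: "{a, b'} = {v, b}" "t v (q a) < t v (q b')"
    by (metis insert_commute neqE)
  have "dist (q a) (q b') = elen q e"
    using ab(1) elen_other[OF ev, of q] by (auto simp: b_def doubleton_eq_iff dist_commute)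
  moreover have "insert a (insert b' (guests e)) = {fst e, snd e} \<union> guests e" using ab(1) ends by blast
  ultimately have "\<exists>E. E \<subseteq> ({fst e, snd e} \<union> guests e) \<times> ({fst e, snd e} \<union> guests e) - Id \<and>
    links E ({fst e, snd e} \<union> guests e) \<and>
    (\<Sum>e'\<in>E. elen q e') \<le> elen q e + card (guests e) * (4 * (\<alpha> v * r)\<^sup>2 / (r / 4))"
    using *[OF ab] by simp
  then show ?thesis using K by (meson add_left_mono order_trans)
qed

text \<open>Exchanging the sums, each vertex is counted once for every short edge at it, at most
  \<open>D\<close> times.\<close>

lemma sum_edge_energy: "(\<Sum>e\<in>S. edge_energy e) \<le> D * energy"
proof -
  have "(\<Sum>e\<in>S. edge_energy e) = (\<Sum>v\<in>X. \<Sum>e\<in>{e\<in>S. fst e = v \<or> snd e = v}. (\<alpha> v)\<^sup>2)"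
    unfolding edge_energy_def by (rule sum.swap_restrict[OF finST(1) finX])
  also have "\<dots> = (\<Sum>v\<in>X. card (incident S v) * (\<alpha> v)\<^sup>2)" by (simp add: incident_def)
  also have "\<dots> \<le> (\<Sum>v\<in>X. D * (\<alpha> v)\<^sup>2)"
    by (intro sum_mono mult_right_mono) (use card_incident_le in auto)
  finally show ?thesis by (simp add: energy_def sum_distrib_left)
qed

text \<open>Each parent that is not good has at most \<open>N\<close> such points within
  \<open>r\<close>; passing from labels to positions adds at most \<open>r / 50\<close> to each
  length.\<close>

lemma new_leaves:
  "(\<Sum>y\<in>{y\<in>Y - X. \<not> good (parent y)}. elen q (parent y, y)) \<le> 2 * r * (N * card B)"
proof -
  let ?C = "{y\<in>Y - X. \<not> good (parent y)}"
  have "?C \<subseteq> (\<Union>v\<in>B. {y\<in>Y. dist v y \<le> r})"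
  proof
    fix y assume y: "y \<in> ?C"
    then have "parent y \<in> B" "dist (parent y) y \<le> r" using parent by (auto simp: B_def)
    then show "y \<in> (\<Union>v\<in>B. {y\<in>Y. dist v y \<le> r})" using y by blast
  qed
  then have "card ?C \<le> card (\<Union>v\<in>B. {y\<in>Y. dist v y \<le> r})"
    using fin finX by (intro card_mono) (auto simp: B_def)
  also have "\<dots> \<le> (\<Sum>v\<in>B. card {y\<in>Y. dist v y \<le> r})" using finX by (intro card_UN_le) (auto simp: B_def)
  also have "\<dots> \<le> card B * N" using sum_bounded_above[of B "\<lambda>v. card {y\<in>Y. dist v y \<le> r}" N] N by (auto simp: B_def)
  finally have "card ?C \<le> N * card B" by (simp add: mult.commute)
  moreover have "elen q (parent y, y) \<le> 2 * r" if "y \<in> ?C" for y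
  proof -
    have y: "y \<in> Y" "parent y \<in> Y" "dist (parent y) y \<le> r" using that parent XY by auto
    then show ?thesis
      using q[OF y(1)] q[OF y(2)] r dist_triangle[of "q (parent y)" "q y" "parent y"]
        dist_triangle[of "parent y" "q y" y] by (simp add: elen_def dist_commute)
  qed
  ultimately have "(\<Sum>y\<in>?C. elen q (parent y, y)) \<le> real (N * card B) * (2 * r)"
    using sum_bounded_above[of ?C "\<lambda>y. elen q (parent y, y)" "2 * r"] r
    by (smt (verit, best) mult_right_mono of_nat_mono)
  then show ?thesis by (simp add: mult_ac)
qed

text \<open>Long edges are kept, short edges are subdivided by their guests, and the other new
  points are attached to their parents as leaves. Connectivity goes through \<open>X\<close>: old
  edges survive as paths, and every new point is joined to its parent.\<close>

lemma refined_network: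
  obtains S' where "network Y S' T"
    "(\<Sum>e\<in>S'. elen q e) \<le> (\<Sum>e\<in>S. elen q e) + 16 * D * r * (D * energy) + 2 * r * (N * card B)"
proof -
  obtain F where F: "\<And>e. e \<in> S \<Longrightarrow> F e \<subseteq> ({fst e, snd e} \<union> guests e) \<times> ({fst e, snd e} \<union> guests e) - Id"
    "\<And>e. e \<in> S \<Longrightarrow> links (F e) ({fst e, snd e} \<union> guests e)"
    "\<And>e. e \<in> S \<Longrightarrow> (\<Sum>e'\<in>F e. elen q e') \<le> elen q e + 16 * D * r * edge_energy e"
    using refine_edge by metis
  let ?C = "{y\<in>Y - X. \<not> good (parent y)}"
  define S' where "S' = (\<Union>e\<in>S. F e) \<union> (\<lambda>y. (parent y, y)) ` ?C"
  have ends: "fst e \<in> X" "snd e \<in> X" if "e \<in> S" for e using that sub by auto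
  have FY: "F e \<subseteq> Y \<times> Y - Id" if "e \<in> S" for e
  proof -
    have "{fst e, snd e} \<union> guests e \<subseteq> Y" using ends[OF that] XY by (auto simp: guests_def)
    then show ?thesis using F(1)[OF that] by blast
  qed
  have finF: "finite (F e)" if "e \<in> S" for e
    using FY[OF that] fin by (meson finite_Diff finite_SigmaI finite_subset)
  have subS': "S' \<subseteq> Y \<times> Y - Id"
  proof -
    have "(parent y, y) \<in> Y \<times> Y - Id" if "y \<in> ?C" for y using that parent(1)[of y] XY by auto
    then have "(\<lambda>y. (parent y, y)) ` ?C \<subseteq> Y \<times> Y - Id" by (rule image_subsetI)
    moreover have "(\<Union>e\<in>S. F e) \<subseteq> Y \<times> Y - Id" using FY by (rule UN_least)
    ultimately show ?thesis unfolding S'_def by (rule Un_least[rotated])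
  qed
  let ?R = "((S' \<union> T) \<union> (S' \<union> T)\<inverse>)\<^sup>*"
  have FR: "(a, b) \<in> ?R" if "e \<in> S" "a \<in> {fst e, snd e} \<union> guests e" "b \<in> {fst e, snd e} \<union> guests e" for e a b
  proof -
    have "links (S' \<union> T) ({fst e, snd e} \<union> guests e)"
      using F(2)[OF that(1)] by (rule links_mono) (use that(1) in \<open>auto simp: S'_def\<close>)
    then show ?thesis using that(2,3) unfolding links_def by blast
  qed
  have lX: "links (S' \<union> T) X"
  proof (rule links_replace)
    show "links (S \<union> T) X" using nw by (simp add: network_def)
    fix a b assume ab: "(a, b) \<in> S \<union> T"
    show "(a, b) \<in> ?R"
    proof (cases "(a, b) \<in> S")
      case True
      then show ?thesis using FR[OF True, of a b] by simp
    next
      case False then show ?thesis using ab by auto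
    qed
  qed
  have toX: "\<exists>x\<in>X. (y, x) \<in> ?R" if y: "y \<in> Y" for y
  proof (cases "y \<in> X")
    case False
    have "(parent y, y) \<in> ?R"
    proof (cases "good (parent y)")
      case True
      have h: "home y \<in> incident S (parent y)" using home(1)[OF y False True] .
      then have "parent y \<in> {fst (home y), snd (home y)}" by (auto simp: incident_def)
      moreover have "y \<in> guests (home y)" using y False True by (auto simp: guests_def)
      ultimately show ?thesis using FR[OF incident_subset[OF h]] by blast
    next
      case bad: False
      then have "(parent y, y) \<in> S'" using y False by (simp add: S'_def)
      then show ?thesis by (intro r_into_rtrancl) simp
    qed
    from links_sym[OF this] show ?thesis using parent(1)[OF y] by (rule bexI)
  next
    case True
    then show ?thesis by (intro bexI[of _ y] rtrancl_refl)
  qed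
  have "links (S' \<union> T) Y"
    unfolding links_def
  proof (intro ballI)
    fix a b assume "a \<in> Y" "b \<in> Y"
    then obtain x y where xy: "x \<in> X" "(a, x) \<in> ?R" "y \<in> X" "(b, y) \<in> ?R" using toX by meson
    have "(x, y) \<in> ?R" using lX xy unfolding links_def by blast
    then show "(a, b) \<in> ?R" using xy(2) links_sym[OF xy(4)] by (meson rtrancl_trans)
  qed
  moreover have "T \<subseteq> Y \<times> Y - Id" using sub(2) XY by blast
  ultimately have "network Y S' T" using subS' by (simp add: network_def)
  moreover have "(\<Sum>e\<in>S'. elen q e) \<le> (\<Sum>e\<in>S. elen q e) + 16 * D * r * (D * energy) + 2 * r * (N * card B)"
  proof -
    have finC: "finite ?C" using fin by auto
    have "(\<Sum>e\<in>S'. elen q e) \<le> (\<Sum>e\<in>(\<Union>e\<in>S. F e). elen q e) + (\<Sum>e\<in>(\<lambda>y. (parent y, y)) ` ?C. elen q e)"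
      unfolding S'_def using finST finF finC by (subst sum_Un) (auto simp: sum_nonneg)
    also have "(\<Sum>e\<in>(\<lambda>y. (parent y, y)) ` ?C. elen q e) = (\<Sum>y\<in>?C. elen q (parent y, y))"
      by (subst sum.reindex) (auto simp: inj_on_def)
    also have "\<dots> \<le> 2 * r * (N * card B)" by (rule new_leaves)
    also have "(\<Sum>e\<in>(\<Union>e\<in>S. F e). elen q e) \<le> (\<Sum>e\<in>S. \<Sum>e'\<in>F e. elen q e')"
      using finST(1) finF by (intro sum_UN_le) auto
    also have "\<dots> \<le> (\<Sum>e\<in>S. elen q e + 16 * D * r * edge_energy e)" by (rule sum_mono) (rule F(3))
    also have "\<dots> = (\<Sum>e\<in>S. elen q e) + 16 * D * r * (\<Sum>e\<in>S. edge_energy e)"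
      by (simp add: sum.distrib sum_distrib_left)
    also have "\<dots> \<le> (\<Sum>e\<in>S. elen q e) + 16 * D * r * (D * energy)"
      using sum_edge_energy r by (intro add_left_mono mult_left_mono) auto
    finally show ?thesis by simp
  qed
  ultimately show ?thesis using that by blast
qed

text \<open>By \<open>card_B\<close> the first order costs contain a multiple of
  \<open>card T\<close>, which the halved penalty absorbs. What is left is of order
  \<open>r * (1 + energy)\<close>, where the plain \<open>r\<close> sums to a geometric series over
  the scales.\<close>

lemma refinement_cost:
  obtains S' where "network Y S' T"
    "cost (g / 2) q S' T \<le> cost g p S T +
      (17 + 8 * real N + 32 * (real D)\<^sup>2 + 1200 * real D + 40000 * (real N * real D)) * (r * (1 + energy))"
proof -
  obtain S' where S': "network Y S' T"
    "(\<Sum>e\<in>S'. elen q e) \<le> (\<Sum>e\<in>S. elen q e) + 16 * D * r * (D * energy) + 2 * r * (N * card B)"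
    using refined_network .
  define b c w where "b = real (card B)" and "c = real (card T)" and "w = real (card bent)"
  have nonneg: "0 \<le> energy" "0 \<le> b" "0 \<le> c" "0 \<le> w"
    by (auto simp: energy_def sum_nonneg b_def c_def w_def)
  have w: "w \<le> 10000 * energy" using card_bent by (simp add: w_def)
  have b: "b \<le> 2 + 4 * c + D * w" using card_B by (simp add: b_def c_def w_def)
  \<comment> \<open>The part \<open>16 * N\<close> offsets the \<open>4 * c\<close> in the bound for
    \<open>b\<close>, multiplied by \<open>4 * N\<close>; the remaining 1 covers the
    \<open>9/25 * c\<close> that comes from moving vertices.\<close>
  have ge: "c * g / 2 = c * g - r * (c * (16 * N + 1))" by (simp add: g field_simps)
  have "cost (g / 2) q S' T = 2 * (\<Sum>e\<in>S'. elen q e) + (\<Sum>e\<in>T. elen q e) + c * g / 2"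
    by (simp add: cost_def sum.distrib c_def)
  also have "\<dots> \<le> len0 q + 32 * D * r * (D * energy) + 4 * r * (N * b) + c * g / 2"
    using S'(2) by (simp add: len0_def b_def)
  also have "\<dots> \<le> (len0 p + 16 * r * energy + r / 25 * (2 * b + D * w) + r / 25 * c)
      + 32 * D * r * (D * energy) + 4 * r * (N * b) + c * g / 2"
    using move_all by (simp add: b_def c_def w_def)
  finally have 1: "cost (g / 2) q S' T \<le> len0 p + c * g + r * (16 * energy + 2 / 25 * b + D * w / 25 + c / 25
      + 32 * (real D)\<^sup>2 * energy + 4 * (N * b) - c * (16 * N + 1))"
    unfolding ge by (simp add: algebra_simps power2_eq_square)
  have Dw: "D * w \<le> D * (10000 * energy)" by (rule mult_left_mono[OF w]) simp
  have Nb: "N * b \<le> N * (2 + 4 * c + D * w)" by (rule mult_left_mono[OF b]) simp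
  have NDw: "N * (D * w) \<le> N * (D * (10000 * energy))" by (rule mult_left_mono[OF Dw]) simp
  have "16 * energy + 2 / 25 * b + D * w / 25 + c / 25 + 32 * (real D)\<^sup>2 * energy + 4 * (N * b) - c * (16 * N + 1)
      \<le> 1 + 8 * real N + (16 + 32 * (real D)\<^sup>2 + 1200 * real D + 40000 * (real N * real D)) * energy"
    using b Dw Nb NDw nonneg(3) by (simp add: algebra_simps)
  also have "\<dots> \<le> (17 + 8 * real N + 32 * (real D)\<^sup>2 + 1200 * real D + 40000 * (real N * real D)) * (1 + energy)"
    using nonneg(1) by (simp add: algebra_simps)
  finally have "r * (16 * energy + 2 / 25 * b + D * w / 25 + c / 25 + 32 * (real D)\<^sup>2 * energy + 4 * (N * b) - c * (16 * N + 1))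
      \<le> r * ((17 + 8 * real N + 32 * (real D)\<^sup>2 + 1200 * real D + 40000 * (real N * real D)) * (1 + energy))"
    using r by (intro mult_left_mono) auto
  moreover have "cost g p S T = len0 p + c * g" by (simp add: cost_def len0_def sum.distrib c_def)
  ultimately show ?thesis using 1 S'(1) that by (simp add: mult_ac)
qed

end

section \<open>Nets and the curve through them\<close>

text \<open>Rescaling to \<open>r = 1\<close>, a fixed ball is covered by finitely many balls of
  radius \<open>1/4\<close>, each holding at most one of the points. So the bound is uniform in
  \<open>r\<close> and \<open>v\<close>.\<close>

lemma packing_bound:
  obtains D :: nat where "\<And>r v (S::'a::euclidean_space set). \<lbrakk>r > 0; S \<subseteq> cball v (R * r);
    \<And>x y. x \<in> S \<Longrightarrow> y \<in> S \<Longrightarrow> x \<noteq> y \<Longrightarrow> r / 2 \<le> dist x y\<rbrakk> \<Longrightarrow> finite S \<and> card S \<le> D"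
proof -
  obtain K where K: "finite K" "cball (0::'a) R \<subseteq> (\<Union>k\<in>K. ball k (1/4))"
    using compact_cball[of "0::'a" R] unfolding compact_eq_totally_bounded
    by (metis zero_less_divide_1_iff zero_less_numeral)
  show ?thesis
  proof (rule that)
    fix r :: real and v :: 'a and S :: "'a set"
    assume r: "r > 0" and S: "S \<subseteq> cball v (R * r)"
      and sep: "\<And>x y. x \<in> S \<Longrightarrow> y \<in> S \<Longrightarrow> x \<noteq> y \<Longrightarrow> r / 2 \<le> dist x y"
    have "\<exists>k\<in>K. dist k ((x - v) /\<^sub>R r) < 1/4" if "x \<in> S" for x
    proof -
      have "(x - v) /\<^sub>R r \<in> cball 0 R"
      proof -
        have "norm (x - v) \<le> R * r" using S that by (auto simp: dist_norm norm_minus_commute)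
        then show ?thesis using r by (simp add: divide_le_eq flip: divide_inverse_commute)
      qed
      then have "(x - v) /\<^sub>R r \<in> (\<Union>k\<in>K. ball k (1/4))" using K(2) by blast
      then show ?thesis by (simp only: UN_iff mem_ball)
    qed
    then obtain f where f: "\<And>x. x \<in> S \<Longrightarrow> f x \<in> K \<and> dist (f x) ((x - v) /\<^sub>R r) < 1/4" by metis
    have "inj_on f S"
    proof (rule inj_onI, rule ccontr)
      fix x y assume xy: "x \<in> S" "y \<in> S" "f x = f y" "x \<noteq> y"
      have "dist ((x - v) /\<^sub>R r) ((y - v) /\<^sub>R r) < 1/2"
        using f[OF xy(1)] f[OF xy(2)] xy(3) dist_triangle3[of "(x - v) /\<^sub>R r" "(y - v) /\<^sub>R r" "f x"] by simp
      moreover have "dist ((x - v) /\<^sub>R r) ((y - v) /\<^sub>R r) = dist x y / r"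
        using r by (simp add: dist_norm divide_inverse_commute flip: scaleR_diff_right)
      ultimately have "dist x y / r < 1 / 2" by simp
      then have "dist x y < r / 2" using r by (simp add: divide_less_eq)
      then show False using sep[OF xy(1,2,4)] by simp
    qed
    moreover have "f ` S \<subseteq> K" using f by blast
    ultimately show "finite S \<and> card S \<le> card K"
      using K(1) by (meson card_inj_on_le inj_on_finite)
  qed
qed

definition separated :: "real \<Rightarrow> 'a::metric_space set \<Rightarrow> bool" where
  "separated r S \<longleftrightarrow> (\<forall>x\<in>S. \<forall>y\<in>S. x \<noteq> y \<longrightarrow> r \<le> dist x y)"

lemma separated_finite:
  fixes A :: "'a::euclidean_space set"
  assumes "bounded A" "r > 0"
  obtains D where "\<And>S. S \<subseteq> A \<Longrightarrow> separated r S \<Longrightarrow> finite S \<and> card S \<le> D"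
proof -
  obtain v B where B: "A \<subseteq> cball v B" using assms(1) bounded_subset_cball by blast
  obtain D where D: "\<And>r' v (S::'a set). \<lbrakk>r' > 0; S \<subseteq> cball v (B / (2 * r) * r');
    \<And>x y. x \<in> S \<Longrightarrow> y \<in> S \<Longrightarrow> x \<noteq> y \<Longrightarrow> r' / 2 \<le> dist x y\<rbrakk> \<Longrightarrow> finite S \<and> card S \<le> D"
    using packing_bound by blast
  show ?thesis
  proof (rule that)
    fix S assume S: "S \<subseteq> A" "separated r S"
    show "finite S \<and> card S \<le> D"
      by (rule D[of "2 * r" S v]) (use S B assms(2) in \<open>auto simp: separated_def\<close>)
  qed
qed

text \<open>A separated set of maximal cardinality is automatically a net;
  \<open>separated_finite\<close> makes the maximum exist.\<close>

lemma separated_extend: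
  fixes A :: "'a::euclidean_space set"
  assumes "bounded A" "r > 0" "S \<subseteq> A" "separated r S"
  obtains S' where "S \<subseteq> S'" "S' \<subseteq> A" "separated r S'" "finite S'" "\<And>x. x \<in> A \<Longrightarrow> \<exists>s\<in>S'. dist s x \<le> r"
proof -
  obtain D where D: "\<And>S. S \<subseteq> A \<Longrightarrow> separated r S \<Longrightarrow> finite S \<and> card S \<le> D"
    using separated_finite[OF assms(1,2)] by blast
  let ?P = "\<lambda>S'. S \<subseteq> S' \<and> S' \<subseteq> A \<and> separated r S'"
  have "?P S" using assms by blast
  moreover have "\<forall>S'. ?P S' \<longrightarrow> card S' < Suc D" using D by (simp add: less_Suc_eq_le)
  ultimately obtain S' where S': "?P S'" "\<And>S''. ?P S'' \<Longrightarrow> card S'' \<le> card S'"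
    using ex_has_greatest_nat[of ?P S card "Suc D"] by blast
  have fin: "finite S'" using D S' by blast
  have "\<exists>s\<in>S'. dist s x \<le> r" if x: "x \<in> A" for x
  proof (rule ccontr)
    assume "\<not> (\<exists>s\<in>S'. dist s x \<le> r)"
    then have far: "\<And>s. s \<in> S' \<Longrightarrow> r < dist s x" by force
    then have "x \<notin> S'" using assms(2) by force
    moreover have "?P (insert x S')" using S'(1) x far by (force simp: separated_def dist_commute)
    ultimately show False using S'(2)[of "insert x S'"] fin by simp
  qed
  then show ?thesis using that S'(1) fin by blast
qed

lemma nested_nets:
  fixes A :: "'a::euclidean_space set"
  assumes "bounded A" "\<And>k. r k > 0" "\<And>k. r (Suc k) \<le> r k"
  obtains X :: "nat \<Rightarrow> 'a set" where "\<And>k. X k \<subseteq> A" "\<And>k. finite (X k)" "\<And>k. separated (r k) (X k)"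
    "\<And>k. X k \<subseteq> X (Suc k)" "\<And>k x. x \<in> A \<Longrightarrow> \<exists>s\<in>X k. dist s x \<le> r k"
proof -
  let ?P = "\<lambda>k S. S \<subseteq> A \<and> finite S \<and> separated (r k) S \<and> (\<forall>x\<in>A. \<exists>s\<in>S. dist s x \<le> r k)"
  have "\<exists>X. \<forall>k. ?P k (X k) \<and> X k \<subseteq> X (Suc k)"
  proof (rule dependent_nat_choice[of ?P "\<lambda>_. (\<subseteq>)"])
    obtain S' where "S' \<subseteq> A" "separated (r 0) S'" "finite S'" "\<And>x. x \<in> A \<Longrightarrow> \<exists>s\<in>S'. dist s x \<le> r 0"
      using separated_extend[OF assms(1,2), of "{}"] by (auto simp: separated_def)
    then show "\<exists>S. ?P 0 S" by blast
  next
    fix S k assume S: "?P k S"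
    then have "separated (r (Suc k)) S" using assms(3)[of k] by (force simp: separated_def)
    then obtain S' where "S \<subseteq> S'" "S' \<subseteq> A" "separated (r (Suc k)) S'" "finite S'"
      "\<And>x. x \<in> A \<Longrightarrow> \<exists>s\<in>S'. dist s x \<le> r (Suc k)"
      using separated_extend[OF assms(1,2)] S by metis
    then show "\<exists>S'. ?P (Suc k) S' \<and> S \<subseteq> S'" by blast
  qed
  then obtain X where "\<And>k. ?P k (X k) \<and> X k \<subseteq> X (Suc k)" by blast
  then show ?thesis using that[of X] by blast
qed

text \<open>The sufficient half of the traveling salesman theorem; \<open>y k x\<close> is the position that
  represents x at scale k.\<close>

theorem traveling_salesman_curve:
  obtains R :: real where "R \<ge> 1"
    "\<And>(A::'a::euclidean_space set) y \<alpha> t r0 C. \<lbrakk>bounded A; A \<noteq> {}; 0 < r0;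
      \<And>k x. x \<in> A \<Longrightarrow> dist (y k x) x \<le> r0 / 2 ^ k / 100; \<And>k v. 0 \<le> \<alpha> k v;
      \<And>k v. v \<in> A \<Longrightarrow> flat_on (\<alpha> k v * (r0 / 2 ^ k)) (t k v)
         (\<Union>x\<in>{x\<in>A. dist v x \<le> R * (r0 / 2 ^ k)}. {y k x, y (Suc k) x});
      \<And>X n. (\<And>k. X k \<subseteq> A) \<Longrightarrow> (\<And>k. separated (r0 / 2 ^ k) (X k)) \<Longrightarrow>
         (\<Sum>k<n. \<Sum>v\<in>X k. (\<alpha> k v)\<^sup>2 * (r0 / 2 ^ k)) \<le> C\<rbrakk>
      \<Longrightarrow> \<exists>L f. L-lipschitz_on {0..1::real} f \<and> A \<subseteq> f ` {0..1}"
proof -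
  obtain N where N: "\<And>r v (S::'a set). \<lbrakk>r > 0; S \<subseteq> cball v (1 * r);
    \<And>x y. x \<in> S \<Longrightarrow> y \<in> S \<Longrightarrow> x \<noteq> y \<Longrightarrow> r / 2 \<le> dist x y\<rbrakk> \<Longrightarrow> finite S \<and> card S \<le> N"
    using packing_bound[of 1] by blast
  \<comment> \<open>Chosen so that the window radius \<open>g + 2 * r\<close> is
    \<open>R * r\<close>. It is fixed before the set, which lets an application match its cubes to
    it.\<close>
  define R where "R = 32 * real N + 4"
  obtain D where D: "\<And>r v (S::'a set). \<lbrakk>r > 0; S \<subseteq> cball v (R * r);
    \<And>x y. x \<in> S \<Longrightarrow> y \<in> S \<Longrightarrow> x \<noteq> y \<Longrightarrow> r / 2 \<le> dist x y\<rbrakk> \<Longrightarrow> finite S \<and> card S \<le> D"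
    using packing_bound[of R] by blast
  define K where "K = 17 + 8 * real N + 32 * (real D)\<^sup>2 + 1200 * real D + 40000 * (real N * real D)"
  have K0: "0 \<le> K" by (simp add: K_def)
  show ?thesis
  proof (rule that)
    show "R \<ge> 1" by (simp add: R_def)
    fix A :: "'a set" and y :: "nat \<Rightarrow> 'a \<Rightarrow> 'a" and \<alpha> :: "nat \<Rightarrow> 'a \<Rightarrow> real" and t :: "nat \<Rightarrow> 'a \<Rightarrow> 'a \<Rightarrow> real"
      and r0 C :: real
    define r where "r k = r0 / 2 ^ k" for k :: nat
    assume bdd: "bounded A" and ne: "A \<noteq> {}" and r0: "0 < r0"
      and y': "\<And>k x. x \<in> A \<Longrightarrow> dist (y k x) x \<le> r0 / 2 ^ k / 100" and \<alpha>: "\<And>k v. 0 \<le> \<alpha> k v"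
      and flat': "\<And>k v. v \<in> A \<Longrightarrow> flat_on (\<alpha> k v * (r0 / 2 ^ k)) (t k v)
         (\<Union>x\<in>{x\<in>A. dist v x \<le> R * (r0 / 2 ^ k)}. {y k x, y (Suc k) x})"
      and C': "\<And>X n. (\<And>k. X k \<subseteq> A) \<Longrightarrow> (\<And>k. separated (r0 / 2 ^ k) (X k)) \<Longrightarrow>
         (\<Sum>k<n. \<Sum>v\<in>X k. (\<alpha> k v)\<^sup>2 * (r0 / 2 ^ k)) \<le> C"
    note y = y'[folded r_def] and flat = flat'[folded r_def] and C = C'[folded r_def]
    have r: "r k > 0" "r (Suc k) = r k / 2" for k using r0 by (auto simp: r_def)
    obtain X where X: "\<And>k. X k \<subseteq> A" "\<And>k. finite (X k)" "\<And>k. separated (r k) (X k)"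
      "\<And>k. X k \<subseteq> X (Suc k)" "\<And>k x. x \<in> A \<Longrightarrow> \<exists>s\<in>X k. dist s x \<le> r k"
    proof (rule nested_nets[OF bdd, of r])
      show "r (Suc k) \<le> r k" for k using r[of k] by simp
    qed (use r in auto)
    have Xne: "X k \<noteq> {}" for k using X(5) ne by blast
    define g where "g k = (32 * real N + 2) * r k" for k
    have "\<forall>k. \<exists>S T. optimal (g k) (y k) (X k) S T" using optimal_exists[OF X(2)] by metis
    then obtain S T where ST: "\<And>k. optimal (g k) (y k) (X k) (S k) (T k)" by metis
    define \<Psi> where "\<Psi> k = cost (g k) (y k) (S k) (T k)" for k
    have g2: "g (Suc k) = g k / 2" for k by (simp add: g_def r)
    have gR: "g k + 2 * r k = R * r k" for k by (simp add: g_def R_def algebra_simps)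
    have step: "\<Psi> (Suc k) \<le> \<Psi> k + K * (r k + (\<Sum>v\<in>X k. (\<alpha> k v)\<^sup>2 * r k))" for k
    proof -
      have sepY: "r k / 2 \<le> dist a b" if "a \<in> X (Suc k)" "b \<in> X (Suc k)" "a \<noteq> b" for a b
        using X(3)[of "Suc k"] that by (auto simp: separated_def r)
      interpret refinement "X k" "X (Suc k)" "y k" "y (Suc k)" "r k" "g k" "\<alpha> k" "t k" N D "S k" "T k"
      proof
        show "0 < r k" "finite (X (Suc k))" "X k \<subseteq> X (Suc k)" using r X by auto
        show "r k \<le> dist a b" if "a \<in> X k" "b \<in> X k" "a \<noteq> b" for a b
          using X(3)[of k] that by (auto simp: separated_def)
        show "r k / 2 \<le> dist a b" if "a \<in> X (Suc k)" "b \<in> X (Suc k)" "a \<noteq> b" for a b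
          by (rule sepY[OF that])
        show "\<exists>x\<in>X k. dist x b \<le> r k" if "b \<in> X (Suc k)" for b using X(5)[of b k] X(1) that by blast
        show "dist (y k b) b \<le> r k / 100" if "b \<in> X (Suc k)" for b using y X(1) that by blast
        show "dist (y (Suc k) b) b \<le> r k / 100" if "b \<in> X (Suc k)" for b
          using y[of b "Suc k"] X(1)[of "Suc k"] that r[of k] by (auto simp: subset_iff)
        show "0 \<le> \<alpha> k v" for v by (rule \<alpha>)
        show "flat_on (\<alpha> k v * r k) (t k v) (\<Union>x\<in>{x \<in> X (Suc k). dist v x \<le> g k + 2 * r k}. {y k x, y (Suc k) x})"
          if "v \<in> X k" for v
        proof -
          have "v \<in> A" using that X(1) by blast
          from flat[OF this, of k] show ?thesis
            unfolding flat_on_def gR using X(1)[of "Suc k"] by blast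
        qed
        show "card {b \<in> X (Suc k). dist v b \<le> r k} \<le> N" for v
        proof -
          have "{b \<in> X (Suc k). dist v b \<le> r k} \<subseteq> cball v (1 * r k)" by auto
          from N[OF r(1) this] sepY show ?thesis by blast
        qed
        show "card {b \<in> X (Suc k). dist v b \<le> g k + 2 * r k} \<le> D" for v
        proof -
          have "{b \<in> X (Suc k). dist v b \<le> g k + 2 * r k} \<subseteq> cball v (R * r k)" by (auto simp: gR)
          from D[OF r(1) this] sepY show ?thesis by blast
        qed
        show "g k = (32 * real N + 2) * r k" by (rule g_def)
        show "optimal (g k) (y k) (X k) (S k) (T k)" by (rule ST)
      qed
      obtain S' where S': "network (X (Suc k)) S' (T k)"
        "cost (g k / 2) (y (Suc k)) S' (T k) \<le> cost (g k) (y k) (S k) (T k) + K * (r k * (1 + energy))"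
        using refinement_cost unfolding K_def by blast
      \<comment> \<open>The refined network competes with the optimal one of the next scale, whose
        penalty is half as large.\<close>
      have "\<Psi> (Suc k) \<le> cost (g k / 2) (y (Suc k)) S' (T k)"
        using ST[of "Suc k"] S'(1) unfolding optimal_def \<Psi>_def g2 by blast
      also have "\<dots> \<le> \<Psi> k + K * (r k * (1 + energy))" using S'(2) by (simp add: \<Psi>_def)
      also have "r k * (1 + energy) = r k + (\<Sum>v\<in>X k. (\<alpha> k v)\<^sup>2 * r k)"
        by (simp add: energy_def algebra_simps flip: sum_distrib_left sum_distrib_right)
      finally show ?thesis .
    qed
    \<comment> \<open>The first order costs form a geometric series bounded by
      \<open>2 * r0\<close>.\<close>
    have sumr: "(\<Sum>k<n. r k) = 2 * r0 - 2 * r n" for n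
      by (induction n) (auto simp: r_def field_simps)
    have "\<Psi> n \<le> \<Psi> 0 + K * ((\<Sum>k<n. r k) + (\<Sum>k<n. \<Sum>v\<in>X k. (\<alpha> k v)\<^sup>2 * r k))" for n
    proof (induction n)
      case (Suc n)
      then show ?case using step[of n] by (simp add: algebra_simps)
    qed auto
    moreover have "K * ((\<Sum>k<n. r k) + (\<Sum>k<n. \<Sum>v\<in>X k. (\<alpha> k v)\<^sup>2 * r k)) \<le> K * (2 * r0 + C)" for n
      using C[of X n, OF X(1) X(3)] sumr[of n] r(1)[of n] K0 by (intro mult_left_mono) auto
    ultimately have \<Psi>: "\<Psi> n \<le> \<Psi> 0 + K * (2 * r0 + C)" for n by (rule order_trans[OF _ add_left_mono])
    define L where "L = 2 * \<bar>\<Psi> 0 + K * (2 * r0 + C)\<bar> + 1"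
    have L: "L > 0" by (simp add: L_def add_nonneg_pos)
    have L2: "2 * \<Psi> n \<le> L" for n
      using order_trans[OF \<Psi>[of n] abs_ge_self] by (simp add: L_def)
    have tour: "\<exists>f. 1-lipschitz_on {0..L} f \<and> y k ` X k \<subseteq> f ` {0..L}" for k
    proof -
      have nw: "network (X k) (S k) (T k)" using ST by (simp add: optimal_def)
      then have li: "links (S k \<union> T k) (X k)" "S k \<union> T k \<subseteq> X k \<times> X k" by (auto simp: network_def)
      have fin: "finite (S k)" "finite (T k)" using network_finite[OF nw X(2)] by auto
      have "0 \<le> g k" using r(1)[of k] by (simp add: g_def)
      have "(\<Sum>e\<in>S k \<union> T k. elen (y k) e) \<le> (\<Sum>e\<in>S k. elen (y k) e) + (\<Sum>e\<in>T k. elen (y k) e)"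
        using fin by (simp add: sum_Un sum_nonneg)
      also have "\<dots> \<le> \<Psi> k" unfolding \<Psi>_def cost_def
        using \<open>0 \<le> g k\<close> sum_nonneg[of "S k" "elen (y k)"] by (intro add_mono sum_mono) auto
      finally have "2 * (\<Sum>e\<in>S k \<union> T k. elen (y k) e) \<le> L" using L2[of k] by simp
      then obtain f where "1-lipschitz_on {0..L} f" "y k ` X k \<subseteq> f ` {0..L}"
        using links_tour[OF li X(2) Xne] by blast
      then show ?thesis by blast
    qed
    have bddV: "bounded (\<Union>k. y k ` X k)"
    proof -
      obtain B where B: "\<And>x. x \<in> A \<Longrightarrow> norm x \<le> B" using bdd by (auto simp: bounded_iff)
      have "norm (y k x) \<le> B + r0" if "x \<in> X k" for k x
      proof -
        have "x \<in> A" using X(1) that by blast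
        moreover have "r k \<le> r0" using r0 by (simp add: r_def divide_le_eq_1 field_simps)
        ultimately show ?thesis
          using y[of x k] B[of x] r(1)[of k] norm_triangle_sub[of "y k x" x] by (simp add: dist_norm)
      qed
      then show ?thesis unfolding bounded_iff by blast
    qed
    have limV: "\<exists>v. (\<forall>k. v k \<in> y k ` X k) \<and> v \<longlonglongrightarrow> x" if x: "x \<in> A" for x
    proof -
      obtain s where s: "\<And>k. s k \<in> X k" "\<And>k. dist (s k) x \<le> r k" using X(5)[OF x] by metis
      have near: "dist (y k (s k)) x \<le> 2 * r k" for k
      proof -
        have "dist (y k (s k)) (s k) \<le> r k / 100" using y s X(1) by blast
        then show ?thesis using s(2)[of k] r(1)[of k] dist_triangle[of "y k (s k)" x "s k"] by linarith
      qed
      have r2: "(\<lambda>k. 2 * r k) \<longlonglongrightarrow> 0"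
        unfolding r_def by (intro tendsto_mult_right_zero LIMSEQ_divide_realpow_zero) auto
      have "\<forall>\<^sub>F k in sequentially. norm (dist (y k (s k)) x) \<le> 2 * r k"
        using near by (intro always_eventually) simp
      then have "(\<lambda>k. dist (y k (s k)) x) \<longlonglongrightarrow> 0" using r2 by (rule Lim_null_comparison)
      then have "(\<lambda>k. y k (s k)) \<longlonglongrightarrow> x" by (rule tendsto_dist_iff[THEN iffD2])
      then show ?thesis using s(1) by (intro exI[of _ "\<lambda>k. y k (s k)"]) auto
    qed
    have "y k ` X k \<noteq> {}" for k using Xne by simp
    then obtain f where "L-lipschitz_on {0..1::real} f" "A \<subseteq> f ` {0..1}"
      using lipschitz_curve_through_limits[OF tour L bddV _ limV] by blast
    then show "\<exists>L f. L-lipschitz_on {0..1::real} f \<and> A \<subseteq> f ` {0..1}" by blast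
  qed
qed

section \<open>Lines and barycenters\<close>

text \<open>For a unit vector \<open>u\<close>, the component orthogonal to \<open>u\<close>; its
  norm at \<open>z - a\<close> is the distance of \<open>z\<close> from the line through
  \<open>a\<close> in direction \<open>u\<close>.\<close>

definition normal_part :: "'a::real_inner \<Rightarrow> 'a \<Rightarrow> 'a" where
  "normal_part u w = w - (w \<bullet> u) *\<^sub>R u"

lemma bounded_linear_normal_part: "bounded_linear (normal_part u)"
  unfolding normal_part_def
  by (intro bounded_linear_sub bounded_linear_ident bounded_linear_scaleR_left
      bounded_linear_compose[OF bounded_linear_scaleR_left bounded_linear_inner_left])

lemma norm_normal_part:
  assumes "norm u = 1"
  shows "(norm w)\<^sup>2 = (w \<bullet> u)\<^sup>2 + (norm (normal_part u w))\<^sup>2"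
proof -
  have "u \<bullet> u = 1" using assms by (simp add: dot_square_norm)
  then have "normal_part u w \<bullet> normal_part u w = w \<bullet> w - (w \<bullet> u)\<^sup>2"
    by (simp add: normal_part_def inner_diff_left inner_diff_right inner_commute power2_eq_square)
  then show ?thesis by (simp add: power2_norm_eq_inner)
qed

text \<open>The normal components of two points differ by at most \<open>2 * h\<close>, which is the
  origin of \<open>4 * h\<^sup>2\<close> in \<open>flat_on\<close>.\<close>

lemma flat_on_line:
  assumes u: "norm u = 1" and h: "\<And>z. z \<in> F \<Longrightarrow> norm (normal_part u (z - a)) \<le> h"
  shows "flat_on h (\<lambda>z. z \<bullet> u) F"
  unfolding flat_on_def
proof (intro ballI conjI)
  fix x y assume xy: "x \<in> F" "y \<in> F"
  show "\<bar>x \<bullet> u - y \<bullet> u\<bar> \<le> dist x y"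
    using Cauchy_Schwarz_ineq2[of "x - y" u] u by (simp add: dist_norm inner_diff_left)
  interpret bounded_linear "normal_part u" by (rule bounded_linear_normal_part)
  have "normal_part u (x - y) = normal_part u (x - a) - normal_part u (y - a)"
    by (simp flip: diff)
  then have "norm (normal_part u (x - y)) \<le> 2 * h"
    using h[OF xy(1)] h[OF xy(2)] norm_triangle_ineq4[of "normal_part u (x - a)" "normal_part u (y - a)"] by simp
  then have "(norm (normal_part u (x - y)))\<^sup>2 \<le> (2 * h)\<^sup>2" by (rule power_mono) simp
  then show "(dist x y)\<^sup>2 \<le> (x \<bullet> u - y \<bullet> u)\<^sup>2 + 4 * h\<^sup>2"
    using norm_normal_part[OF u, of "x - y"] by (simp add: dist_norm inner_diff_left power_mult_distrib)
qed

text \<open>The normal part of \<open>z - x\<close> is the same for all \<open>x\<close> on the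
  line, and its norm never exceeds that of \<open>z - x\<close>.\<close>

lemma norm_normal_part_le_infdist:
  assumes "v \<noteq> 0"
  shows "norm (normal_part (v /\<^sub>R norm v) (z - a)) \<le> infdist z (range (\<lambda>t. a + t *\<^sub>R v))"
proof -
  define u where "u = v /\<^sub>R norm v"
  have u: "norm u = 1" using assms by (simp add: u_def)
  interpret bounded_linear "normal_part u" by (rule bounded_linear_normal_part)
  have v: "v = norm v *\<^sub>R u" using assms by (simp add: u_def)
  have "u \<bullet> u = 1" using u by (simp add: dot_square_norm)
  then have "normal_part u u = 0" by (simp add: normal_part_def)
  then have "normal_part u (norm v *\<^sub>R u) = 0" by (simp add: scale)
  then have "normal_part u v = 0" unfolding v[symmetric] .
  then have tv: "normal_part u (t *\<^sub>R v) = 0" for t by (simp only: scale scaleR_zero_right)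
  have eq: "normal_part u (z - a) = normal_part u (z - (a + t *\<^sub>R v))" for t
  proof -
    have "z - (a + t *\<^sub>R v) = (z - a) - t *\<^sub>R v" by (simp only: diff_diff_eq)
    then show ?thesis by (simp only: diff tv diff_zero)
  qed
  have le: "norm (normal_part u w) \<le> norm w" for w
    using norm_normal_part[OF u, of w] by (auto intro: power2_le_imp_le[OF _ norm_ge_zero])
  have "norm (normal_part u (z - a)) \<le> dist z (a + t *\<^sub>R v)" for t
    unfolding eq[of t] dist_norm by (rule le)
  then have "norm (normal_part u (z - a)) \<le> dist z x" if "x \<in> range (\<lambda>t. a + t *\<^sub>R v)" for x
    using that by (elim rangeE) (simp only:)
  then have n: "norm (normal_part u (z - a)) \<le> (INF x\<in>range (\<lambda>t. a + t *\<^sub>R v). dist z x)"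
    by (intro cINF_greatest) (simp_all only: image_is_empty UNIV_not_empty not_False_eq_True)
  have i: "infdist z (range (\<lambda>t. a + t *\<^sub>R v)) = (INF x\<in>range (\<lambda>t. a + t *\<^sub>R v). dist z x)"
    by (rule infdist_notempty) blast
  show ?thesis using n unfolding i u_def .
qed

section \<open>Means over bounded sets and barycenters\<close>

lemma radon_bounded_finite:
  assumes "radon_measure M" "bounded S"
  shows "emeasure M S < \<infinity>"
proof -
  obtain B where "\<And>x. x \<in> S \<Longrightarrow> norm x \<le> B" using assms(2) by (auto simp: bounded_iff)
  then have "S \<subseteq> cball 0 B" by auto
  then have "emeasure M S \<le> emeasure M (cball 0 B)"
    using assms(1) by (intro emeasure_mono) (simp_all add: radon_measure_def)
  also have "\<dots> < \<infinity>" using assms(1) by (auto simp: radon_measure_def)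
  finally show ?thesis .
qed

lemma radon_integrable_on_bounded:
  fixes f :: "'a::euclidean_space \<Rightarrow> 'b::euclidean_space"
  assumes M: "radon_measure M" and S: "bounded S" "S \<in> sets borel" and f: "continuous_on UNIV f"
  shows "set_integrable M S f"
proof -
  have sets: "sets M = sets borel" using M by (simp add: radon_measure_def)
  have "compact (f ` closure S)"
    using S(1) by (intro compact_continuous_image continuous_on_subset[OF f]) auto
  then have "bounded (f ` S)"
    by (rule bounded_subset[OF compact_imp_bounded image_mono[OF closure_subset]])
  then obtain B where B: "\<And>x. x \<in> S \<Longrightarrow> norm (f x) \<le> B" by (auto simp: bounded_iff)
  show ?thesis
    unfolding set_integrable_def
  proof (rule integrableI_bounded_set_indicator[where B = B])
    show "S \<in> sets M" using S(2) sets by simp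
    show "f \<in> borel_measurable M"
      using borel_measurable_continuous_onI[OF f] measurable_cong_sets[OF sets refl] by blast
    show "emeasure M S < \<infinity>" by (rule radon_bounded_finite[OF M S(1)])
    show "AE x in M. x \<in> S \<longrightarrow> norm (f x) \<le> B" using B by (intro AE_I2) blast
  qed
qed

definition barycenter :: "'a::euclidean_space measure \<Rightarrow> 'a set \<Rightarrow> 'a" where
  "barycenter M S = (LINT z:S|M. z) /\<^sub>R measure M S"

text \<open>Jensen's inequality: linear maps commute with means, and the norm is convex. With
  \<open>normal_part\<close> for \<open>f\<close>, an average distance to a line controls the
  distance of a single point.\<close>

lemma norm_barycenter_le:
  fixes M :: "'a::euclidean_space measure" and f :: "'a \<Rightarrow> 'b::euclidean_space"
  assumes M: "radon_measure M" and S: "bounded S" "S \<in> sets borel" "0 < measure M S"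
    and f: "bounded_linear f"
  shows "norm (f (barycenter M S - c)) \<le> (LINT z:S|M. norm (f (z - c))) / measure M S"
proof -
  interpret f: bounded_linear f by (rule f)
  have sets: "S \<in> sets M" using M S by (simp add: radon_measure_def)
  have id: "set_integrable M S (\<lambda>z. z)" and fi: "set_integrable M S (\<lambda>z. f (z - c))"
    and c: "set_integrable M S (\<lambda>z. c)"
    by (intro radon_integrable_on_bounded[OF M S(1,2)] continuous_intros f.continuous_on)+
  have ci: "(LINT z:S|M. c) = measure M S *\<^sub>R c"
    using sets radon_bounded_finite[OF M S(1)] by (simp add: set_lebesgue_integral_def)
  have "f (barycenter M S - c) = f (LINT z:S|M. z - c) /\<^sub>R measure M S"
    using S(3) set_integral_diff(2)[OF id c] ci by (simp add: barycenter_def f.diff f.scale scaleR_diff_right)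
  also have "f (LINT z:S|M. z - c) = (LINT z:S|M. f (z - c))"
    using integral_bounded_linear[OF f, of M "\<lambda>z. indicator S z *\<^sub>R (z - c)"] set_integral_diff(1)[OF id c]
    by (simp add: set_lebesgue_integral_def set_integrable_def f.scale)
  finally have "norm (f (barycenter M S - c)) = norm (LINT z:S|M. f (z - c)) / measure M S"
    using S(3) by (simp add: divide_inverse)
  also have "norm (LINT z:S|M. f (z - c)) \<le> (LINT z:S|M. norm (f (z - c)))"
    using set_integral_norm_bound[OF fi] .
  finally show ?thesis using S(3) by (simp add: divide_right_mono)
qed

lemma barycenter_dist:
  fixes M :: "'a::euclidean_space measure"
  assumes M: "radon_measure M" and "0 < measure M (cball x \<rho>)"
  shows "dist (barycenter M (cball x \<rho>)) x \<le> \<rho>"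
proof -
  let ?S = "cball x \<rho>"
  have "norm (barycenter M ?S - x) \<le> (LINT z:?S|M. norm (z - x)) / measure M ?S"
    using norm_barycenter_le[OF M _ _ assms(2) bounded_linear_ident] by simp
  also have "(LINT z:?S|M. norm (z - x)) \<le> (LINT z:?S|M. \<rho>)"
  proof (rule set_integral_mono)
    show "set_integrable M ?S (\<lambda>z. norm (z - x))" "set_integrable M ?S (\<lambda>z. \<rho>)"
      by (intro radon_integrable_on_bounded[OF M] continuous_intros; simp)+
  qed (auto simp: dist_norm norm_minus_commute)
  also have "\<dots> = measure M ?S * \<rho>"
    using M radon_bounded_finite[OF M, of ?S] by (simp add: set_lebesgue_integral_def radon_measure_def)
  finally show ?thesis using assms(2) by (simp add: dist_norm divide_right_mono)
qed

text \<open>Takes the place of Hoelder's inequality: up to \<open>s\<close> the first summand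
  suffices, above \<open>s\<close> the second. Integrated, it bounds a mean by \<open>2 * s\<close>
  when the mean of the power \<open>p\<close> is at most \<open>s powr p\<close>.\<close>

lemma le_add_powr:
  fixes x s p :: real
  assumes "0 \<le> x" "0 < s" "1 \<le> p"
  shows "x \<le> s + s powr (1 - p) * x powr p"
proof (cases "x \<le> s")
  case True
  then show ?thesis by (simp add: add_increasing2)
next
  case False
  then have x: "s < x" "0 < x" using assms by auto
  have "x = x powr (1 - p) * x powr p" using x by (simp flip: powr_add)
  also have "\<dots> \<le> s powr (1 - p) * x powr p"
    using x assms by (intro mult_right_mono powr_mono2') auto
  finally show ?thesis using assms by simp
qed

text \<open>The infimum over lines need not be attained, hence a bound \<open>s\<close> strictly
  above beta. Passing from exponent \<open>p\<close> to exponent 1 costs the factor 2.\<close>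

lemma beta_line:
  fixes M :: "'a::euclidean_space measure"
  assumes M: "radon_measure M" and p: "1 \<le> p" and E: "bounded E" "E \<in> sets borel"
    and m: "0 < measure M E" and d: "0 < diameter E" and s: "beta_p M p E < s" "0 < s"
  obtains a u where "norm u = 1"
    "(LINT z:E|M. norm (normal_part u (z - a))) \<le> 2 * s * diameter E * measure M E"
proof -
  have sets: "E \<in> sets M" using M E by (simp add: radon_measure_def)
  let ?I = "\<lambda>L. (enn2real (\<integral>\<^sup>+ x. ennreal ((infdist x L / diameter E) powr p) * indicator E x \<partial>M) / measure M E) powr (1 / p)"
  have "emeasure M E \<noteq> 0" using m by (auto simp: measure_def)
  then have "(INF L\<in>lines. ?I L) < s" using s by (simp add: beta_p_def)
  moreover have "lines \<noteq> ({} :: 'a set set)"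
  proof -
    obtain b :: 'a where "b \<in> Basis" using nonempty_Basis by blast
    then have "range (\<lambda>t::real. 0 + t *\<^sub>R b) \<in> lines" unfolding lines_def by (force dest: nonzero_Basis)
    then show ?thesis by blast
  qed
  ultimately obtain L where L: "L \<in> lines" "?I L < s" using cInf_lessD[of "?I ` lines" s] by blast
  then obtain a v where v: "v \<noteq> 0" "L = range (\<lambda>t::real. a + t *\<^sub>R v)" by (auto simp: lines_def)
  define u where "u = v /\<^sub>R norm v"
  let ?w = "\<lambda>z. infdist z L / diameter E"
  have cont: "continuous_on UNIV ?w" using d by (intro continuous_intros) auto
  have contp: "continuous_on UNIV (\<lambda>z. ?w z powr p)"
    using p d by (intro continuous_on_powr' cont continuous_intros) (auto simp: infdist_nonneg)
  have int: "set_integrable M E ?w" "set_integrable M E (\<lambda>z. ?w z powr p)"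
    by (intro radon_integrable_on_bounded[OF M E] cont contp)+
  define I where "I = (LINT z:E|M. ?w z powr p)"
  have I0: "0 \<le> I" unfolding I_def set_lebesgue_integral_def by (intro integral_nonneg_AE) auto
  have "(\<integral>\<^sup>+ x. ennreal (?w x powr p) * indicator E x \<partial>M) = (\<integral>\<^sup>+ x. ennreal (indicator E x *\<^sub>R (?w x powr p)) \<partial>M)"
    by (intro nn_integral_cong) (auto simp: indicator_def)
  also have "\<dots> = ennreal I"
    unfolding I_def set_lebesgue_integral_def using int(2)
    by (intro nn_integral_eq_integral) (auto simp: set_integrable_def)
  finally have "(I / measure M E) powr (1 / p) < s" using L(2) I0 by simp
  then have "I / measure M E \<le> s powr p"
  proof -
    have "((I / measure M E) powr (1 / p)) powr p \<le> s powr p"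
      using \<open>(I / measure M E) powr (1 / p) < s\<close> p by (intro powr_mono2) auto
    then show ?thesis using p I0 m by (simp add: powr_powr)
  qed
  then have I: "I \<le> s powr p * measure M E" using m by (simp add: divide_le_eq)
  have ms: "(LINT z:E|M. s) = measure M E * s"
    using sets radon_bounded_finite[OF M E(1)] by (simp add: set_lebesgue_integral_def)
  have si: "set_integrable M E (\<lambda>z. s)" by (intro radon_integrable_on_bounded[OF M E] continuous_intros)
  have "(LINT z:E|M. ?w z) \<le> (LINT z:E|M. s + s powr (1 - p) * ?w z powr p)"
  proof (rule set_integral_mono[OF int(1)])
    show "set_integrable M E (\<lambda>z. s + s powr (1 - p) * ?w z powr p)"
      using int(2) si by (intro set_integral_add set_integrable_mult_right) auto
    show "?w z \<le> s + s powr (1 - p) * ?w z powr p" for z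
      using d p s(2) by (intro le_add_powr) (auto simp: infdist_nonneg)
  qed
  also have "\<dots> = measure M E * s + s powr (1 - p) * I"
    unfolding I_def using int(2) si
    by (subst set_integral_add(2)) (auto simp: ms intro!: set_integrable_mult_right)
  also have "\<dots> \<le> measure M E * s + s powr (1 - p) * (s powr p * measure M E)"
    using I by (intro add_left_mono mult_left_mono) auto
  also have "s powr (1 - p) * (s powr p * measure M E) = s * measure M E"
    using s(2) by (simp flip: powr_add mult.assoc)
  finally have w: "(LINT z:E|M. ?w z) \<le> 2 * s * measure M E" by simp
  have "(LINT z:E|M. norm (normal_part u (z - a))) \<le> (LINT z:E|M. diameter E * ?w z)"
  proof (rule set_integral_mono)
    show "set_integrable M E (\<lambda>z. norm (normal_part u (z - a)))"
      by (intro radon_integrable_on_bounded[OF M E] continuous_intros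
          bounded_linear.continuous_on[OF bounded_linear_normal_part])
    show "set_integrable M E (\<lambda>z. diameter E * ?w z)" using int(1) by (intro set_integrable_mult_right) auto
    show "norm (normal_part u (z - a)) \<le> diameter E * ?w z" for z
      using norm_normal_part_le_infdist[OF v(1), of z a] d unfolding u_def v(2) by simp
  qed
  also have "\<dots> = diameter E * (LINT z:E|M. ?w z)" by simp
  also have "\<dots> \<le> diameter E * (2 * s * measure M E)" using w d by (intro mult_left_mono) auto
  finally have "(LINT z:E|M. norm (normal_part u (z - a))) \<le> 2 * s * diameter E * measure M E"
    by (simp add: mult_ac)
  moreover have "norm u = 1" using v(1) by (simp add: u_def)
  ultimately show ?thesis using that by blast
qed

section \<open>Dyadic cubes\<close>

definition cube :: "nat \<Rightarrow> 'a::euclidean_space \<Rightarrow> 'a set" where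
  "cube k x = dcube (int k) (\<lambda>b. \<lfloor>x \<bullet> b * 2 ^ k\<rfloor>)"

lemma mem_dcube:
  "z \<in> dcube (int k) j \<longleftrightarrow> (\<forall>b\<in>Basis. \<lfloor>z \<bullet> b * 2 ^ k\<rfloor> = j b)"
proof -
  have "(of_int (j b) * 2 powr (- of_int (int k)) \<le> z \<bullet> b \<and> z \<bullet> b < (of_int (j b) + 1) * 2 powr (- of_int (int k)))
    \<longleftrightarrow> \<lfloor>z \<bullet> b * 2 ^ k\<rfloor> = j b" for b
    by (simp add: floor_eq_iff powr_minus powr_realpow field_simps)
  then show ?thesis by (simp add: dcube_def)
qed

lemma mem_cube: "z \<in> cube k x \<longleftrightarrow> (\<forall>b\<in>Basis. \<lfloor>z \<bullet> b * 2 ^ k\<rfloor> = \<lfloor>x \<bullet> b * 2 ^ k\<rfloor>)"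
  unfolding cube_def mem_dcube ..

lemma cube_self [simp]: "x \<in> cube k x"
  by (simp add: mem_cube)

lemma cube_eq: "z \<in> cube k x \<Longrightarrow> cube k z = cube k x"
  by (rule set_eqI) (simp add: mem_cube)

lemma mem_cube_bounds:
  "z \<in> cube k x \<longleftrightarrow> (\<forall>b\<in>Basis. of_int \<lfloor>x \<bullet> b * 2 ^ k\<rfloor> \<le> z \<bullet> b * 2 ^ k \<and> z \<bullet> b * 2 ^ k < of_int \<lfloor>x \<bullet> b * 2 ^ k\<rfloor> + 1)"
  unfolding mem_cube floor_eq_iff ..

definition corner :: "nat \<Rightarrow> ('a::euclidean_space \<Rightarrow> int) \<Rightarrow> 'a" where
  "corner k j = (\<Sum>b\<in>Basis. (of_int (j b) / 2 ^ k) *\<^sub>R b)"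

lemma corner_inner: "b \<in> Basis \<Longrightarrow> corner k j \<bullet> b = of_int (j b) / 2 ^ k"
  by (simp add: corner_def)

lemma dcube_cube: "dcube (int k) j = cube k (corner k j)"
  by (rule set_eqI) (simp add: mem_dcube mem_cube corner_inner)

lemma dyadic1_cube: "dyadic1 = {Q. \<exists>k x. Q = cube k x}"
proof -
  have "\<exists>k x. Q = cube k x" if Q: "Q \<in> dyadic1" for Q :: "'a set"
  proof -
    obtain k j where "k \<ge> 0" "Q = dcube k j" using Q by (auto simp: dyadic1_def)
    then have "Q = cube (nat k) (corner (nat k) j)" by (simp flip: dcube_cube)
    then show ?thesis by blast
  qed
  moreover have "cube k x \<in> dyadic1" for k and x :: 'a
    unfolding cube_def dyadic1_def by (force intro: exI[of _ "int k"])
  ultimately show ?thesis by blast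
qed

lemma cube_dyadic1 [simp]: "cube k x \<in> dyadic1"
  unfolding dyadic1_cube by blast

text \<open>Nestedness: the floors at a coarser level are integer quotients of those at a finer
  one.\<close>

lemma cube_coarser:
  assumes "cube l x = cube l y" "k \<le> l"
  shows "cube k x = cube k y"
proof -
  have "x \<in> cube l y" using assms(1) cube_self by blast
  have "\<lfloor>x \<bullet> b * 2 ^ k\<rfloor> = \<lfloor>y \<bullet> b * 2 ^ k\<rfloor>" if b: "b \<in> Basis" for b
  proof -
    have fl: "\<lfloor>z * 2 ^ k\<rfloor> = \<lfloor>z * 2 ^ l\<rfloor> div 2 ^ (l - k)" for z :: real
    proof -
      have "z * 2 ^ k = (z * 2 ^ l) / real_of_int (2 ^ (l - k))"
      proof -
        have "(2::real) ^ l = 2 ^ (l - k) * 2 ^ k" using assms(2) by (simp flip: power_add)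
        then show ?thesis by simp
      qed
      then show ?thesis by (simp only:) (rule floor_divide_real_eq_div, simp)
    qed
    show ?thesis unfolding fl using \<open>x \<in> cube l y\<close> b by (simp add: mem_cube)
  qed
  then have "x \<in> cube k y" by (simp add: mem_cube)
  then show ?thesis by (rule cube_eq)
qed

lemma countable_dyadic1: "countable (dyadic1 :: 'a::euclidean_space set set)"
proof -
  have "dyadic1 \<subseteq> (\<lambda>(k, j). dcube (int k) j) ` (UNIV \<times> PiE (Basis :: 'a set) (\<lambda>_. UNIV))"
  proof
    fix Q :: "'a set" assume "Q \<in> dyadic1"
    then obtain k x where Q: "Q = cube k x" by (auto simp: dyadic1_cube)
    have "Q = dcube (int k) (restrict (\<lambda>b. \<lfloor>x \<bullet> b * 2 ^ k\<rfloor>) Basis)"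
      unfolding Q by (rule set_eqI) (simp add: mem_dcube mem_cube)
    then show "Q \<in> (\<lambda>(k, j). dcube (int k) j) ` (UNIV \<times> PiE (Basis :: 'a set) (\<lambda>_. UNIV))"
      by (intro image_eqI[of _ _ "(k, restrict (\<lambda>b. \<lfloor>x \<bullet> b * 2 ^ k\<rfloor>) Basis)"]) auto
  qed
  moreover have "countable (PiE (Basis :: 'a set) (\<lambda>_. UNIV :: int set))"
    by (rule countable_PiE) simp_all
  then have "countable ((UNIV :: nat set) \<times> PiE (Basis :: 'a set) (\<lambda>_. UNIV :: int set))"
    by (intro countable_SIGMA) simp_all
  ultimately show ?thesis by (rule countable_subset[OF _ countable_image])
qed

lemma cube_borel: "cube k x \<in> sets borel"
proof -
  have "cube k x = {z. \<forall>b\<in>Basis. of_int \<lfloor>x \<bullet> b * 2 ^ k\<rfloor> \<le> z \<bullet> b * 2 ^ k \<and> z \<bullet> b * 2 ^ k < of_int \<lfloor>x \<bullet> b * 2 ^ k\<rfloor> + 1}"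
    by (auto simp only: mem_cube_bounds)
  also have "\<dots> \<in> sets borel" by measurable
  finally show ?thesis .
qed

lemma norm_le_sup:
  fixes w :: "'a::euclidean_space" and c :: real
  assumes "\<And>b. b \<in> Basis \<Longrightarrow> \<bar>w \<bullet> b\<bar> \<le> c"
  shows "norm w \<le> DIM('a) * c"
proof -
  have "norm w \<le> (\<Sum>b\<in>Basis. \<bar>w \<bullet> b\<bar>)" by (rule norm_le_l1)
  also have "\<dots> \<le> DIM('a) * c" using assms by (rule sum_bounded_above)
  finally show ?thesis .
qed

lemma cube_subset_cball: "cube k (x::'a::euclidean_space) \<subseteq> cball x (DIM('a) / 2 ^ k)"
proof
  fix z assume z: "z \<in> cube k x"
  have "\<bar>(z - x) \<bullet> b\<bar> \<le> 1 / 2 ^ k" if "b \<in> Basis" for b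
  proof -
    have "\<bar>z \<bullet> b * 2 ^ k - x \<bullet> b * 2 ^ k\<bar> \<le> 1"
      using z[unfolded mem_cube, rule_format, OF that] floor_correct[of "z \<bullet> b * 2 ^ k"]
        floor_correct[of "x \<bullet> b * 2 ^ k"] by linarith
    then have "\<bar>(z - x) \<bullet> b\<bar> * 2 ^ k \<le> 1" by (simp add: inner_diff_left abs_mult flip: left_diff_distrib)
    then show ?thesis by (simp add: field_simps)
  qed
  then have "norm (z - x) \<le> DIM('a) * (1 / 2 ^ k)" by (rule norm_le_sup)
  then show "z \<in> cball x (DIM('a) / 2 ^ k)" by (simp add: dist_norm norm_minus_commute)
qed

lemma cube_bounded: "bounded (cube k x)"
  by (rule bounded_subset[OF bounded_cball cube_subset_cball])

lemma cube_side:
  fixes x :: "'a::euclidean_space"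
  assumes "b \<in> Basis"
  shows "corner k (\<lambda>b. \<lfloor>x \<bullet> b * 2 ^ k\<rfloor>) + (s / 2 ^ k) *\<^sub>R b \<in> cube k x \<longleftrightarrow> 0 \<le> s \<and> s < 1"
proof -
  have "(corner k (\<lambda>b. \<lfloor>x \<bullet> b * 2 ^ k\<rfloor>) + (s / 2 ^ k) *\<^sub>R b) \<bullet> b' * 2 ^ k =
    of_int \<lfloor>x \<bullet> b' * 2 ^ k\<rfloor> + (if b' = b then s else 0)" if "b' \<in> Basis" for b'
    using assms that by (simp add: inner_add_left corner_inner inner_Basis field_simps)
  then show ?thesis unfolding mem_cube_bounds using assms by auto
qed

text \<open>Half an edge is measured because the far end of an edge is missing from the half open
  cube; a lower bound up to a constant suffices.\<close>

lemma cube_diameter: "1 / 2 ^ Suc k \<le> diameter (cube k (x::'a::euclidean_space))"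
proof -
  obtain b :: 'a where b: "b \<in> Basis" using nonempty_Basis by blast
  let ?c = "corner k (\<lambda>b. \<lfloor>x \<bullet> b * 2 ^ k\<rfloor>)"
  have "dist (?c + (0 / 2 ^ k) *\<^sub>R b) (?c + ((1/2) / 2 ^ k) *\<^sub>R b) \<le> diameter (cube k x)"
    using cube_side[OF b, of k x 0] cube_side[OF b, of k x "1/2"]
    by (intro diameter_bounded_bound cube_bounded) auto
  then show ?thesis using b by (simp add: dist_norm)
qed

text \<open>Half an edge of the coarser cube already has the full length of an edge of the finer
  one. Thus the families of cubes used at different scales have no member in common.\<close>

lemma cube_level:
  fixes x y :: "'a::euclidean_space"
  assumes "cube k x = cube l y"
  shows "k = l"
proof -
  have False if "cube k x = cube l y" "k < l" for k l and x y :: 'a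
  proof -
    obtain b :: 'a where b: "b \<in> Basis" using nonempty_Basis by blast
    let ?c = "corner k (\<lambda>b. \<lfloor>x \<bullet> b * 2 ^ k\<rfloor>)"
    have "?c + (0 / 2 ^ k) *\<^sub>R b \<in> cube l y" "?c + ((1/2) / 2 ^ k) *\<^sub>R b \<in> cube l y"
      unfolding that(1)[symmetric] cube_side[OF b] by simp_all
    then have "(?c + ((1/2) / 2 ^ k) *\<^sub>R b) \<bullet> b * 2 ^ l < (?c + (0 / 2 ^ k) *\<^sub>R b) \<bullet> b * 2 ^ l + 1"
      unfolding mem_cube_bounds using b by force
    then have "(1/2) / 2 ^ k * 2 ^ l < (1::real)" using b by (simp add: inner_add_left distrib_right)
    moreover have "(2::real) * 2 ^ k \<le> 2 ^ l" using that(2) power_increasing[of "Suc k" l "2::real"] by simp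
    ultimately show False by (simp add: field_simps)
  qed
  from this[OF assms] this[OF assms[symmetric]] show ?thesis by (meson linorder_neqE_nat)
qed

text \<open>Makes the choice in \<open>dcenter\<close> independent of the representation of the cube.\<close>

lemma dcube_inj:
  fixes j j' :: "'a::euclidean_space \<Rightarrow> int"
  assumes eq: "dcube (int k) j = dcube k' j'" and b: "b \<in> Basis"
  shows "(real_of_int (j b) + 1/2) * 2 powr (- of_int (int k)) = (real_of_int (j' b) + 1/2) * 2 powr (- of_int k')"
proof -
  define lo hi lo' hi' :: "'a \<Rightarrow> real" where "lo b = of_int (j b) * 2 powr (- of_int (int k))"
    and "hi b = (of_int (j b) + 1) * 2 powr (- of_int (int k))"
    and "lo' b = of_int (j' b) * 2 powr (- of_int k')"
    and "hi' b = (of_int (j' b) + 1) * 2 powr (- of_int k')" for b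
  have box: "dcube (int k) j = {x. \<forall>b\<in>Basis. lo b \<le> x \<bullet> b \<and> x \<bullet> b < hi b}"
    "dcube k' j' = {x. \<forall>b\<in>Basis. lo' b \<le> x \<bullet> b \<and> x \<bullet> b < hi' b}"
    by (simp_all add: dcube_def lo_def hi_def lo'_def hi'_def)
  have pos: "lo b < hi b" "lo' b < hi' b" for b
    by (auto simp: lo_def hi_def lo'_def hi'_def)
  have *: "l' b \<le> l b \<and> h b \<le> h' b"
    if sub: "\<And>x. (\<forall>b\<in>Basis. l b \<le> x \<bullet> b \<and> x \<bullet> b < h b) \<Longrightarrow> (\<forall>b\<in>Basis. l' b \<le> x \<bullet> b \<and> x \<bullet> b < h' b)"
      and lh: "\<And>b. l b < h b" for l h l' h' :: "'a \<Rightarrow> real"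
  proof -
    have p: "l' b \<le> s \<and> s < h' b" if s: "l b \<le> s" "s < h b" for s
    proof -
      let ?x = "\<Sum>i\<in>Basis. (if i = b then s else l i) *\<^sub>R i"
      have "\<forall>i\<in>Basis. ?x \<bullet> i = (if i = b then s else l i)" by simp
      then have "\<forall>i\<in>Basis. l i \<le> ?x \<bullet> i \<and> ?x \<bullet> i < h i" using s lh by auto
      then have "l' b \<le> ?x \<bullet> b \<and> ?x \<bullet> b < h' b" using sub[of ?x] b by blast
      then show ?thesis using b by simp
    qed
    have "l' b \<le> l b" using p[of "l b"] lh by simp
    moreover have "h b \<le> h' b"
    proof (rule ccontr)
      assume "\<not> h b \<le> h' b"
      moreover have "l b < h' b" using p[of "l b"] lh by simp
      ultimately show False using p[of "h' b"] by simp
    qed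
    ultimately show ?thesis by blast
  qed
  have "lo' b \<le> lo b \<and> hi b \<le> hi' b" by (rule *) (use eq pos in \<open>auto simp: box set_eq_iff\<close>)
  moreover have "lo b \<le> lo' b \<and> hi' b \<le> hi b" by (rule *) (use eq pos in \<open>auto simp: box set_eq_iff\<close>)
  ultimately have "lo b + hi b = lo' b + hi' b" by simp
  then show ?thesis by (simp add: lo_def hi_def lo'_def hi'_def field_simps)
qed

lemma dcenter_cube:
  fixes x :: "'a::euclidean_space"
  assumes "b \<in> Basis"
  shows "dcenter (cube k x) \<bullet> b = (of_int \<lfloor>x \<bullet> b * 2 ^ k\<rfloor> + 1/2) / 2 ^ k"
proof -
  let ?j = "\<lambda>b. \<lfloor>x \<bullet> b * 2 ^ k\<rfloor>"
  have "\<exists>k' j'. cube k x = dcube k' j' \<and>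
    dcenter (cube k x) = (\<Sum>b\<in>Basis. ((of_int (j' b) + 1/2) * 2 powr (- of_int k')) *\<^sub>R b)"
    unfolding dcenter_def by (rule someI_ex) (auto simp: cube_def)
  then obtain k' j' where kj: "cube k x = dcube k' j'"
    "dcenter (cube k x) = (\<Sum>b\<in>Basis. ((of_int (j' b) + 1/2) * 2 powr (- of_int k')) *\<^sub>R b)" by blast
  have d: "dcube (int k) ?j = dcube k' j'" using kj(1) unfolding cube_def .
  have "dcenter (cube k x) \<bullet> b = (real_of_int (j' b) + 1/2) * 2 powr (- of_int k')"
    unfolding kj(2) using assms by simp
  moreover have "(real_of_int \<lfloor>x \<bullet> b * 2 ^ k\<rfloor> + 1/2) * 2 powr (- of_int (int k)) = (real_of_int (j' b) + 1/2) * 2 powr (- of_int k')"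
    by (rule dcube_inj[OF d assms])
  moreover have "2 powr (- of_int (int k)) = 1 / (2::real) ^ k" by (simp add: powr_minus powr_realpow divide_inverse)
  ultimately show ?thesis by (simp only: times_divide_eq_right mult_1_right)
qed

section \<open>Threefold dilates\<close>

lemma dilate3_interval:
  fixes j w :: real
  shows "(j \<le> 2/3 * (j + 1/2) + 1/3 * w \<and> 2/3 * (j + 1/2) + 1/3 * w < j + 1) \<longleftrightarrow> (j - 1 \<le> w \<and> w < j + 2)"
proof -
  have "2/3 * (j + 1/2) + 1/3 * w = j + (w - j + 1) / 3" by (simp add: field_simps)
  then show ?thesis by auto
qed

lemma mem_dilate3:
  fixes x :: "'a::euclidean_space"
  shows "z \<in> dilate3 (cube k x) \<longleftrightarrow>
    (\<forall>b\<in>Basis. of_int \<lfloor>x \<bullet> b * 2 ^ k\<rfloor> - 1 \<le> z \<bullet> b * 2 ^ k \<and> z \<bullet> b * 2 ^ k < of_int \<lfloor>x \<bullet> b * 2 ^ k\<rfloor> + 2)"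
proof -
  let ?c = "dcenter (cube k x)"
  have "z \<in> dilate3 (cube k x) \<longleftrightarrow> ?c + (1/3) *\<^sub>R (z - ?c) \<in> cube k x"
  proof
    assume "z \<in> dilate3 (cube k x)"
    then obtain y where "y \<in> cube k x" "z = ?c + 3 *\<^sub>R (y - ?c)" by (auto simp: dilate3_def)
    then show "?c + (1/3) *\<^sub>R (z - ?c) \<in> cube k x" by simp
  next
    assume "?c + (1/3) *\<^sub>R (z - ?c) \<in> cube k x"
    then show "z \<in> dilate3 (cube k x)" unfolding dilate3_def by (rule rev_image_eqI) simp
  qed
  also have "\<dots> \<longleftrightarrow> (\<forall>b\<in>Basis. of_int \<lfloor>x \<bullet> b * 2 ^ k\<rfloor> - 1 \<le> z \<bullet> b * 2 ^ k \<and> z \<bullet> b * 2 ^ k < of_int \<lfloor>x \<bullet> b * 2 ^ k\<rfloor> + 2)"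
    unfolding mem_cube_bounds
  proof (intro ball_cong refl)
    fix b :: 'a assume b: "b \<in> Basis"
    have "(?c + (1/3) *\<^sub>R (z - ?c)) \<bullet> b * 2 ^ k = 2/3 * (?c \<bullet> b * 2 ^ k) + 1/3 * (z \<bullet> b * 2 ^ k)"
      by (simp add: inner_add_left inner_diff_left field_simps)
    also have "?c \<bullet> b * 2 ^ k = of_int \<lfloor>x \<bullet> b * 2 ^ k\<rfloor> + 1/2" using dcenter_cube[OF b, of k x] by simp
    finally have e: "(?c + (1/3) *\<^sub>R (z - ?c)) \<bullet> b * 2 ^ k = 2/3 * (of_int \<lfloor>x \<bullet> b * 2 ^ k\<rfloor> + 1/2) + 1/3 * (z \<bullet> b * 2 ^ k)" .
    show "(of_int \<lfloor>x \<bullet> b * 2 ^ k\<rfloor> \<le> (?c + (1/3) *\<^sub>R (z - ?c)) \<bullet> b * 2 ^ k \<and>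
      (?c + (1/3) *\<^sub>R (z - ?c)) \<bullet> b * 2 ^ k < of_int \<lfloor>x \<bullet> b * 2 ^ k\<rfloor> + 1) \<longleftrightarrow>
      (of_int \<lfloor>x \<bullet> b * 2 ^ k\<rfloor> - 1 \<le> z \<bullet> b * 2 ^ k \<and> z \<bullet> b * 2 ^ k < of_int \<lfloor>x \<bullet> b * 2 ^ k\<rfloor> + 2)"
      unfolding e by (rule dilate3_interval)
  qed
  finally show ?thesis .
qed

lemma dilate3_borel: "dilate3 (cube k x) \<in> sets borel"
proof -
  have "dilate3 (cube k x) = {z. \<forall>b\<in>Basis. of_int \<lfloor>x \<bullet> b * 2 ^ k\<rfloor> - 1 \<le> z \<bullet> b * 2 ^ k \<and> z \<bullet> b * 2 ^ k < of_int \<lfloor>x \<bullet> b * 2 ^ k\<rfloor> + 2}"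
    by (auto simp only: mem_dilate3)
  also have "\<dots> \<in> sets borel" by measurable
  finally show ?thesis .
qed

lemma ball_subset_dilate3: "ball x (1 / 2 ^ k) \<subseteq> dilate3 (cube k (x::'a::euclidean_space))"
proof
  fix z assume z: "z \<in> ball x (1 / 2 ^ k)"
  show "z \<in> dilate3 (cube k x)"
    unfolding mem_dilate3
  proof
    fix b :: 'a assume "b \<in> Basis"
    then have "\<bar>(z - x) \<bullet> b\<bar> \<le> norm (z - x)" by (rule Basis_le_norm)
    also have "\<dots> < 1 / 2 ^ k" using z by (simp add: dist_norm norm_minus_commute)
    finally have "\<bar>(z - x) \<bullet> b\<bar> * 2 ^ k < 1" by (simp add: field_simps)
    then have "\<bar>z \<bullet> b * 2 ^ k - x \<bullet> b * 2 ^ k\<bar> < 1" by (simp add: inner_diff_left abs_mult flip: left_diff_distrib)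
    then show "of_int \<lfloor>x \<bullet> b * 2 ^ k\<rfloor> - 1 \<le> z \<bullet> b * 2 ^ k \<and> z \<bullet> b * 2 ^ k < of_int \<lfloor>x \<bullet> b * 2 ^ k\<rfloor> + 2"
      using floor_correct[of "x \<bullet> b * 2 ^ k"] by linarith
  qed
qed

lemma dilate3_subset_cball: "dilate3 (cube k (x::'a::euclidean_space)) \<subseteq> cball x (2 * DIM('a) / 2 ^ k)"
proof
  fix z assume z: "z \<in> dilate3 (cube k x)"
  have "\<bar>(z - x) \<bullet> b\<bar> \<le> 2 / 2 ^ k" if "b \<in> Basis" for b
  proof -
    have "\<bar>z \<bullet> b * 2 ^ k - x \<bullet> b * 2 ^ k\<bar> \<le> 2"
      using z[unfolded mem_dilate3, rule_format, OF that] floor_correct[of "x \<bullet> b * 2 ^ k"] by linarith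
    then have "\<bar>(z - x) \<bullet> b\<bar> * 2 ^ k \<le> 2" by (simp add: inner_diff_left abs_mult flip: left_diff_distrib)
    then show ?thesis by (simp add: field_simps)
  qed
  then have "norm (z - x) \<le> DIM('a) * (2 / 2 ^ k)" by (rule norm_le_sup)
  then show "z \<in> cball x (2 * DIM('a) / 2 ^ k)" by (simp add: dist_norm norm_minus_commute mult.commute)
qed

lemma dilate3_bounded: "bounded (dilate3 (cube k x))"
  by (rule bounded_subset[OF bounded_cball dilate3_subset_cball])

lemma diameter_dilate3:
  "0 < diameter (dilate3 (cube k x))"
  "diameter (dilate3 (cube k (x::'a::euclidean_space))) \<le> 4 * DIM('a) / 2 ^ k"
proof -
  have "diameter (ball x (1 / 2 ^ k)) \<le> diameter (dilate3 (cube k x))"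
    by (intro diameter_subset ball_subset_dilate3 dilate3_bounded)
  moreover have "0 < diameter (ball x (1 / 2 ^ k))" by (simp add: diameter_ball)
  ultimately show "0 < diameter (dilate3 (cube k x))" by linarith
  have "diameter (dilate3 (cube k x)) \<le> diameter (cball x (2 * DIM('a) / 2 ^ k))"
    by (intro diameter_subset dilate3_subset_cball bounded_cball)
  moreover have "\<not> 2 * DIM('a) / 2 ^ k < (0::real)" by (simp add: not_less)
  ultimately show "diameter (dilate3 (cube k x)) \<le> 4 * DIM('a) / 2 ^ k" by (simp add: diameter_cball)
qed

section \<open>Sets on which the measure is doubling\<close>

lemma doubling_iterate:
  assumes "\<And>\<rho>. 0 < \<rho> \<Longrightarrow> \<rho> \<le> \<delta> \<Longrightarrow> measure M (cball x (2 * \<rho>)) \<le> c * measure M (cball x \<rho>)"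
    and "0 < \<rho>" "2 ^ m * \<rho> \<le> \<delta>" "1 \<le> c"
  shows "measure M (cball x (2 ^ m * \<rho>)) \<le> c ^ m * measure M (cball x \<rho>)"
  using assms(3)
proof (induction m)
  case (Suc m)
  have "2 ^ m * \<rho> \<le> \<delta>" using Suc.prems assms(2) by (simp add: mult.assoc) (smt (verit) mult_pos_pos zero_less_power)
  then have "measure M (cball x (2 * (2 ^ m * \<rho>))) \<le> c * measure M (cball x (2 ^ m * \<rho>))"
    using assms(1,2) by simp
  also have "\<dots> \<le> c * (c ^ m * measure M (cball x \<rho>))"
    using Suc.IH \<open>2 ^ m * \<rho> \<le> \<delta>\<close> assms(4) by (intro mult_left_mono) auto
  finally show ?case by (simp add: mult_ac)
qed simp

lemma spt_measure_pos:
  assumes M: "radon_measure M" and "x \<in> spt M" "0 < \<rho>" "ball x \<rho> \<subseteq> S" "bounded S" "S \<in> sets borel"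
  shows "0 < measure M S"
proof -
  have "0 < emeasure M (ball x \<rho>)" using assms by (auto simp: spt_def)
  also have "\<dots> \<le> emeasure M S" using M assms(4,6) by (intro emeasure_mono) (auto simp: radon_measure_def)
  finally show ?thesis
    using radon_bounded_finite[OF M assms(5)] by (simp add: measure_def enn2real_positive_iff)
qed

lemma radon_measure_mono:
  assumes M: "radon_measure M" and "S \<subseteq> S'" "bounded S'" "S' \<in> sets borel"
  shows "measure M S \<le> measure M S'"
proof -
  have "emeasure M S \<le> emeasure M S'" using M assms(2,4) by (intro emeasure_mono) (auto simp: radon_measure_def)
  then show ?thesis using radon_bounded_finite[OF M assms(3)] by (simp add: measure_def enn2real_mono)
qed

text \<open>A line nearly optimal for the dilated cube is passed on to barycenters of small balls.
  By doubling, each ball carries at least the proportion \<open>1 / c ^ m\<close> of the mass of the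
  dilated cube, so a mean over the ball is at most \<open>c ^ m\<close> times the mean over the
  cube.\<close>

lemma doubling_curve:
  fixes M :: "'a::euclidean_space measure" and A :: "'a set"
  assumes M: "radon_measure M" and p: "1 \<le> p" and A: "bounded A" "A \<noteq> {}" "A \<subseteq> spt M"
    and c: "1 \<le> c" and \<delta>: "0 < \<delta>"
    and doubling: "\<And>x \<rho>. x \<in> A \<Longrightarrow> 0 < \<rho> \<Longrightarrow> \<rho> \<le> \<delta> \<Longrightarrow> measure M (cball x (2 * \<rho>)) \<le> c * measure M (cball x \<rho>)"
    and S: "\<And>F. finite F \<Longrightarrow> F \<subseteq> dyadic1 \<Longrightarrow> (\<And>Q. Q \<in> F \<Longrightarrow> Q \<inter> A \<noteq> {}) \<Longrightarrow>
      (\<Sum>Q\<in>F. (beta_p M p (dilate3 Q))\<^sup>2 * diameter Q) \<le> S"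
  shows "\<exists>L f. L-lipschitz_on {0..1::real} f \<and> A \<subseteq> f ` {0..1}"
proof (rule traveling_salesman_curve[where 'a = 'a])
  fix R :: real
  assume R: "R \<ge> 1"
    "\<And>(A::'a set) y \<alpha> t r0 C. \<lbrakk>bounded A; A \<noteq> {}; 0 < r0;
      \<And>k x. x \<in> A \<Longrightarrow> dist (y k x) x \<le> r0 / 2 ^ k / 100; \<And>k v. 0 \<le> \<alpha> k v;
      \<And>k v. v \<in> A \<Longrightarrow> flat_on (\<alpha> k v * (r0 / 2 ^ k)) (t k v)
         (\<Union>x\<in>{x\<in>A. dist v x \<le> R * (r0 / 2 ^ k)}. {y k x, y (Suc k) x});
      \<And>X n. (\<And>k. X k \<subseteq> A) \<Longrightarrow> (\<And>k. separated (r0 / 2 ^ k) (X k)) \<Longrightarrow>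
         (\<Sum>k<n. \<Sum>v\<in>X k. (\<alpha> k v)\<^sup>2 * (r0 / 2 ^ k)) \<le> C\<rbrakk>
      \<Longrightarrow> \<exists>L f. L-lipschitz_on {0..1::real} f \<and> A \<subseteq> f ` {0..1}"
  define n :: real where "n = DIM('a)"
  \<comment> \<open>Cubes will have side \<open>W * r k\<close> with \<open>W > R + 1\<close>, so
    that the dilate contains the window of radius \<open>R * r k\<close> together with the small
    balls around its points.\<close>
  obtain j0 where j0: "R + 1 < 2 ^ j0" using real_arch_pow[of 2 "R + 1"] by auto
  define W :: real where "W = 2 ^ j0"
  have W: "R + 1 < W" using j0 by (simp add: W_def)
  \<comment> \<open>After \<open>m\<close> doublings a small ball contains the dilated cube. The 200
    reflects radius \<open>r k / 100\<close> at scale \<open>k\<close> and half of it at scale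
    \<open>Suc k\<close>.\<close>
  obtain m where "200 * (2 * n * W + R) < 2 ^ m" using real_arch_pow[of 2 "200 * (2 * n * W + R)"] by auto
  then have m: "200 * (2 * n * W + R) \<le> 2 ^ m" by simp
  \<comment> \<open>The initial scale must be so small that all \<open>m\<close> doublings stay
    below \<open>\<delta>\<close>.\<close>
  obtain k1 where k1: "2 ^ m / \<delta> < 2 ^ k1" using real_arch_pow[of 2 "2 ^ m / \<delta>"] by auto
  define k0 where "k0 = j0 + k1"
  define r0 :: real where "r0 = 1 / 2 ^ k0"
  define r where "r k = r0 / 2 ^ k" for k :: nat
  have r: "0 < r k" "r (Suc k) = r k / 2" "r k \<le> 1" for k
  proof -
    show "0 < r k" "r (Suc k) = r k / 2" by (simp_all add: r_def r0_def)
    have "(1::real) \<le> 2 ^ k0 * 2 ^ k" by (metis one_le_numeral one_le_power power_add)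
    then show "r k \<le> 1" by (simp add: r_def r0_def)
  qed
  have rm: "2 ^ m * r k \<le> \<delta>" for k
  proof -
    have "(2::real) ^ k1 \<le> 2 ^ (k0 + k)" by (intro power_increasing) (auto simp: k0_def)
    then have "2 ^ m / \<delta> \<le> 2 ^ k0 * 2 ^ k" using k1 by (simp add: power_add)
    then show ?thesis using \<delta> by (simp add: r_def r0_def field_simps)
  qed
  define l where "l k = k1 + k" for k
  have l: "1 / 2 ^ l k = W * r k" for k
    by (simp add: l_def W_def r_def r0_def k0_def power_add)
  have linj: "l k = l k' \<longleftrightarrow> k = k'" for k k' by (simp add: l_def)
  define E where "E k v = dilate3 (cube (l k) v)" for k and v :: 'a
  have Esub: "ball v (W * r k) \<subseteq> E k v" "E k v \<subseteq> cball v (2 * n * (W * r k))" for k v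
    using ball_subset_dilate3[of v "l k"] dilate3_subset_cball[of "l k" v] l[of k]
    by (simp_all add: E_def n_def divide_inverse)
  have E: "bounded (E k v)" "E k v \<in> sets borel" "0 < diameter (E k v)" "diameter (E k v) \<le> 4 * n * (W * r k)" for k v
    using diameter_dilate3[of "l k" v] l[of k]
    by (simp_all add: E_def dilate3_bounded dilate3_borel n_def divide_inverse)
  have Epos: "0 < measure M (E k v)" if "v \<in> A" for k v
    by (rule spt_measure_pos[OF M _ _ Esub(1) E(1,2)]) (use that A(3) W R(1) r(1)[of k] in auto)
  have "\<forall>k. \<exists>D. \<forall>X. X \<subseteq> A \<longrightarrow> separated (r k) X \<longrightarrow> finite X \<and> card X \<le> D"
    using separated_finite[OF A(1) r(1)] by meson
  then obtain D where D: "\<And>k X. X \<subseteq> A \<Longrightarrow> separated (r k) X \<Longrightarrow> finite X \<and> card X \<le> D k" by metis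
  \<comment> \<open>Slack above beta, which may vanish or not be attained. Since a net at scale
    \<open>k\<close> has at most \<open>D k\<close> points, this choice is summable over all
    nets.\<close>
  define \<epsilon> :: "nat \<Rightarrow> real" where "\<epsilon> k = 1 / (2 ^ k * (real (D k) + 1))" for k
  have \<epsilon>: "0 < \<epsilon> k" for k by (simp add: \<epsilon>_def)
  have \<beta>: "0 \<le> beta_p M p F" for F
    unfolding beta_p_def
  proof (cases "emeasure M F = 0")
    case False
    have "lines \<noteq> ({} :: 'a set set)"
    proof -
      obtain b :: 'a where "b \<in> Basis" using nonempty_Basis by blast
      then have "range (\<lambda>t::real. 0 + t *\<^sub>R b) \<in> lines" unfolding lines_def by (force dest: nonzero_Basis)
      then show ?thesis by blast
    qed
    then show "0 \<le> (if emeasure M F = 0 then 0 else (INF L\<in>lines.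
      (enn2real (\<integral>\<^sup>+ x. ennreal ((infdist x L / diameter F) powr p) * indicator F x \<partial>M) / measure M F) powr (1 / p)))"
      using False by (simp add: cINF_greatest)
  qed simp
  define s where "s k v = beta_p M p (E k v) + \<epsilon> k" for k v
  have s: "beta_p M p (E k v) < s k v" "0 < s k v" for k v
    using \<beta>[of "E k v"] \<epsilon>[of k] by (auto simp: s_def)
  define line where "line k v w \<longleftrightarrow> norm (snd w) = 1 \<and> (LINT z:E k v|M. norm (normal_part (snd w) (z - fst w)))
      \<le> 2 * s k v * diameter (E k v) * measure M (E k v)" for k v and w :: "'a \<times> 'a"
  define w where "w k v = (SOME w. line k v w)" for k v
  have lw: "line k v (w k v)" if v: "v \<in> A" for k v
  proof -
    obtain a u where "norm u = 1"
      "(LINT z:E k v|M. norm (normal_part u (z - a))) \<le> 2 * s k v * diameter (E k v) * measure M (E k v)"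
      by (rule beta_line[OF M p E(1,2) Epos[OF v] E(3) s])
    then have "line k v (a, u)" by (simp add: line_def)
    then show ?thesis unfolding w_def by (rule someI)
  qed
  define a u where "a k v = fst (w k v)" and "u k v = snd (w k v)" for k v
  have au: "norm (u k v) = 1"
    "(LINT z:E k v|M. norm (normal_part (u k v) (z - a k v))) \<le> 2 * s k v * diameter (E k v) * measure M (E k v)"
    if "v \<in> A" for k v
    using lw[OF that, of k] by (simp_all add: line_def a_def u_def)
  define y where "y k x = barycenter M (cball x (r k / 100))" for k x
  have Bpos: "0 < measure M (cball x (r k / 100))" if "x \<in> A" for k x
    by (rule spt_measure_pos[OF M, of x "r k / 100"]) (use that A(3) r(1)[of k] in auto)
  \<comment> \<open>The factors are \<open>2 * s\<close> from \<open>beta_line\<close>, the diameter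
    bound \<open>4 * n * W * r k\<close> and the mass ratio \<open>c ^ m\<close>.\<close>
  define C1 where "C1 = 8 * n * W * c ^ m"
  have n: "1 \<le> n" by (simp add: n_def DIM_positive Suc_leI)
  have C1: "0 \<le> C1" using n W R(1) c by (simp add: C1_def)
  define \<alpha> where "\<alpha> k v = C1 * s k v" for k v
  have near: "norm (normal_part (u k v) (y i x - a k v)) \<le> \<alpha> k v * r k"
    if vx: "v \<in> A" "x \<in> A" "dist v x \<le> R * r k" and i: "i = k \<or> i = Suc k" for k v i x
  proof -
    let ?B = "cball x (r i / 100)" and ?f = "\<lambda>z. norm (normal_part (u k v) (z - a k v))"
    have ri: "r k / 2 \<le> r i" "r i \<le> r k" using i r(1)[of k] r(2)[of k] by auto
    have BE: "?B \<subseteq> E k v"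
    proof
      fix z assume "z \<in> ?B"
      then have "dist v z \<le> R * r k + r k / 100" using vx(3) ri(2) dist_triangle[of v z x] by simp
      also have "\<dots> \<le> (R + 1) * r k" using r(1)[of k] by (simp add: algebra_simps)
      also have "\<dots> < W * r k" using W r(1)[of k] by simp
      finally show "z \<in> E k v" using Esub(1)[of v k] by (auto simp: subset_iff)
    qed
    have fint: "set_integrable M F ?f" if "bounded F" "F \<in> sets borel" for F
      by (intro radon_integrable_on_bounded[OF M that] continuous_intros
          bounded_linear.continuous_on[OF bounded_linear_normal_part])
    have "E k v \<subseteq> cball x (2 ^ m * (r i / 100))"
    proof
      fix z assume "z \<in> E k v"
      then have "dist v z \<le> 2 * n * (W * r k)" using Esub(2)[of k v] by (auto simp: subset_iff)
      then have "dist x z \<le> (2 * n * W + R) * r k"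
        using vx(3) dist_triangle[of x z v] by (simp add: algebra_simps dist_commute)
      also have "\<dots> \<le> (2 ^ m / 200) * r k" using m r(1)[of k] by (intro mult_right_mono) auto
      also have "\<dots> \<le> 2 ^ m * (r i / 100)" using ri(1) by (simp add: field_simps)
      finally show "z \<in> cball x (2 ^ m * (r i / 100))" by simp
    qed
    then have "measure M (E k v) \<le> measure M (cball x (2 ^ m * (r i / 100)))"
      by (intro radon_measure_mono[OF M]) auto
    also have "\<dots> \<le> c ^ m * measure M ?B"
    proof (rule doubling_iterate[OF _ _ _ c])
      show "2 ^ m * (r i / 100) \<le> \<delta>" using rm[of i] \<delta> by simp
    qed (use doubling[OF vx(2)] r(1)[of i] in auto)
    finally have \<mu>: "measure M (E k v) \<le> c ^ m * measure M ?B" .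
    have "norm (normal_part (u k v) (y i x - a k v)) \<le> (LINT z:?B|M. ?f z) / measure M ?B"
      unfolding y_def by (rule norm_barycenter_le[OF M _ _ Bpos[OF vx(2)] bounded_linear_normal_part]) auto
    also have "(LINT z:?B|M. ?f z) \<le> (LINT z:E k v|M. ?f z)"
      using fint[OF E(1,2)] fint[of ?B] BE unfolding set_lebesgue_integral_def set_integrable_def
      by (intro integral_mono) (auto simp: indicator_def)
    also have "\<dots> \<le> 2 * s k v * diameter (E k v) * measure M (E k v)" by (rule au(2)[OF vx(1)])
    also have "\<dots> \<le> 2 * s k v * (4 * n * (W * r k)) * (c ^ m * measure M ?B)"
      using E(4)[of k v] s(2)[of k v] \<mu> E(3)[of k v] n W R(1) r(1)[of k] by (intro mult_mono) auto
    also have "\<dots> / measure M ?B = \<alpha> k v * r k"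
      using Bpos[OF vx(2), of i] by (simp add: \<alpha>_def C1_def)
    finally show ?thesis using Bpos[OF vx(2), of i] by (simp add: divide_right_mono)
  qed
  obtain N where N: "\<And>r v (S::'a set). \<lbrakk>r > 0; S \<subseteq> cball v (n * W * r);
    \<And>x y. x \<in> S \<Longrightarrow> y \<in> S \<Longrightarrow> x \<noteq> y \<Longrightarrow> r / 2 \<le> dist x y\<rbrakk> \<Longrightarrow> finite S \<and> card S \<le> N"
    using packing_bound by blast
  define h where "h Q = (beta_p M p (dilate3 Q))\<^sup>2 * diameter Q" for Q :: "'a set"
  have h0: "0 \<le> h Q" if "Q \<in> dyadic1" for Q
    using that cube_diameter unfolding dyadic1_cube h_def by (force intro!: mult_nonneg_nonneg diameter_ge_0 cube_bounded)
  have sum: "(\<Sum>k<K. \<Sum>v\<in>X k. (\<alpha> k v)\<^sup>2 * r k) \<le> 4 * C1\<^sup>2 * (N * S + 2)"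
    if X: "\<And>k. X k \<subseteq> A" "\<And>k. separated (r k) (X k)" for X K
  proof -
    have finX: "finite (X k)" "card (X k) \<le> D k" for k using D[OF X] by auto
    define \<Q> where "\<Q> k = cube (l k) ` X k" for k
    have \<alpha>h: "(\<alpha> k v)\<^sup>2 * r k \<le> 4 * C1\<^sup>2 * (h (cube (l k) v) + (\<epsilon> k)\<^sup>2)" for k v
    proof -
      let ?b = "beta_p M p (E k v)"
      have "(s k v)\<^sup>2 \<le> 2 * ?b\<^sup>2 + 2 * (\<epsilon> k)\<^sup>2"
        using zero_le_power2[of "?b - \<epsilon> k"] by (simp add: s_def power2_eq_square algebra_simps)
      then have "(s k v)\<^sup>2 * r k \<le> (2 * ?b\<^sup>2 + 2 * (\<epsilon> k)\<^sup>2) * r k" using r(1)[of k] by (intro mult_right_mono) auto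
      also have "\<dots> = 2 * (?b\<^sup>2 * r k) + 2 * ((\<epsilon> k)\<^sup>2 * r k)" by (simp add: algebra_simps)
      also have "?b\<^sup>2 * r k \<le> ?b\<^sup>2 * (2 * diameter (cube (l k) v))"
      proof (rule mult_left_mono)
        have "r k \<le> W * r k" using W R(1) r(1)[of k] by simp
        also have "\<dots> = 2 * (1 / 2 ^ Suc (l k))" using l[of k] by simp
        also have "\<dots> \<le> 2 * diameter (cube (l k) v)" using cube_diameter by (intro mult_left_mono) auto
        finally show "r k \<le> 2 * diameter (cube (l k) v)" .
      qed simp
      also have "(\<epsilon> k)\<^sup>2 * r k \<le> (\<epsilon> k)\<^sup>2" using r(3)[of k] by (simp add: mult_left_le)
      finally have "(s k v)\<^sup>2 * r k \<le> 4 * (h (cube (l k) v) + (\<epsilon> k)\<^sup>2)"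
        by (simp add: h_def E_def) (smt (verit) zero_le_power2)
      then have "C1\<^sup>2 * ((s k v)\<^sup>2 * r k) \<le> C1\<^sup>2 * (4 * (h (cube (l k) v) + (\<epsilon> k)\<^sup>2))" by (intro mult_left_mono) auto
      then show ?thesis by (simp add: \<alpha>_def power_mult_distrib algebra_simps)
    qed
    have e1: "(\<Sum>v\<in>X k. (\<epsilon> k)\<^sup>2) \<le> (1/2) ^ k" for k
    proof -
      have "1 * 1 \<le> (2::real) ^ k * (real (D k) + 1)" by (intro mult_mono) auto
      then have "\<epsilon> k \<le> 1" by (simp add: \<epsilon>_def)
      then have "(\<epsilon> k)\<^sup>2 \<le> \<epsilon> k" using \<epsilon>[of k] by (simp add: power2_eq_square mult_left_le)
      then have "(\<Sum>v\<in>X k. (\<epsilon> k)\<^sup>2) \<le> (real (D k) + 1) * \<epsilon> k"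
        using finX(2)[of k] \<epsilon>[of k] by (simp add: mult_mono)
      also have "(real (D k) + 1) * \<epsilon> k = (1/2) ^ k"
      proof -
        have "real (D k) + 1 \<noteq> 0" by linarith
        then show ?thesis by (simp add: \<epsilon>_def power_one_over)
      qed
      finally show ?thesis .
    qed
    \<comment> \<open>Several net points may share a cube, but by packing at most \<open>N\<close>
      of them.\<close>
    have fib: "(\<Sum>v\<in>X k. h (cube (l k) v)) \<le> N * (\<Sum>Q\<in>\<Q> k. h Q)" for k
    proof -
      have "(\<Sum>v\<in>X k. h (cube (l k) v)) = (\<Sum>Q\<in>\<Q> k. \<Sum>v\<in>{v\<in>X k. cube (l k) v = Q}. h (cube (l k) v))"
        unfolding \<Q>_def by (rule sum.image_gen[OF finX(1)])
      also have "\<dots> = (\<Sum>Q\<in>\<Q> k. card {v\<in>X k. cube (l k) v = Q} * h Q)" by simp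
      also have "\<dots> \<le> (\<Sum>Q\<in>\<Q> k. N * h Q)"
      proof (rule sum_mono)
        fix Q assume "Q \<in> \<Q> k"
        then obtain v where v: "v \<in> X k" "Q = cube (l k) v" by (auto simp: \<Q>_def)
        have "{w\<in>X k. cube (l k) w = Q} \<subseteq> cball v (n * W * r k)"
        proof
          fix w assume "w \<in> {w\<in>X k. cube (l k) w = Q}"
          then have "w \<in> cube (l k) v" using v(2) cube_self by blast
          then have "w \<in> cball v (n * (1 / 2 ^ l k))" using cube_subset_cball[of "l k" v] by (auto simp: n_def)
          then show "w \<in> cball v (n * W * r k)" unfolding l by (simp add: mult.assoc)
        qed
        then have "finite {w\<in>X k. cube (l k) w = Q} \<and> card {w\<in>X k. cube (l k) w = Q} \<le> N"
        proof (rule N[OF r(1)])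
          fix x y assume "x \<in> {w\<in>X k. cube (l k) w = Q}" "y \<in> {w\<in>X k. cube (l k) w = Q}" "x \<noteq> y"
          then have "r k \<le> dist x y" using X(2)[of k] by (auto simp: separated_def)
          then show "r k / 2 \<le> dist x y" using r(1)[of k] by simp
        qed
        moreover have "0 \<le> h Q" using v(2) by (intro h0) simp
        ultimately show "card {w\<in>X k. cube (l k) w = Q} * h Q \<le> N * h Q" by (intro mult_right_mono) auto
      qed
      finally show ?thesis by (simp add: sum_distrib_left)
    qed
    \<comment> \<open>A cube determines its level, so none is counted at two scales.\<close>
    have "(\<Sum>k<K. \<Sum>Q\<in>\<Q> k. h Q) = (\<Sum>Q\<in>(\<Union>k<K. \<Q> k). h Q)"
    proof (rule sum.UNION_disjoint[symmetric])
      show "\<forall>i\<in>{..<K}. finite (\<Q> i)" using finX by (simp add: \<Q>_def)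
      show "\<forall>i\<in>{..<K}. \<forall>j\<in>{..<K}. i \<noteq> j \<longrightarrow> \<Q> i \<inter> \<Q> j = {}"
        using cube_level linj unfolding \<Q>_def by blast
    qed simp
    also have "\<dots> \<le> S"
      unfolding h_def
    proof (rule S)
      show "finite (\<Union>k<K. \<Q> k)" using finX by (simp add: \<Q>_def)
      show "(\<Union>k<K. \<Q> k) \<subseteq> dyadic1" by (auto simp: \<Q>_def)
      fix Q assume "Q \<in> (\<Union>k<K. \<Q> k)"
      then obtain k v where "v \<in> X k" "Q = cube (l k) v" by (auto simp: \<Q>_def)
      then have "v \<in> Q \<inter> A" using X(1) by auto
      then show "Q \<inter> A \<noteq> {}" by blast
    qed
    finally have hS: "(\<Sum>k<K. \<Sum>Q\<in>\<Q> k. h Q) \<le> S" .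
    have "(\<Sum>k<K. \<Sum>v\<in>X k. (\<alpha> k v)\<^sup>2 * r k) \<le> (\<Sum>k<K. \<Sum>v\<in>X k. 4 * C1\<^sup>2 * (h (cube (l k) v) + (\<epsilon> k)\<^sup>2))"
      by (intro sum_mono) (rule \<alpha>h)
    also have "\<dots> = 4 * C1\<^sup>2 * (\<Sum>k<K. (\<Sum>v\<in>X k. h (cube (l k) v)) + (\<Sum>v\<in>X k. (\<epsilon> k)\<^sup>2))"
      by (simp only: sum_distrib_left[symmetric] sum.distrib)
    also have "\<dots> \<le> 4 * C1\<^sup>2 * (\<Sum>k<K. N * (\<Sum>Q\<in>\<Q> k. h Q) + (1/2) ^ k)"
      by (intro mult_left_mono sum_mono add_mono fib e1) auto
    also have "(\<Sum>k<K. N * (\<Sum>Q\<in>\<Q> k. h Q) + (1/2) ^ k) = N * (\<Sum>k<K. \<Sum>Q\<in>\<Q> k. h Q) + (\<Sum>k<K. (1/2) ^ k)"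
      by (simp only: sum_distrib_left sum.distrib)
    also have "\<dots> \<le> N * S + 2"
    proof (rule add_mono)
      show "N * (\<Sum>k<K. \<Sum>Q\<in>\<Q> k. h Q) \<le> N * S" using hS by (intro mult_left_mono) auto
      have "(\<Sum>k<K. (1/2) ^ k) = 2 - 2 * (1/2::real) ^ K" by (induction K) auto
      then show "(\<Sum>k<K. (1/2) ^ k) \<le> (2::real)" by simp
    qed
    finally show ?thesis by (simp add: mult_left_mono)
  qed
  show ?thesis
  proof (rule R(2)[of A r0 y \<alpha> "\<lambda>k v z. z \<bullet> u k v"])
    show "bounded A" "A \<noteq> {}" by (fact A)+
    show "0 < r0" by (simp add: r0_def)
    show "dist (y k x) x \<le> r0 / 2 ^ k / 100" if "x \<in> A" for k x
      unfolding r_def[symmetric] y_def using Bpos[OF that] by (rule barycenter_dist[OF M])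
    show "0 \<le> \<alpha> k v" for k v using C1 s(2)[of k v] by (simp add: \<alpha>_def)
    show "flat_on (\<alpha> k v * (r0 / 2 ^ k)) (\<lambda>z. z \<bullet> u k v)
        (\<Union>x\<in>{x \<in> A. dist v x \<le> R * (r0 / 2 ^ k)}. {y k x, y (Suc k) x})" if "v \<in> A" for k v
      unfolding r_def[symmetric]
      by (rule flat_on_line[OF au(1)[OF that], where a = "a k v"]) (use near that in blast)
    show "(\<Sum>k<n. \<Sum>v\<in>X k. (\<alpha> k v)\<^sup>2 * (r0 / 2 ^ k)) \<le> 4 * C1\<^sup>2 * (N * S + 2)"
      if "\<And>k. X k \<subseteq> A" "\<And>k. separated (r0 / 2 ^ k) (X k)" for X n
      using sum[of X n] that unfolding r_def by blast
  qed
qed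

section \<open>Decomposition into countably many pieces\<close>

text \<open>The maximal-function argument for dyadic cubes: the maximal cubes in which B has relative
  measure below 1/j are disjoint.\<close>

lemma sparse_part:
  fixes M :: "'a::euclidean_space measure" and j :: nat
  assumes M: "radon_measure M" and B: "B \<in> sets borel" "B \<subseteq> U" "open U"
    and U: "\<And>k x. x \<in> B \<Longrightarrow> cube k x \<subseteq> U"
  defines "Z \<equiv> {x\<in>B. \<exists>k. of_nat j * emeasure M (B \<inter> cube k x) < emeasure M (cube k x)}"
  shows "Z \<in> sets borel" "of_nat j * emeasure M Z \<le> emeasure M U"
proof -
  have sets: "sets M = sets borel" using M by (simp add: radon_measure_def)
  define bad where "bad k x \<longleftrightarrow> of_nat j * emeasure M (B \<inter> cube k x) < emeasure M (cube k x)" for k and x :: 'a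
  \<comment> \<open>The least level belongs to the largest cube around \<open>x\<close> that is
    bad.\<close>
  define K where "K x = (LEAST k. bad k x)" for x
  define \<M> where "\<M> = (\<lambda>x. cube (K x) x) ` Z"
  have Z: "x \<in> B" "bad (K x) x" if x: "x \<in> Z" for x
  proof -
    obtain k where "x \<in> B" "bad k x" using x by (auto simp: Z_def bad_def)
    then show "x \<in> B" "bad (K x) x" unfolding K_def by (auto intro: LeastI)
  qed
  have cnt: "countable \<M>"
    by (rule countable_subset[OF _ countable_dyadic1]) (auto simp: \<M>_def)
  \<comment> \<open>If two selected cubes meet, the larger one contains both points and is bad for
    both, so minimality makes the levels equal.\<close>
  have le: "K y \<le> K x" if x: "x \<in> Z" and y: "y \<in> Z" and z: "z \<in> cube (K x) x" "z \<in> cube (K y) y" "K x \<le> K y" for x y z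
  proof -
    have "cube (K x) y = cube (K x) z" by (rule cube_coarser[OF cube_eq[OF z(2), symmetric] z(3)])
    also have "\<dots> = cube (K x) x" by (rule cube_eq[OF z(1)])
    finally have "bad (K x) y" using Z(2)[OF x] by (simp add: bad_def)
    then show ?thesis unfolding K_def[of y] by (rule Least_le)
  qed
  have disj: "disjoint_family_on (\<lambda>Q. Q) \<M>"
    unfolding disjoint_family_on_def
  proof (intro ballI impI, rule ccontr)
    fix P Q assume PQ: "P \<in> \<M>" "Q \<in> \<M>" "P \<noteq> Q" "P \<inter> Q \<noteq> {}"
    then obtain x y z where xyz: "x \<in> Z" "y \<in> Z" "P = cube (K x) x" "Q = cube (K y) y" "z \<in> P" "z \<in> Q"
      unfolding \<M>_def by blast
    have "K x = K y"
      using le[OF xyz(1,2), of z] le[OF xyz(2,1), of z] xyz by (cases "K x \<le> K y") auto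
    then have "P = Q" using cube_eq[of z "K x" x] cube_eq[of z "K y" y] xyz by simp
    then show False using PQ(3) by simp
  qed
  have \<M>: "Q \<in> sets borel" "of_nat j * emeasure M (B \<inter> Q) \<le> emeasure M Q" "Q \<subseteq> U" if "Q \<in> \<M>" for Q
  proof -
    obtain x where x: "x \<in> Z" "Q = cube (K x) x" using \<open>Q \<in> \<M>\<close> by (auto simp: \<M>_def)
    show "Q \<in> sets borel" by (simp add: x cube_borel)
    show "of_nat j * emeasure M (B \<inter> Q) \<le> emeasure M Q" using Z(2)[OF x(1)] by (simp add: bad_def x less_imp_le)
    show "Q \<subseteq> U" unfolding x by (rule U[OF Z(1)[OF x(1)]])
  qed
  have Zeq: "Z = (\<Union>Q\<in>\<M>. B \<inter> Q)"
  proof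
    show "Z \<subseteq> (\<Union>Q\<in>\<M>. B \<inter> Q)"
    proof
      fix x assume x: "x \<in> Z"
      then show "x \<in> (\<Union>Q\<in>\<M>. B \<inter> Q)" using Z(1)[OF x] by (intro UN_I[of "cube (K x) x"]) (auto simp: \<M>_def)
    qed
    show "(\<Union>Q\<in>\<M>. B \<inter> Q) \<subseteq> Z"
    proof
      fix z assume "z \<in> (\<Union>Q\<in>\<M>. B \<inter> Q)"
      then obtain x where x: "x \<in> Z" "z \<in> B" "z \<in> cube (K x) x" by (auto simp: \<M>_def)
      have "cube (K x) z = cube (K x) x" using x(3) by (rule cube_eq)
      then have "bad (K x) z" using Z(2)[OF x(1)] by (simp add: bad_def)
      then show "z \<in> Z" using x(2) by (auto simp: Z_def bad_def)
    qed
  qed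
  show Zb: "Z \<in> sets borel" unfolding Zeq using cnt B(1) \<M>(1) by (intro sets.countable_UN' sets.Int) auto
  have "of_nat j * emeasure M Z = of_nat j * (\<integral>\<^sup>+Q. emeasure M (B \<inter> Q) \<partial>count_space \<M>)"
    unfolding Zeq using cnt B(1) \<M>(1) disj sets
    by (subst emeasure_UN_countable) (auto simp: disjoint_family_on_def)
  also have "\<dots> = (\<integral>\<^sup>+Q. of_nat j * emeasure M (B \<inter> Q) \<partial>count_space \<M>)"
    by (rule nn_integral_cmult[symmetric]) simp
  also have "\<dots> \<le> (\<integral>\<^sup>+Q. emeasure M Q \<partial>count_space \<M>)"
    by (rule nn_integral_mono) (simp add: \<M>(2))
  also have "\<dots> = emeasure M (\<Union>Q\<in>\<M>. Q)"
    using cnt \<M>(1) disj sets by (subst emeasure_UN_countable) auto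
  also have "\<dots> \<le> emeasure M U" using \<M>(3) B(3) sets by (intro emeasure_mono) auto
  finally show "of_nat j * emeasure M Z \<le> emeasure M U" .
qed

lemma ennreal_zero_if_multiples_bounded:
  fixes a b :: ennreal
  assumes "b < \<infinity>" "\<And>j::nat. of_nat j * a \<le> b"
  shows "a = 0"
proof (rule ccontr)
  assume a: "a \<noteq> 0"
  have "a \<le> b" using assms(2)[of 1] by simp
  then have fin: "a < \<infinity>" "b < \<infinity>" using assms(1) by (auto intro: le_less_trans)
  obtain a' where a': "a = ennreal a'" "0 \<le> a'" using fin(1) by (cases a) auto
  obtain b' where b': "b = ennreal b'" "0 \<le> b'" using fin(2) by (cases b) auto
  have "0 < a'" using a a' by (cases "a' = 0") auto
  then obtain j :: nat where j: "b' < of_nat j * a'" using reals_Archimedean3 by blast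
  have "ennreal (of_nat j * a') \<le> ennreal b'"
    using assms(2)[of j] a' b' by (simp add: ennreal_mult' flip: ennreal_of_nat_eq_real_of_nat)
  then show False using j b' by (simp add: ennreal_le_iff)
qed

section \<open>Sublevel sets of the Jones function\<close>

definition beta_term :: "'a::euclidean_space measure \<Rightarrow> real \<Rightarrow> 'a set \<Rightarrow> ennreal" where
  "beta_term M p Q = ennreal ((beta_p M p (dilate3 Q))\<^sup>2 * diameter Q) / emeasure M Q"

lemma Jtilde_finite_sum_le:
  assumes "finite F" "F \<subseteq> dyadic1"
  shows "(\<Sum>Q\<in>F. beta_term M p Q * indicator Q x) \<le> Jtilde M p x"
proof -
  have "(\<Sum>Q\<in>F. beta_term M p Q * indicator Q x) \<le>
    (SUP F\<in>{F. finite F \<and> F \<subseteq> dyadic1}. \<Sum>Q\<in>F. beta_term M p Q * indicator Q x)"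
    using assms by (intro SUP_upper) auto
  also have "\<dots> = Jtilde M p x"
    unfolding Jtilde_def beta_term_def by (rule nonneg_infsum_complete[symmetric]) simp
  finally show ?thesis .
qed

text \<open>Expressed by finite partial sums: there are only countably many finite families of
  cubes, which makes the set Borel, and only finite sums are bounded later.\<close>

definition sublevel :: "'a::euclidean_space measure \<Rightarrow> real \<Rightarrow> nat \<Rightarrow> 'a set" where
  "sublevel M p N = {x\<in>cball 0 (real N). \<forall>F\<in>{F. finite F \<and> F \<subseteq> dyadic1}.
     (\<Sum>Q\<in>F. beta_term M p Q * indicator Q x) \<le> of_nat N}"

lemma sublevel_borel: "sublevel M p N \<in> sets borel"
proof -
  let ?\<F> = "{F. finite F \<and> F \<subseteq> (dyadic1 :: 'a set set)}"
  have cnt: "countable ?\<F>"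
    using countable_Collect_finite_subset[OF countable_dyadic1] by (simp add: conj_commute)
  have "{x. (\<Sum>Q\<in>F. beta_term M p Q * indicator Q x) \<le> of_nat N} \<in> sets borel" if "F \<in> ?\<F>" for F
  proof -
    have "Q \<in> sets borel" if "Q \<in> F" for Q
    proof -
      have "Q \<in> dyadic1" using \<open>F \<in> ?\<F>\<close> that by blast
      then obtain k x where "Q = cube k x" unfolding dyadic1_cube by blast
      then show ?thesis by (simp add: cube_borel)
    qed
    then have "(\<lambda>x. \<Sum>Q\<in>F. beta_term M p Q * indicator Q x) \<in> borel_measurable borel"
      by (intro borel_measurable_sum borel_measurable_times_ennreal borel_measurable_const borel_measurable_indicator)
    then show ?thesis by measurable
  qed
  then have "(\<Inter>F\<in>?\<F>. {x. (\<Sum>Q\<in>F. beta_term M p Q * indicator Q x) \<le> of_nat N}) \<in> sets borel"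
    using cnt by (intro sets.countable_INT') auto
  then have "cball 0 (real N) \<inter> (\<Inter>F\<in>?\<F>. {x. (\<Sum>Q\<in>F. beta_term M p Q * indicator Q x) \<le> of_nat N}) \<in> sets borel"
    by (intro sets.Int) auto
  also have "cball 0 (real N) \<inter> (\<Inter>F\<in>?\<F>. {x. (\<Sum>Q\<in>F. beta_term M p Q * indicator Q x) \<le> of_nat N}) = sublevel M p N"
    by (auto simp: sublevel_def)
  finally show ?thesis .
qed

text \<open>Integrating a partial sum over the sublevel set replaces each indicator by the mass of
  that set in \<open>Q\<close>. By density this mass is at least a proportion \<open>1 / j\<close>
  of that of \<open>Q\<close>, which cancels the denominator in \<open>beta_term\<close>.\<close>

lemma sublevel_sum:
  fixes M :: "'a::euclidean_space measure"
  assumes M: "radon_measure M" and F: "finite F" "F \<subseteq> dyadic1"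
    and dense: "\<And>Q. Q \<in> F \<Longrightarrow> Q \<inter> sublevel M p N \<noteq> {} \<and> emeasure M Q \<le> of_nat j * emeasure M (sublevel M p N \<inter> Q)"
  shows "(\<Sum>Q\<in>F. (beta_p M p (dilate3 Q))\<^sup>2 * diameter Q) \<le> real j * (real N * measure M (cball 0 (real N)))"
proof -
  let ?B = "sublevel M p N"
  have sets: "sets M = sets borel" using M by (simp add: radon_measure_def)
  have "?B \<in> sets M" unfolding sets by (rule sublevel_borel)
  moreover have "?B \<subseteq> cball 0 (real N)" unfolding sublevel_def by blast
  ultimately have B: "?B \<in> sets M" "?B \<subseteq> cball 0 (real N)" .
  have Q: "Q \<in> sets M" "bounded Q" if "Q \<in> F" for Q
  proof -
    have "Q \<in> dyadic1" using that F(2) by blast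
    then obtain k x where "Q = cube k x" unfolding dyadic1_cube by blast
    then show "Q \<in> sets M" "bounded Q" by (simp_all add: sets cube_borel cube_bounded)
  qed
  let ?b = "\<lambda>Q. (beta_p M p (dilate3 Q))\<^sup>2 * diameter Q"
  have b0: "0 \<le> ?b Q" if "Q \<in> F" for Q using Q[OF that] by (simp add: diameter_ge_0)
  have term_le: "ennreal (?b Q) \<le> of_nat j * (beta_term M p Q * emeasure M (?B \<inter> Q))" if QF: "Q \<in> F" for Q
  proof (cases "emeasure M Q = 0")
    \<comment> \<open>On a null cube the convention for division by 0 decides:
      \<open>beta_term\<close> is finite because \<open>Q\<close> meets the sublevel set, so the
      numerator must vanish.\<close>
    case True
    obtain x where x: "x \<in> Q" "x \<in> ?B" using dense[OF QF] by blast
    have "{Q} \<in> {F. finite F \<and> F \<subseteq> dyadic1}" using QF F(2) by auto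
    then have "(\<Sum>Q\<in>{Q}. beta_term M p Q * indicator Q x) \<le> of_nat N" using x(2) unfolding sublevel_def by blast
    then have "beta_term M p Q \<le> of_nat N" using x(1) by simp
    then have "beta_term M p Q \<noteq> top" by (auto simp: top_unique)
    then have "ennreal (?b Q) = 0"
      unfolding beta_term_def True ennreal_divide_zero by metis
    then show ?thesis by simp
  next
    case False
    have fin: "emeasure M Q \<noteq> top" using radon_bounded_finite[OF M Q(2)[OF QF]] by auto
    have "ennreal (?b Q) = beta_term M p Q * emeasure M Q"
      unfolding beta_term_def using False fin by (simp add: ennreal_divide_times ennreal_times_divide mult_divide_eq_ennreal)
    also have "\<dots> \<le> beta_term M p Q * (of_nat j * emeasure M (?B \<inter> Q))"
      using dense[OF QF] by (intro mult_left_mono) auto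
    finally show ?thesis by (simp add: mult_ac)
  qed
  have "ennreal (\<Sum>Q\<in>F. ?b Q) = (\<Sum>Q\<in>F. ennreal (?b Q))" using b0 by (rule sum_ennreal[symmetric])
  also have "\<dots> \<le> (\<Sum>Q\<in>F. of_nat j * (beta_term M p Q * emeasure M (?B \<inter> Q)))" by (rule sum_mono) (rule term_le)
  also have "\<dots> = of_nat j * (\<Sum>Q\<in>F. beta_term M p Q * emeasure M (?B \<inter> Q))" by (simp add: sum_distrib_left)
  also have "(\<Sum>Q\<in>F. beta_term M p Q * emeasure M (?B \<inter> Q)) =
      (\<Sum>Q\<in>F. \<integral>\<^sup>+x. beta_term M p Q * indicator (?B \<inter> Q) x \<partial>M)"
    using Q B by (intro sum.cong refl) (simp add: nn_integral_cmult_indicator)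
  also have "\<dots> = (\<integral>\<^sup>+x. (\<Sum>Q\<in>F. beta_term M p Q * indicator (?B \<inter> Q) x) \<partial>M)"
    using Q B by (intro nn_integral_sum[symmetric] borel_measurable_times_ennreal borel_measurable_const borel_measurable_indicator) auto
  also have "\<dots> \<le> (\<integral>\<^sup>+x. of_nat N * indicator ?B x \<partial>M)"
  proof (rule nn_integral_mono)
    fix x
    show "(\<Sum>Q\<in>F. beta_term M p Q * indicator (?B \<inter> Q) x) \<le> of_nat N * indicator ?B x"
    proof (cases "x \<in> ?B")
      case True
      have "F \<in> {F. finite F \<and> F \<subseteq> dyadic1}" using F by simp
      then have "(\<Sum>Q\<in>F. beta_term M p Q * indicator Q x) \<le> of_nat N" using True unfolding sublevel_def by blast
      then show ?thesis using True by (simp add: indicator_inter_arith)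
    qed simp
  qed
  also have "\<dots> = of_nat N * emeasure M ?B" using B by (simp add: nn_integral_cmult_indicator)
  also have "\<dots> \<le> of_nat N * emeasure M (cball 0 (real N))"
    using B(2) sets by (intro mult_left_mono emeasure_mono) auto
  also have "emeasure M (cball 0 (real N)) = ennreal (measure M (cball 0 (real N)))"
    using radon_bounded_finite[OF M, of "cball 0 (real N)"] by (intro emeasure_eq_ennreal_measure) auto
  also have "of_nat j * (of_nat N * ennreal (measure M (cball 0 (real N)))) = ennreal (real j * (real N * measure M (cball 0 (real N))))"
    by (simp add: ennreal_mult' flip: ennreal_of_nat_eq_real_of_nat)
  finally have "ennreal (\<Sum>Q\<in>F. ?b Q) \<le> ennreal (real j * (real N * measure M (cball 0 (real N))))"
    by (simp add: mult_left_mono)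
  then show ?thesis by (simp add: ennreal_le_iff)
qed

text \<open>Support points give balls positive mass, so the bound on the ratio can be multiplied out
  into an inequality of real measures.\<close>

lemma doubling_at:
  fixes M :: "'a::euclidean_space measure"
  assumes M: "radon_measure M" and x: "x \<in> spt M"
    and lim: "Limsup (at_right 0) (\<lambda>r. emeasure M (cball x (2 * r)) / emeasure M (cball x r)) < \<infinity>"
  obtains N :: nat where "\<And>r. 0 < r \<Longrightarrow> r < 1 / real (Suc N) \<Longrightarrow> measure M (cball x (2 * r)) \<le> real N * measure M (cball x r)"
proof -
  obtain c where c: "Limsup (at_right 0) (\<lambda>r. emeasure M (cball x (2 * r)) / emeasure M (cball x r)) < c" "c < \<infinity>"
    using dense[OF lim] by blast
  have "\<forall>\<^sub>F r in at_right 0. emeasure M (cball x (2 * r)) / emeasure M (cball x r) < c"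
    by (rule Limsup_lessD[OF c(1)])
  then obtain d where d: "d > 0" "\<And>r. 0 < r \<Longrightarrow> r < d \<Longrightarrow> emeasure M (cball x (2 * r)) / emeasure M (cball x r) < c"
    by (auto simp: eventually_at_right_field)
  obtain c' where c': "c = ennreal c'" "0 \<le> c'" using c(2) by (cases c) auto
  obtain N1 where N1: "1 / real (Suc N1) < d" using nat_approx_posE[OF d(1)] by blast
  obtain N2 where N2: "c' \<le> real N2" using real_arch_simple by blast
  show ?thesis
  proof (rule that[of "max N1 N2"])
    fix r :: real assume r: "0 < r" "r < 1 / real (Suc (max N1 N2))"
    have "1 / real (Suc (max N1 N2)) \<le> 1 / real (Suc N1)" by (intro divide_left_mono) auto
    then have "r < d" using r N1 by linarith
    have fin: "emeasure M (cball x (s * r)) = ennreal (measure M (cball x (s * r)))" for s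
      using radon_bounded_finite[OF M, of "cball x (s * r)"] by (intro emeasure_eq_ennreal_measure) auto
    have pos: "0 < measure M (cball x r)"
      using r(1) x by (intro spt_measure_pos[OF M, of x r]) auto
    have "ennreal (measure M (cball x (2 * r)) / measure M (cball x r)) < ennreal c'"
      using d(2)[OF r(1) \<open>r < d\<close>] fin[of 2] fin[of 1] pos c'(1) by (simp add: divide_ennreal)
    then have "measure M (cball x (2 * r)) / measure M (cball x r) < c'"
      using c'(2) by (simp add: ennreal_less_iff)
    then have "measure M (cball x (2 * r)) < c' * measure M (cball x r)" using pos by (simp add: divide_less_eq)
    also have "\<dots> \<le> real (max N1 N2) * measure M (cball x r)" using N2 by (intro mult_right_mono) auto
    finally show "measure M (cball x (2 * r)) \<le> real (max N1 N2) * measure M (cball x r)" by simp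
  qed
qed

theorem theorem7p4:
  fixes M :: "'a::euclidean_space measure" and p :: real
  assumes "radon_measure M" and "1 \<le> p"
  shows "one_rectifiable_restr M
           {x \<in> spt M. Limsup (at_right 0) (\<lambda>r. emeasure M (cball x (2 * r)) / emeasure M (cball x r)) < \<infinity>
                       \<and> Jtilde M p x < \<infinity>}"
proof -
  note M = assms(1)
  have sets: "sets M = sets borel" using M by (simp add: radon_measure_def)
  \<comment> \<open>A single \<open>N\<close> serves as doubling constant, as threshold for the
    radii, and as bound for the partial sums and for the norm; this keeps the decomposition
    countable.\<close>
  define G where "G N = {x \<in> spt M. x \<in> sublevel M p N \<and>
    (\<forall>r. 0 < r \<longrightarrow> r < 1 / real (Suc N) \<longrightarrow> measure M (cball x (2 * r)) \<le> real N * measure M (cball x r))}" for N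
  \<comment> \<open>The density refers to the Borel set \<open>sublevel M p N\<close> and not to
    \<open>G N\<close>, so the exceptional set is Borel.\<close>
  define Z where "Z N j = {x\<in>sublevel M p N. \<exists>k. of_nat j * emeasure M (sublevel M p N \<inter> cube k x) < emeasure M (cube k x)}" for N j :: nat
  define A where "A N j = G N - Z N j" for N j
  have GN: "\<exists>N. x \<in> G N"
    if x: "x \<in> spt M" "Limsup (at_right 0) (\<lambda>r. emeasure M (cball x (2 * r)) / emeasure M (cball x r)) < \<infinity>" "Jtilde M p x < \<infinity>" for x
  proof -
    obtain N1 where N1: "\<And>r. 0 < r \<Longrightarrow> r < 1 / real (Suc N1) \<Longrightarrow> measure M (cball x (2 * r)) \<le> real N1 * measure M (cball x r)"
      by (rule doubling_at[OF M x(1,2)]) blast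
    obtain J where J: "Jtilde M p x = ennreal J" "0 \<le> J" using x(3) by (cases "Jtilde M p x") auto
    obtain N2 where N2: "J \<le> real N2" using real_arch_simple by blast
    obtain N3 where N3: "norm x \<le> real N3" using real_arch_simple by blast
    define N where "N = max N1 (max N2 N3)"
    have N: "N1 \<le> N" "N2 \<le> N" "N3 \<le> N" by (simp_all add: N_def)
    have "(\<Sum>Q\<in>F. beta_term M p Q * indicator Q x) \<le> of_nat N" if "finite F" "F \<subseteq> dyadic1" for F
    proof -
      have "(\<Sum>Q\<in>F. beta_term M p Q * indicator Q x) \<le> ennreal J"
        using Jtilde_finite_sum_le[OF that, of M p x] J(1) by simp
      also have "\<dots> \<le> ennreal (real N)" using N2 N(2) by (intro ennreal_leI) linarith
      finally show ?thesis by (simp add: ennreal_of_nat_eq_real_of_nat)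
    qed
    moreover have "norm x \<le> real N" using N3 N(3) by linarith
    ultimately have "x \<in> sublevel M p N" by (simp add: sublevel_def)
    moreover have "measure M (cball x (2 * r)) \<le> real N * measure M (cball x r)"
      if r: "0 < r" "r < 1 / real (Suc N)" for r
    proof -
      have "1 / real (Suc N) \<le> 1 / real (Suc N1)" using N(1) by (intro divide_left_mono) auto
      then have "measure M (cball x (2 * r)) \<le> real N1 * measure M (cball x r)" using r by (intro N1) auto
      also have "\<dots> \<le> real N * measure M (cball x r)" using N(1) by (intro mult_right_mono) auto
      finally show ?thesis .
    qed
    ultimately show ?thesis using x(1) by (auto simp: G_def)
  qed
  \<comment> \<open>\<open>j\<close> times the measure of \<open>Z N j\<close> is at most that of a
    fixed bounded ball containing every cube of side at most 1 that meets the sublevel set. So the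
    points lying in \<open>Z N j\<close> for all \<open>j\<close> form a null set.\<close>
  have null: "(\<Inter>j. Z N j) \<in> null_sets M" for N
  proof -
    let ?U = "ball 0 (real N + DIM('a) + 1) :: 'a set"
    have sp: "Z N j \<in> sets borel" "of_nat j * emeasure M (Z N j) \<le> emeasure M ?U" for j
    proof -
      have U: "cube k x \<subseteq> ?U" if "x \<in> sublevel M p N" for k x
      proof
        fix z assume "z \<in> cube k x"
        then have "dist x z \<le> DIM('a) / 2 ^ k" using cube_subset_cball[of k x] by auto
        also have "\<dots> \<le> DIM('a)" by (simp add: divide_le_eq)
        finally have "dist x z \<le> DIM('a)" .
        moreover have "norm x \<le> real N" using that by (simp add: sublevel_def)
        ultimately show "z \<in> ?U" using norm_triangle_sub[of z x] by (simp add: dist_norm norm_minus_commute)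
      qed
      have "sublevel M p N \<subseteq> ?U" using U cube_self by blast
      from sparse_part[OF M sublevel_borel this open_ball U, of j]
      show "Z N j \<in> sets borel" "of_nat j * emeasure M (Z N j) \<le> emeasure M ?U" by (simp_all add: Z_def)
    qed
    have meas: "(\<Inter>j. Z N j) \<in> sets M" using sp(1) sets by (intro sets.countable_INT) auto
    have "emeasure M (\<Inter>j. Z N j) = 0"
    proof (rule ennreal_zero_if_multiples_bounded)
      show "emeasure M ?U < \<infinity>" by (rule radon_bounded_finite[OF M bounded_ball])
      fix j :: nat
      have "emeasure M (\<Inter>j. Z N j) \<le> emeasure M (Z N j)" using sp(1) sets by (intro emeasure_mono) auto
      then have "of_nat j * emeasure M (\<Inter>j. Z N j) \<le> of_nat j * emeasure M (Z N j)" by (rule mult_left_mono) simp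
      also have "\<dots> \<le> emeasure M ?U" by (rule sp(2))
      finally show "of_nat j * emeasure M (\<Inter>j. Z N j) \<le> emeasure M ?U" .
    qed
    then show ?thesis using meas by auto
  qed
  have curve: "\<exists>f. (\<exists>L. L-lipschitz_on {0..1::real} f) \<and> A N j \<subseteq> f ` {0..1}" for N j
  proof (cases "A N j = {}")
    case True
    then show ?thesis by (intro exI[of _ "\<lambda>_. 0"]) (auto intro!: exI[of _ 0] lipschitz_onI)
  next
    case False
    have AG: "x \<in> spt M" "x \<in> sublevel M p N" "x \<notin> Z N j" if "x \<in> A N j" for x
      using that by (auto simp: A_def G_def)
    have "\<exists>L f. L-lipschitz_on {0..1::real} f \<and> A N j \<subseteq> f ` {0..1}"
    \<comment> \<open>\<open>G N\<close> gives doubling only strictly below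
      \<open>1 / Suc N\<close>, hence the next smaller fraction for \<open>\<delta>\<close>;
      \<open>Suc N\<close> ensures a constant of at least 1.\<close>
    proof (rule doubling_curve[OF M assms(2) _ False, where c = "real (Suc N)" and \<delta> = "1 / real (Suc (Suc N))"])
      show "bounded (A N j)"
        by (rule bounded_subset[OF bounded_cball[of 0 "real N"]]) (use AG(2) in \<open>auto simp: sublevel_def\<close>)
      show "A N j \<subseteq> spt M" using AG(1) by blast
      show "measure M (cball x (2 * \<rho>)) \<le> real (Suc N) * measure M (cball x \<rho>)"
        if "x \<in> A N j" "0 < \<rho>" "\<rho> \<le> 1 / real (Suc (Suc N))" for x \<rho>
      proof -
        have "1 / real (Suc (Suc N)) < 1 / real (Suc N)" by (intro divide_strict_left_mono) auto
        then have "measure M (cball x (2 * \<rho>)) \<le> real N * measure M (cball x \<rho>)"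
          using that by (auto simp: A_def G_def)
        also have "\<dots> \<le> real (Suc N) * measure M (cball x \<rho>)" by (intro mult_right_mono) auto
        finally show ?thesis .
      qed
      fix F :: "'a set set"
      assume F: "finite F" "F \<subseteq> dyadic1" "\<And>Q. Q \<in> F \<Longrightarrow> Q \<inter> A N j \<noteq> {}"
      show "(\<Sum>Q\<in>F. (beta_p M p (dilate3 Q))\<^sup>2 * diameter Q) \<le> real j * (real N * measure M (cball 0 (real N)))"
      proof (rule sublevel_sum[OF M F(1,2)])
        fix Q assume Q: "Q \<in> F"
        then obtain x where x: "x \<in> Q" "x \<in> A N j" using F(3) by blast
        obtain k y where "Q = cube k y" using Q F(2) unfolding dyadic1_cube by blast
        \<comment> \<open>As \<open>Q\<close> is the cube of its level around \<open>x\<close>, the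
          failure of \<open>x \<in> Z N j\<close> gives the density bound for
          \<open>Q\<close>.\<close>
        then have Qx: "Q = cube k x" using x(1) cube_eq by blast
        have "emeasure M Q \<le> of_nat j * emeasure M (sublevel M p N \<inter> Q)"
          using AG(2,3)[OF x(2)] unfolding Qx Z_def by (auto simp: not_less)
        moreover have "Q \<inter> sublevel M p N \<noteq> {}" using x AG(2) by blast
        ultimately show "Q \<inter> sublevel M p N \<noteq> {} \<and> emeasure M Q \<le> of_nat j * emeasure M (sublevel M p N \<inter> Q)" by blast
      qed
    qed auto
    then show ?thesis by blast
  qed
  define f where "f N j = (SOME f. (\<exists>L. L-lipschitz_on {0..1::real} f) \<and> A N j \<subseteq> f ` {0..1})" for N j
  have f: "(\<exists>L. L-lipschitz_on {0..1::real} (f N j)) \<and> A N j \<subseteq> f N j ` {0..1}" for N j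
    unfolding f_def using curve[of N j] by (rule someI_ex)
  define g where "g i = f (fst (prod_decode i)) (snd (prod_decode i))" for i
  let ?T = "{x \<in> spt M. Limsup (at_right 0) (\<lambda>r. emeasure M (cball x (2 * r)) / emeasure M (cball x r)) < \<infinity>
                       \<and> Jtilde M p x < \<infinity>}"
  have "?T \<inter> (UNIV - (\<Union>i. g i ` {0..1})) \<subseteq> (\<Union>N. \<Inter>j. Z N j)"
  proof
    fix x assume x: "x \<in> ?T \<inter> (UNIV - (\<Union>i. g i ` {0..1}))"
    then obtain N where N: "x \<in> G N" using GN by blast
    have "x \<in> Z N j" for j
    proof (rule ccontr)
      assume "x \<notin> Z N j"
      then have "x \<in> f N j ` {0..1}" using N f[of N j] by (auto simp: A_def)
      moreover have "f N j = g (prod_encode (N, j))" by (simp add: g_def)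
      ultimately show False using x by (metis (no_types, lifting) DiffD2 IntD2 UN_I UNIV_I)
    qed
    then show "x \<in> (\<Union>N. \<Inter>j. Z N j)" by blast
  qed
  moreover have "(\<Union>N. \<Inter>j. Z N j) \<in> null_sets M" using null by (intro null_sets_UN)
  ultimately have "outer_null M (?T \<inter> (UNIV - (\<Union>i. g i ` {0..1})))" unfolding outer_null_def by blast
  moreover have "\<forall>i. \<exists>C. C-lipschitz_on {0..1} (g i)" using f by (simp add: g_def)
  ultimately show ?thesis unfolding one_rectifiable_restr_def by blast
qed

end
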